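(* Let $L,g,\mu,m,H_{\max}>0$ be constants, let $h^*:=m/L$, and assume $h^*<H_{\max}$. Let $\varepsilon>0$ satisfy $$\varepsilon^2 K<R\quad\text{and}\quad \varepsilon<\frac{\min(h^*,H_{\max}-h^* )}{\sqrt L},\qquad\text{where } K:=\max\left(\mu^2\left(h^*-\varepsilon\sqrt L\right)^{-1},\,g,\,\tfrac{3H_{\max}}2\right),$$ and let $\xi_0\in\mathbb R$, $\xi_0\neq0$. Consider the following algorithm. Step 1. Pick $r\in(0,R)$ and $q>0$ with $q\le K$ and $\varepsilon^2K<r$ (this is possible because $\varepsilon^2K<R$). Step 2. Select $\sigma,k,\gamma>0$ with $$\frac{2g}{\mu L}>\sigma>\frac{8k}q,\qquad \frac{2\pi^2\mu\,G^{-1}(-cr)}{mL^2\,G^{-1}(cr)}>8\sigma,\qquad \gamma\ge\frac{2\sigma q^2\varepsilon^2}{r-K\varepsilon^2},\qquad k\le\sqrt{\frac1{3q}}\;\frac{\sqrt{r-\varepsilon^2K}}{|\xi_0|}.$$ For these parameters there exist constants $M,\varphi>0$ with the following property (P'): every classical solution of the closed-loop system (CL) described in the context with $\Psi(\xi(0),w(0),h[0],v[0],\zeta(0))\le r$ satisfies, for all $t\ge0$, $(\xi(t),w(t),h[t],v[t])\in X$ and $$\left\|(\xi(t),w(t),h[t]-h^*\chi_{[0,L]},v[t])\right\|_X+|\zeta(t)-w(t)+\gamma\xi(t)|$$ $$\le M e^{-\varphi t}\left(\left\|(\xi(0),w(0),h[0]-h^*\chi_{[0,L]},v[0])\right\|_X+|\zeta(0)-w(0)+\gamma\xi(0)|\right).$$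 Let $M,\varphi>0$ be constants with property (P'). Step 3. Set $$T:=\frac1\varphi\ln\left(\frac{M|\xi_0|+2M\varepsilon}{\varepsilon}\right)$$ and apply the feedback law of (CL) with $\zeta(0)=-\gamma\xi_0$ for $t\in(0,T]$. Then every classical solution of (CL) with $(\xi(0),w(0),h[0],v[0])\in S$, $\xi(0)=\xi_0$, $\zeta(0)=-\gamma\xi_0$ and $$\left\|(0,w(0),h[0]-h^*\chi_{[0,L]},v[0])\right\|_X\le\varepsilon$$ satisfies $\Psi(\xi(0),w(0),h[0],v[0],\zeta(0))\le r$, $$\left\|(\xi(T),w(T),h[T]-h^*\chi_{[0,L]},v[T])\right\|_X\le M e^{-\varphi T}\left(|\xi_0|+2\varepsilon\right)=\varepsilon,$$ and the no-spilling condition $\max(h(t,0),h(t,L))<H_{\max}$ for all $t\in[0,T]$.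
   Context: Notation: $u[t]$ denotes the profile $x\mapsto u(t,x)$; subscripts $t,x$ denote partial derivatives; $\chi_{[0,L]}$ is the characteristic function of $[0,L]$; $\|\cdot\|_2$ is the $L^2(0,L)$ norm. Closed-loop system (CL): $$\dot\xi=w,\quad \dot w=-f,\qquad h_t+(hv)_x=0\ \ (t>0,\ x\in[0,L]),$$ $$(hv)_t+\left(hv^2+\tfrac12 gh^2\right)_x=\mu(hv_x)_x+hf\ \ (t>0,\ x\in(0,L)),$$ $$v(t,0)=v(t,L)=0,\qquad \int_0^L h(t,x)\,dx=m\ \ (t\ge 0),$$ $$\dot\zeta=-\gamma\zeta-\gamma^2\xi-f,\qquad f=-\sigma\left(\mu(h(t,L)-h(t,0))-q(\zeta+(\gamma+k)\xi)\right).$$ Constants and functions: $c:=\frac1{\mu\sqrt g}$ and $R:=\frac{2\mu\sqrt g}{3}\left(2h^*\sqrt{h^*}+\sqrt{H_{\max}}\,\min(H_{\max}-3h^*,0)\right)$. The function $G:(0,+\infty)\to\left(-\frac43h^*\sqrt{h^*},+\infty\right)$, $G(h):=\frac23\,\mathrm{sgn}(h-h^* )\left(h\sqrt h-3h^*\sqrt h+2h^*\sqrt{h^*}\right)$, is an increasing $C^1$ bijection and $G^{-1}$ is its inverse. $S$ is the set of all $(\xi,w,h,v)$ with $(\xi,w)\in\mathbb R^2$, $h\in C^0([0,L];(0,+\infty))\cap H^1(0,L)$, $v\in C^0([0,L])$, $v(0)=v(L)=0$, $\int_0^L h(x)\,dx=m$. On $S$ define $$V(\xi,w,h,v):=\frac12\int_0^L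 h^{-1}\left(hv+\mu h_x\right)^2dx+\frac12\int_0^L hv^2\,dx+g\int_0^L (h-h^* )^2dx+\frac{qk^2}2\xi^2+\frac q2(w+k\xi)^2,$$ $$\Psi(\xi,w,h,v,\zeta):=V(\xi,w,h,v)+\frac{\sigma q^2}{\gamma}(\zeta-w+\gamma\xi)^2,$$ and $X:=\{(\xi,w,h,v)\in S: V(\xi,w,h,v)<R\}$. The norm is $\|(\xi,w,h,v)\|_X:=\left(\xi^2+w^2+\|h\|_2^2+\|h'\|_2^2+\|v\|_2^2\right)^{1/2}$. Classical solution: $\xi\in C^1([0,\infty))\cap C^2((0,\infty))$, $w\in C^0([0,\infty))\cap C^1((0,\infty))$, $v\in C^0([0,\infty)\times[0,L])\cap C^1((0,\infty)\times[0,L])$, $h\in C^1([0,\infty)\times[0,L];(0,\infty))\cap C^2((0,\infty)\times(0,L))$, $v[t]\in C^2((0,L))$ for each $t>0$, $f\in C^0([0,\infty))$, and $\zeta\in C^0([0,\infty))\cap C^1((0,\infty))$, satisfying all the equations. Interpretation: $\xi$ is the position error and $w$ the velocity of a glass (tank) of length $L$ and wall height $H_{\max}$, moved by a robotic arm with acceleration $-f$; $h$ is the water level, $v$ the water velocity relative to the glass, and $\zeta$ the state of a reduced-order observer of the glass velocity. The controller uses only $\xi$, $h(t,0)$, $h(t,L)$, so neither the glass velocity nor the water momentum is measured. *)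

theory Defs
  imports "HOL-Analysis.Analysis"
begin

section \<open>Classes of differentiable functions\<close>

text \<open>
  On a set that is not open, derivatives are relative to the set; on an interval or a rectangle
  they are one-sided at the boundary points belonging to the set.
\<close>

primrec Ck_on :: "nat \<Rightarrow> real set \<Rightarrow> (real \<Rightarrow> real) \<Rightarrow> bool" where
  "Ck_on 0 I u \<longleftrightarrow> continuous_on I u"
| "Ck_on (Suc n) I u \<longleftrightarrow>
     (\<exists>u'. (\<forall>x\<in>I. (u has_real_derivative u' x) (at x within I)) \<and> Ck_on n I u')"

primrec Ck_on2 :: "nat \<Rightarrow> real set \<Rightarrow> real set \<Rightarrow> (real \<Rightarrow> real \<Rightarrow> real) \<Rightarrow> bool" where
  "Ck_on2 0 I J u \<longleftrightarrow> continuous_on (I \<times> J) (\<lambda>(t, x). u t x)"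
| "Ck_on2 (Suc n) I J u \<longleftrightarrow>
     (\<exists>ut ux. (\<forall>t\<in>I. \<forall>x\<in>J. ((\<lambda>s. u s x) has_real_derivative ut t x) (at t within I)
                       \<and> ((\<lambda>y. u t y) has_real_derivative ux t x) (at x within J))
            \<and> Ck_on2 n I J ut \<and> Ck_on2 n I J ux)"

definition dt :: "(real \<Rightarrow> real \<Rightarrow> real) \<Rightarrow> real \<Rightarrow> real \<Rightarrow> real" where
  "dt u t x = vector_derivative (\<lambda>s. u s x) (at t within {0..})"

definition dx :: "real \<Rightarrow> (real \<Rightarrow> real \<Rightarrow> real) \<Rightarrow> real \<Rightarrow> real \<Rightarrow> real" where
  "dx L u t x = vector_derivative (\<lambda>y. u t y) (at x within {0..L})"


section \<open>The spaces \<open>L\<^sup>2(0,L)\<close> and \<open>H\<^sup>1(0,L)\<close>\<close>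

definition L2 :: "real \<Rightarrow> (real \<Rightarrow> real) set" where
  "L2 L = {u. set_borel_measurable lborel {0<..<L} u
            \<and> set_integrable lborel {0<..<L} (\<lambda>x. (u x)\<^sup>2)}"

definition L2_norm :: "real \<Rightarrow> (real \<Rightarrow> real) \<Rightarrow> real" where
  "L2_norm L u = sqrt (LBINT x:{0<..<L}. (u x)\<^sup>2)"

text \<open>The test functions \<open>C\<^sub>c\<^sup>\<infinity>((0,L))\<close>, extended by zero to the real line.\<close>

definition test_fun :: "real \<Rightarrow> (real \<Rightarrow> real) \<Rightarrow> bool" where
  "test_fun L \<eta> \<longleftrightarrow> (\<forall>n. Ck_on n UNIV \<eta>)
     \<and> (\<exists>a b. 0 < a \<and> b < L \<and> (\<forall>x. x \<notin> {a..b} \<longrightarrow> \<eta> x = 0))"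

definition is_weak_deriv :: "real \<Rightarrow> (real \<Rightarrow> real) \<Rightarrow> (real \<Rightarrow> real) \<Rightarrow> bool" where
  "is_weak_deriv L u p \<longleftrightarrow>
     (\<forall>\<eta>. test_fun L \<eta> \<longrightarrow>
        (LBINT x:{0<..<L}. u x * deriv \<eta> x) = - (LBINT x:{0<..<L}. p x * \<eta> x))"

definition H1 :: "real \<Rightarrow> (real \<Rightarrow> real) set" where
  "H1 L = {u \<in> L2 L. \<exists>p \<in> L2 L. is_weak_deriv L u p}"

text \<open>
  A representative of the weak derivative; it is determined up to a null set and is used only
  under integrals over \<open>(0,L)\<close>.
\<close>

definition weak_deriv :: "real \<Rightarrow> (real \<Rightarrow> real) \<Rightarrow> real \<Rightarrow> real" where
  "weak_deriv L u = (SOME p. p \<in> L2 L \<and> is_weak_deriv L u p)"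


section \<open>Constants\<close>

definition h_star :: "real \<Rightarrow> real \<Rightarrow> real" where
  "h_star L m = m / L"

definition R_const :: "real \<Rightarrow> real \<Rightarrow> real \<Rightarrow> real \<Rightarrow> real \<Rightarrow> real" where
  "R_const L g \<mu> m Hmax =
     2 * \<mu> * sqrt g / 3 *
       (2 * h_star L m * sqrt (h_star L m) + sqrt Hmax * min (Hmax - 3 * h_star L m) 0)"

definition c_const :: "real \<Rightarrow> real \<Rightarrow> real" where
  "c_const g \<mu> = 1 / (\<mu> * sqrt g)"

definition G_fun :: "real \<Rightarrow> real \<Rightarrow> real \<Rightarrow> real" where
  "G_fun L m y = 2 / 3 * sgn (y - h_star L m) *
     (y * sqrt y - 3 * h_star L m * sqrt y + 2 * h_star L m * sqrt (h_star L m))"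

definition G_inv :: "real \<Rightarrow> real \<Rightarrow> real \<Rightarrow> real" where
  "G_inv L m = inv_into {0<..} (G_fun L m)"


section \<open>State space and Lyapunov functionals\<close>

type_synonym state = "real \<times> real \<times> (real \<Rightarrow> real) \<times> (real \<Rightarrow> real)"

text \<open>Profiles are functions on the real line of which only the values on \<open>[0,L]\<close> matter.\<close>

definition S_set :: "real \<Rightarrow> real \<Rightarrow> state set" where
  "S_set L m = {(\<xi>, w, h, v).
     continuous_on {0..L} h \<and> (\<forall>x\<in>{0..L}. 0 < h x) \<and> h \<in> H1 L \<and>
     continuous_on {0..L} v \<and> v 0 = 0 \<and> v L = 0 \<and>
     (LBINT x:{0..L}. h x) = m}"

fun V_fun :: "real \<Rightarrow> real \<Rightarrow> real \<Rightarrow> real \<Rightarrow> real \<Rightarrow> real \<Rightarrow> state \<Rightarrow> real" where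
  "V_fun L g \<mu> m q k (\<xi>, w, h, v) =
     1 / 2 * (LBINT x:{0<..<L}. inverse (h x) * (h x * v x + \<mu> * weak_deriv L h x)\<^sup>2)
     + 1 / 2 * (LBINT x:{0..L}. h x * (v x)\<^sup>2)
     + g * (LBINT x:{0..L}. (h x - h_star L m)\<^sup>2)
     + q * k\<^sup>2 / 2 * \<xi>\<^sup>2
     + q / 2 * (w + k * \<xi>)\<^sup>2"

fun \<Psi>_fun :: "real \<Rightarrow> real \<Rightarrow> real \<Rightarrow> real \<Rightarrow> real \<Rightarrow> real \<Rightarrow> real \<Rightarrow> real \<Rightarrow> state \<Rightarrow> real \<Rightarrow> real"
  where
  "\<Psi>_fun L g \<mu> m q \<sigma> k \<gamma> (\<xi>, w, h, v) \<zeta> =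
     V_fun L g \<mu> m q k (\<xi>, w, h, v) + \<sigma> * q\<^sup>2 / \<gamma> * (\<zeta> - w + \<gamma> * \<xi>)\<^sup>2"

definition X_set :: "real \<Rightarrow> real \<Rightarrow> real \<Rightarrow> real \<Rightarrow> real \<Rightarrow> real \<Rightarrow> real \<Rightarrow> state set" where
  "X_set L g \<mu> m Hmax q k = {s \<in> S_set L m. V_fun L g \<mu> m q k s < R_const L g \<mu> m Hmax}"

fun X_norm :: "real \<Rightarrow> state \<Rightarrow> real" where
  "X_norm L (\<xi>, w, h, v) =
     sqrt (\<xi>\<^sup>2 + w\<^sup>2 + (L2_norm L h)\<^sup>2 + (L2_norm L (weak_deriv L h))\<^sup>2 + (L2_norm L v)\<^sup>2)"

text \<open>The deviation \<open>h - h\<^sup>* \<chi>\<close> of a level profile, \<open>\<chi>\<close> being the indicator function of \<open>[0,L]\<close>.\<close>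

definition level_dev :: "real \<Rightarrow> real \<Rightarrow> (real \<Rightarrow> real) \<Rightarrow> real \<Rightarrow> real" where
  "level_dev L m h = (\<lambda>x. h x - h_star L m * indicator {0..L} x)"


section \<open>The closed-loop system\<close>

definition feedback ::
  "real \<Rightarrow> real \<Rightarrow> real \<Rightarrow> real \<Rightarrow> real \<Rightarrow> real \<Rightarrow>
   (real \<Rightarrow> real) \<Rightarrow> (real \<Rightarrow> real \<Rightarrow> real) \<Rightarrow> (real \<Rightarrow> real) \<Rightarrow> real \<Rightarrow> real" where
  "feedback L \<mu> q \<sigma> k \<gamma> \<xi> h \<zeta> t =
     - \<sigma> * (\<mu> * (h t L - h t 0) - q * (\<zeta> t + (\<gamma> + k) * \<xi> t))"

definition classical_solution ::
  "real \<Rightarrow> real \<Rightarrow> real \<Rightarrow> real \<Rightarrow> real \<Rightarrow> real \<Rightarrow> real \<Rightarrow> real \<Rightarrow>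
   (real \<Rightarrow> real) \<Rightarrow> (real \<Rightarrow> real) \<Rightarrow> (real \<Rightarrow> real \<Rightarrow> real) \<Rightarrow> (real \<Rightarrow> real \<Rightarrow> real) \<Rightarrow>
   (real \<Rightarrow> real) \<Rightarrow> bool" where
  "classical_solution L g \<mu> m q \<sigma> k \<gamma> \<xi> w h v \<zeta> \<longleftrightarrow>
    (let f = feedback L \<mu> q \<sigma> k \<gamma> \<xi> h \<zeta> in
       Ck_on 1 {0..} \<xi> \<and> Ck_on 2 {0<..} \<xi>
     \<and> Ck_on 0 {0..} w \<and> Ck_on 1 {0<..} w
     \<and> Ck_on2 0 {0..} {0..L} v \<and> Ck_on2 1 {0<..} {0..L} v
     \<and> Ck_on2 1 {0..} {0..L} h \<and> Ck_on2 2 {0<..} {0<..<L} h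
     \<and> (\<forall>t\<ge>0. \<forall>x\<in>{0..L}. 0 < h t x)
     \<and> (\<forall>t>0. Ck_on 2 {0<..<L} (v t))
     \<and> Ck_on 0 {0..} f
     \<and> Ck_on 0 {0..} \<zeta> \<and> Ck_on 1 {0<..} \<zeta>
     \<and> (\<forall>t>0. (\<xi> has_real_derivative w t) (at t))
     \<and> (\<forall>t>0. (w has_real_derivative - f t) (at t))
     \<and> (\<forall>t>0. \<forall>x\<in>{0..L}. dt h t x + dx L (\<lambda>t x. h t x * v t x) t x = 0)
     \<and> (\<forall>t>0. \<forall>x\<in>{0<..<L}.
          dt (\<lambda>t x. h t x * v t x) t x
            + dx L (\<lambda>t x. h t x * (v t x)\<^sup>2 + 1 / 2 * g * (h t x)\<^sup>2) t x
          = \<mu> * dx L (\<lambda>t x. h t x * dx L v t x) t x + h t x * f t)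
     \<and> (\<forall>t\<ge>0. v t 0 = 0 \<and> v t L = 0)
     \<and> (\<forall>t\<ge>0. (LBINT x:{0..L}. h t x) = m)
     \<and> (\<forall>t>0. (\<zeta> has_real_derivative - \<gamma> * \<zeta> t - \<gamma>\<^sup>2 * \<xi> t - f t) (at t)))"

definition exp_decay_property ::
  "real \<Rightarrow> real \<Rightarrow> real \<Rightarrow> real \<Rightarrow> real \<Rightarrow> real \<Rightarrow> real \<Rightarrow> real \<Rightarrow> real \<Rightarrow> real \<Rightarrow> real \<Rightarrow> real \<Rightarrow> bool"
  where
  "exp_decay_property L g \<mu> m Hmax r q \<sigma> k \<gamma> M \<phi> \<longleftrightarrow>
    (\<forall>\<xi> w h v \<zeta>. classical_solution L g \<mu> m q \<sigma> k \<gamma> \<xi> w h v \<zeta> \<longrightarrow>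
       \<Psi>_fun L g \<mu> m q \<sigma> k \<gamma> (\<xi> 0, w 0, h 0, v 0) (\<zeta> 0) \<le> r \<longrightarrow>
       (\<forall>t\<ge>0. (\<xi> t, w t, h t, v t) \<in> X_set L g \<mu> m Hmax q k \<and>
          X_norm L (\<xi> t, w t, level_dev L m (h t), v t) + \<bar>\<zeta> t - w t + \<gamma> * \<xi> t\<bar>
          \<le> M * exp (- \<phi> * t) *
             (X_norm L (\<xi> 0, w 0, level_dev L m (h 0), v 0) + \<bar>\<zeta> 0 - w 0 + \<gamma> * \<xi> 0\<bar>)))"

end

(* With W = v + mu h_x / h the momentum balance becomes h (W_t + v W_x) = h (f - g h_x), so the fluid part
   of V has the derivative -mu g |h_x|^2 - mu int h v_x^2 + f (2 int h v + mu (h(t,L) - h(t,0))).  The observer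
   error e = zeta - w + gamma xi satisfies e' = -gamma e, and the feedback is f = -sigma (Y - q e) with
   Y = mu (h(t,L) - h(t,0)) - q (w + k xi).  Completing squares makes Psi' <= -kappa Psi as long as the level stays
   between two positive bounds; these bounds follow from |G(h(x))| <= c V, because G'(h) = |h - h^*| / sqrt h
   and h attains its mean h^*.  A continuation argument keeps Psi below a threshold slightly above r for all time.
   The same bound |G(h(x))| <= c V < c R <= G(H_max) excludes spilling. *)
theory Submission
  imports Defs
begin

section \<open>Balance laws on a fixed interval\<close>

text \<open>Two obstacles shape the argument. \<open>V_fun\<close> contains
  \<open>weak_deriv\<close>, an arbitrary representative picked by \<open>SOME\<close>, so weak
  derivatives must first be shown unique almost everywhere, which requires explicit test functions.
  Moreover, classical solutions are twice differentiable only for t > 0 and inside (0,L): h_xt need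
  not extend to the walls, v_xx is known only for each t separately, and at t = 0 the Lyapunov
  functional is merely continuous. Hence the energy balance is obtained by trimming the interval,
  and the strict inequality on \<sigma> pays for the threshold above r. The weight \<sigma> q^2 /
  \<gamma> in \<Psi> makes the observer error contribute exactly -2 \<sigma> (q e)^2, which
  outweighs, after completing squares, the cross terms that e creates through f. The start
  \<zeta>(0) = -\<gamma> \<xi>0 gives e(0) = -w(0), of size at most \<epsilon>; together with the
  \<epsilon> bounding the rest of the initial state this explains the 2 \<epsilon> in T. Applying
  (P') at t = 0 shows M \<ge> 1, hence T \<ge> 0.\<close>

lemma integral_trim:
  fixes f :: "real \<Rightarrow> real"
  assumes f: "continuous_on {0..L} f" and \<delta>: "0 \<le> \<delta>" "2 * \<delta> \<le> L"
    and B: "\<And>x. x \<in> {0..L} \<Longrightarrow> \<bar>f x\<bar> \<le> B"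
  shows "\<bar>integral {0..L} f - integral {\<delta>..L - \<delta>} f\<bar> \<le> 2 * \<delta> * B"
proof -
  have int: "f integrable_on {a..b}" if "0 \<le> a" "b \<le> L" for a b
    using f that by (intro integrable_continuous_interval) (auto elim: continuous_on_subset)
  have b: "\<bar>integral {a..b} f\<bar> \<le> B * (b - a)" if "0 \<le> a" "a \<le> b" "b \<le> L" for a b
    using integral_bound[OF that(2), of f B] continuous_on_subset[OF f, of "{a..b}"] that B by auto
  have "integral {0..L} f = integral {0..\<delta>} f + integral {\<delta>..L} f"
    using \<delta> by (intro Henstock_Kurzweil_Integration.integral_combine[symmetric] int) auto
  also have "integral {\<delta>..L} f = integral {\<delta>..L - \<delta>} f + integral {L - \<delta>..L} f"
    using \<delta> by (intro Henstock_Kurzweil_Integration.integral_combine[symmetric] int) auto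
  finally show ?thesis
    using b[of 0 \<delta>] b[of "L - \<delta>" L] \<delta> by (auto simp: algebra_simps abs_le_iff)
qed

text \<open>The time derivative of the density need not extend to the boundary, so the balance is
  first taken over \<open>[\<delta>, L - \<delta>]\<close>; the boundary fluxes vanish as \<open>\<delta> \<rightarrow> 0\<close>, locally uniformly
  in time.\<close>

lemma balance_law_integral:
  fixes u q s ut :: "real \<Rightarrow> real \<Rightarrow> real"
  assumes L: "0 < L" and t: "0 < t0"
    and cu: "continuous_on ({0<..} \<times> {0..L}) (\<lambda>(t, x). u t x)"
    and cq: "continuous_on ({0<..} \<times> {0..L}) (\<lambda>(t, x). q t x)"
    and cs: "continuous_on ({0<..} \<times> {0..L}) (\<lambda>(t, x). s t x)"
    and cut: "continuous_on ({0<..} \<times> {0<..<L}) (\<lambda>(t, x). ut t x)"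
    and ut: "\<And>t x. 0 < t \<Longrightarrow> x \<in> {0<..<L} \<Longrightarrow> ((\<lambda>t. u t x) has_real_derivative ut t x) (at t)"
    and qx: "\<And>t x. 0 < t \<Longrightarrow> x \<in> {0<..<L} \<Longrightarrow>
               ((\<lambda>x. q t x) has_real_derivative s t x - ut t x) (at x)"
    and q0: "\<And>t. 0 < t \<Longrightarrow> q t 0 = 0" "\<And>t. 0 < t \<Longrightarrow> q t L = 0"
  shows "((\<lambda>t. integral {0..L} (u t)) has_real_derivative integral {0..L} (s t0)) (at t0)"
proof -
  \<comment> \<open>A compact, convex time window around \<open>t0\<close> and away from 0:
    compactness yields uniform bounds and uniform continuity, convexity is what the theorem on
    derivatives of sequences asks for.\<close>
  define S where "S = {t0 / 2..2 * t0}"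
  have Spos: "t > 0" if "t \<in> S" for t using that t by (auto simp: S_def)
  have convS: "convex S" by (simp add: S_def)
  have t0S: "t0 \<in> interior S" using t by (auto simp: S_def)
  have compS: "compact (S \<times> {0..L})" by (auto simp: S_def intro: compact_Times)
  have sub: "S \<times> {0..L} \<subseteq> {0<..} \<times> {0..L}" using Spos by auto
  have slice: "continuous_on {0..L} (f t)" if "continuous_on ({0<..} \<times> {0..L}) (\<lambda>(t, x). f t x)" "t > 0"
    for f :: "real \<Rightarrow> real \<Rightarrow> real" and t
    using continuous_on_compose2[OF that(1), of "{0..L}" "\<lambda>x. (t, x)"] that(2)
    by (force intro: continuous_on_Pair continuous_on_const continuous_on_id)
  have bdd: "\<exists>B>0. \<forall>t\<in>S. \<forall>x\<in>{0..L}. \<bar>f t x\<bar> \<le> B"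
    if "continuous_on ({0<..} \<times> {0..L}) (\<lambda>(t, x). f t x)" for f :: "real \<Rightarrow> real \<Rightarrow> real"
  proof -
    have "bounded ((\<lambda>(t, x). f t x) ` (S \<times> {0..L}))"
      by (intro compact_imp_bounded compact_continuous_image compS continuous_on_subset[OF that sub])
    then show ?thesis unfolding bounded_pos by auto
  qed
  obtain Bu where Bu: "Bu > 0" "\<And>t x. t \<in> S \<Longrightarrow> x \<in> {0..L} \<Longrightarrow> \<bar>u t x\<bar> \<le> Bu" using bdd[OF cu] by blast
  obtain Bs where Bs: "Bs > 0" "\<And>t x. t \<in> S \<Longrightarrow> x \<in> {0..L} \<Longrightarrow> \<bar>s t x\<bar> \<le> Bs" using bdd[OF cs] by blast
  have ucq: "uniformly_continuous_on (S \<times> {0..L}) (\<lambda>(t, x). q t x)"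
    by (intro compact_uniformly_continuous compS continuous_on_subset[OF cq sub])
  \<comment> \<open>With the shift 3, already \<open>n = 0\<close> gives
    \<open>2 * \<delta> n < L\<close>, so every trimmed interval is nondegenerate.\<close>
  define \<delta> where "\<delta> n = L / real (n + 3)" for n
  have \<delta>: "0 < \<delta> n" "2 * \<delta> n < L" for n using L by (auto simp: \<delta>_def field_simps intro: add_pos_nonneg)
  have \<delta>0: "\<delta> \<longlonglongrightarrow> 0" unfolding \<delta>_def by (rule LIMSEQ_ignore_initial_segment[OF lim_const_over_n])
  define F where "F n t = integral {\<delta> n..L - \<delta> n} (u t)" for n t
  define F' where "F' n t = integral {\<delta> n..L - \<delta> n} (ut t)" for n t
  have cslice: "continuous_on {\<delta> n..L - \<delta> n} (ut t)" if "t > 0" for t n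
    using continuous_on_compose2[OF cut, of "{\<delta> n..L - \<delta> n}" "\<lambda>x. (t, x)"] that \<delta>[of n]
    by (force intro: continuous_on_Pair continuous_on_const continuous_on_id)
  have derF: "(F n has_derivative (*) (F' n t)) (at t within S)" if "t \<in> S" for n t
  proof -
    have "((\<lambda>t. integral (cbox (\<delta> n) (L - \<delta> n)) (u t)) has_field_derivative
        integral (cbox (\<delta> n) (L - \<delta> n)) (ut t)) (at t within S)"
    proof (rule leibniz_rule_field_derivative)
      fix x y assume "x \<in> S" "y \<in> cbox (\<delta> n) (L - \<delta> n)"
      then show "((\<lambda>x. u x y) has_field_derivative ut x y) (at x within S)"
        using ut[of x y] Spos[of x] \<delta>[of n] by (auto intro: has_field_derivative_at_within)
    next
      fix x assume "x \<in> S"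
      then show "u x integrable_on cbox (\<delta> n) (L - \<delta> n)"
        using continuous_on_subset[OF slice[OF cu Spos], of x "{\<delta> n..L - \<delta> n}"] \<delta>[of n]
        by (auto intro!: integrable_continuous_interval)
    next
      show "continuous_on (S \<times> cbox (\<delta> n) (L - \<delta> n)) (\<lambda>(t, x). ut t x)"
        by (rule continuous_on_subset[OF cut]) (use Spos \<delta>[of n] in auto)
    qed (use that convS in auto)
    then show ?thesis by (simp add: F_def[abs_def] F'_def has_field_derivative_def)
  qed
  \<comment> \<open>Trades \<open>ut\<close>, possibly unbounded near the walls, for
    \<open>s\<close> and two flux values, which are controlled up to the walls.\<close>
  have F'eq: "F' n t = integral {\<delta> n..L - \<delta> n} (s t) - (q t (L - \<delta> n) - q t (\<delta> n))" if "t > 0" for n t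
  proof -
    have si: "s t integrable_on {\<delta> n..L - \<delta> n}"
      using continuous_on_subset[OF slice[OF cs that], of "{\<delta> n..L - \<delta> n}"] \<delta>[of n]
      by (auto intro!: integrable_continuous_interval)
    have "((\<lambda>x. s t x - ut t x) has_integral (q t (L - \<delta> n) - q t (\<delta> n))) {\<delta> n..L - \<delta> n}"
      using \<delta>[of n] qx[OF that]
      by (intro fundamental_theorem_of_calculus)
         (auto simp: has_real_derivative_iff_has_vector_derivative[symmetric] intro: has_field_derivative_at_within)
    then have "integral {\<delta> n..L - \<delta> n} (\<lambda>x. s t x - ut t x) = q t (L - \<delta> n) - q t (\<delta> n)"
      by (rule integral_unique)
    moreover have "integral {\<delta> n..L - \<delta> n} (\<lambda>x. s t x - ut t x) = integral {\<delta> n..L - \<delta> n} (s t) - F' n t"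
      unfolding F'_def using si cslice[OF that] by (intro integral_diff) (auto intro: integrable_continuous_interval)
    ultimately show ?thesis by simp
  qed
  \<comment> \<open>Three errors of at most e/3 each: the two strips missing from the integral of
    \<open>s\<close>, and the flux at either end, small uniformly in t because \<open>q\<close>
    vanishes at the walls and is uniformly continuous on the compact rectangle.\<close>
  have unif: "\<forall>\<^sub>F n in sequentially. \<forall>t\<in>S. \<forall>h. norm (F' n t * h - integral {0..L} (s t) * h) \<le> e * norm h"
    if e: "e > 0" for e
  proof -
    obtain d where d: "d > 0"
      "\<And>p p'. p \<in> S \<times> {0..L} \<Longrightarrow> p' \<in> S \<times> {0..L} \<Longrightarrow> dist p' p < d \<Longrightarrow>
         dist ((\<lambda>(t, x). q t x) p') ((\<lambda>(t, x). q t x) p) < e / 3"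
      using ucq e unfolding uniformly_continuous_on_def by (metis divide_pos_pos zero_less_numeral)
    have "\<forall>\<^sub>F n in sequentially. \<delta> n < min d (e / (6 * Bs))"
      using order_tendstoD(2)[OF \<delta>0, of "min d (e / (6 * Bs))"] d(1) e Bs(1) by simp
    then show ?thesis
    proof eventually_elim
      case (elim n)
      show ?case
      proof (intro ballI allI)
        fix t h assume tS: "t \<in> S"
        have 1: "\<bar>integral {0..L} (s t) - integral {\<delta> n..L - \<delta> n} (s t)\<bar> \<le> 2 * \<delta> n * Bs"
          using \<delta>[of n] Bs tS Spos by (intro integral_trim slice[OF cs]) auto
        have 2: "2 * \<delta> n * Bs \<le> e / 3" using elim Bs(1) by (auto simp: field_simps)
        have 3: "\<bar>q t (\<delta> n)\<bar> < e / 3"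
          using d(2)[of "(t, 0)" "(t, \<delta> n)"] tS \<delta>[of n] elim q0 Spos[OF tS] by (auto simp: dist_Pair_Pair dist_real_def)
        have 4: "\<bar>q t (L - \<delta> n)\<bar> < e / 3"
          using d(2)[of "(t, L)" "(t, L - \<delta> n)"] tS \<delta>[of n] elim q0 Spos[OF tS] by (auto simp: dist_Pair_Pair dist_real_def)
        have "\<bar>F' n t - integral {0..L} (s t)\<bar> \<le> e"
          using 1 2 3 4 F'eq[OF Spos[OF tS], of n] by linarith
        then show "norm (F' n t * h - integral {0..L} (s t) * h) \<le> e * norm h"
          by (simp add: left_diff_distrib[symmetric] abs_mult mult_right_mono)
      qed
    qed
  qed
  have lim: "(\<lambda>n. F n t) \<longlonglongrightarrow> integral {0..L} (u t)" if "t \<in> S" for t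
  proof -
    have b: "\<bar>integral {0..L} (u t) - F n t\<bar> \<le> \<delta> n * (2 * Bu)" for n
      using integral_trim[OF slice[OF cu Spos[OF that]], of "\<delta> n" Bu] \<delta>[of n] Bu(2)[OF that]
      by (auto simp: F_def algebra_simps)
    have z: "(\<lambda>n. \<delta> n * (2 * Bu)) \<longlonglongrightarrow> 0" using tendsto_mult_left_zero[OF \<delta>0] .
    have "norm (F n t - integral {0..L} (u t)) \<le> \<delta> n * (2 * Bu)" for n
      using b[of n] by (simp add: abs_minus_commute)
    then have "(\<lambda>n. F n t - integral {0..L} (u t)) \<longlonglongrightarrow> 0"
      by (intro Lim_null_comparison[OF _ z] always_eventually) blast
    then show ?thesis by (rule LIM_zero_cancel)
  qed
  have t0: "t0 \<in> S" using t0S interior_subset by blast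
  obtain G where G: "\<And>t. t \<in> S \<Longrightarrow> (\<lambda>n. F n t) \<longlonglongrightarrow> G t"
    "\<And>t. t \<in> S \<Longrightarrow> (G has_derivative (*) (integral {0..L} (s t))) (at t within S)"
    using has_derivative_sequence[OF convS derF unif t0 lim[OF t0]] by blast
  have GU: "G t = integral {0..L} (u t)" if "t \<in> S" for t
    using LIMSEQ_unique[OF G(1)[OF that] lim[OF that]] .
  have "((\<lambda>t. integral {0..L} (u t)) has_derivative (*) (integral {0..L} (s t0))) (at t0 within S)"
    by (rule has_derivative_transform[OF t0 _ G(2)[OF t0]]) (rule GU[symmetric])
  then show ?thesis
    unfolding has_field_derivative_def at_within_interior[OF t0S] .
qed

section \<open>Uniqueness of weak derivatives\<close>

lemma Ck_on_SucD: "Ck_on (Suc n) I u \<Longrightarrow> Ck_on n I u"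
proof (induction n arbitrary: u)
  case 0
  then obtain u' where "\<And>x. x \<in> I \<Longrightarrow> (u has_real_derivative u' x) (at x within I)" by auto
  then have "continuous_on I u" by (rule DERIV_continuous_on)
  then show ?case by simp
next
  case (Suc n)
  then show ?case by (metis Ck_on.simps(2))
qed

lemma Ck_on_const: "Ck_on n I (\<lambda>x. c)"
proof (induction n arbitrary: c)
  case (Suc n)
  then show ?case by (auto intro!: exI[of _ "\<lambda>x. 0"])
qed auto

lemma Ck_on_add: "Ck_on n I u \<Longrightarrow> Ck_on n I v \<Longrightarrow> Ck_on n I (\<lambda>x. u x + v x)"
proof (induction n arbitrary: u v)
  case (Suc n)
  then obtain u' v' where
    "\<forall>x\<in>I. (u has_real_derivative u' x) (at x within I)" "Ck_on n I u'"
    "\<forall>x\<in>I. (v has_real_derivative v' x) (at x within I)" "Ck_on n I v'" by auto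
  then show ?case using Suc.IH by (auto intro!: exI[of _ "\<lambda>x. u' x + v' x"] DERIV_add)
qed (auto intro: continuous_on_add)

lemma Ck_on_mult: "Ck_on n I u \<Longrightarrow> Ck_on n I v \<Longrightarrow> Ck_on n I (\<lambda>x. u x * v x)"
proof (induction n arbitrary: u v)
  case (Suc n)
  then obtain u' v' where
    *: "\<forall>x\<in>I. (u has_real_derivative u' x) (at x within I)" "Ck_on n I u'"
    "\<forall>x\<in>I. (v has_real_derivative v' x) (at x within I)" "Ck_on n I v'" by auto
  have "Ck_on n I (\<lambda>x. u' x * v x + v' x * u x)"
    using *(2,4) Suc.prems[THEN Ck_on_SucD] by (intro Ck_on_add Suc.IH)
  then show ?case using * by (auto intro!: exI[of _ "\<lambda>x. u' x * v x + v' x * u x"] DERIV_mult)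
qed (auto intro: continuous_on_mult)

lemma Ck_on_affine: "Ck_on n UNIV u \<Longrightarrow> Ck_on n UNIV (\<lambda>x. u (c * x + d))"
proof (induction n arbitrary: u)
  case 0
  then show ?case by (auto intro!: continuous_on_compose2[of UNIV u] continuous_intros)
next
  case (Suc n)
  then obtain u' where *: "\<And>x. (u has_real_derivative u' x) (at x)" "Ck_on n UNIV u'" by auto
  have "((\<lambda>x. u (c * x + d)) has_real_derivative u' (c * x + d) * c) (at x)" for x
    by (rule DERIV_chain2[OF *(1)]) (auto intro!: derivative_eq_intros)
  moreover have "Ck_on n UNIV (\<lambda>x. u' (c * x + d) * c)"
    by (intro Ck_on_mult Ck_on_const Suc.IH *(2))
  ultimately show ?case by (auto intro!: exI[of _ "\<lambda>x. u' (c * x + d) * c"])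
qed

text \<open>The flat function \<open>exp (-1/x)\<close> and all its derivatives have this form; the family is closed
  under differentiation.\<close>

definition flat :: "real poly \<Rightarrow> real \<Rightarrow> real" where
  "flat p x = (if x \<le> 0 then 0 else poly p (1 / x) * exp (- (1 / x)))"

lemma poly_times_exp_tendsto_0: "((\<lambda>y. poly p y * exp (- y)) \<longlongrightarrow> (0::real)) at_top"
proof -
  have "((\<lambda>y. \<Sum>i\<le>degree p. coeff p i * (y ^ i / exp y)) \<longlongrightarrow> (\<Sum>i\<le>degree p. coeff p i * 0)) at_top"
    by (intro tendsto_intros tendsto_power_div_exp_0)
  then show ?thesis
    by (simp add: poly_altdef sum_distrib_right sum_divide_distrib exp_minus divide_inverse mult.assoc)
qed

text \<open>With y = 1/x one has d/dx = -y^2 d/dy, which sends p(y) exp(-y) to y^2 (p - p')(y)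
  exp(-y); the factor \<open>[:0, 0, 1:]\<close> is the monomial y^2. At x = 0 the right difference
  quotient is y p(y) exp(-y) with y tending to infinity.\<close>

lemma flat_has_derivative:
  "(flat p has_real_derivative flat ([:0, 0, 1:] * (p - pderiv p)) x) (at x)"
proof -
  consider "x < 0" | "x > 0" | "x = 0" by linarith
  then show ?thesis
  proof cases
    case 1
    have "((\<lambda>x. 0) has_real_derivative 0) (at x)" by simp
    then have "(flat p has_real_derivative 0) (at x)"
      by (rule has_field_derivative_transform_within_open[of _ _ _ "{..<0}"]) (use 1 in \<open>auto simp: flat_def\<close>)
    then show ?thesis using 1 by (simp add: flat_def)
  next
    case 2
    have "((\<lambda>x. poly p (1 / x) * exp (- (1 / x))) has_real_derivative
        flat ([:0, 0, 1:] * (p - pderiv p)) x) (at x)"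
      using 2 unfolding flat_def
      by (auto intro!: derivative_eq_intros simp: field_simps power2_eq_square)
    then show ?thesis
      by (rule has_field_derivative_transform_within_open[of _ _ _ "{0<..}"]) (use 2 in \<open>auto simp: flat_def\<close>)
  next
    case 3
    have "((\<lambda>h. flat p h / h) \<longlongrightarrow> 0) (at_left 0)"
      by (rule Lim_transform_eventually[of "\<lambda>_. 0"])
         (auto simp: flat_def eventually_at_filter)
    moreover have "((\<lambda>h. flat p h / h) \<longlongrightarrow> 0) (at_right 0)"
    proof (rule Lim_transform_eventually)
      show "((\<lambda>h. poly ([:0, 1:] * p) (inverse h) * exp (- inverse h)) \<longlongrightarrow> 0) (at_right 0)"
        by (rule filterlim_compose[OF poly_times_exp_tendsto_0 filterlim_inverse_at_top_right])
      show "\<forall>\<^sub>F h in at_right 0. poly ([:0, 1:] * p) (inverse h) * exp (- inverse h) = flat p h / h"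
        by (auto simp: flat_def eventually_at_filter field_simps)
    qed
    ultimately have "((\<lambda>h. flat p h / h) \<longlongrightarrow> 0) (at 0)" by (simp add: filterlim_split_at)
    then show ?thesis using 3 by (simp add: DERIV_def flat_def)
  qed
qed

lemma Ck_on_flat: "Ck_on n UNIV (flat p)"
proof (induction n arbitrary: p)
  case 0
  have "isCont (flat p) x" for x using flat_has_derivative DERIV_isCont by blast
  then show ?case by (simp add: continuous_on_eq_continuous_at)
next
  case (Suc n)
  then show ?case using flat_has_derivative[of p] by auto
qed

text \<open>A smooth cutoff for the open interval from a to b. The shift by -1 makes both factors
  vanish within 1/n of the endpoints, so the support is compact in (0,L) even when a = 0 and b = L;
  as n grows the values increase to the indicator because \<open>flat 1\<close> tends to 1 at
  infinity.\<close>

definition plateau :: "real \<Rightarrow> real \<Rightarrow> nat \<Rightarrow> real \<Rightarrow> real" where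
  "plateau a b n x = flat 1 (real n * (x - a) - 1) * flat 1 (real n * (b - x) - 1)"

lemma flat_1_bounds: "0 \<le> flat 1 x" "flat 1 x \<le> 1"
  by (auto simp: flat_def)

lemma plateau_bounds: "0 \<le> plateau a b n x" "plateau a b n x \<le> 1"
  by (auto simp: plateau_def intro: mult_le_one flat_1_bounds mult_nonneg_nonneg)

lemma test_fun_plateau:
  assumes "0 \<le> a" "b \<le> L" "0 < n"
  shows "test_fun L (plateau a b n)"
proof -
  have "Ck_on j UNIV (\<lambda>x. flat 1 (real n * x + (- real n * a - 1)) * flat 1 (- real n * x + (real n * b - 1)))" for j
    by (intro Ck_on_mult Ck_on_affine Ck_on_flat)
  then have "Ck_on j UNIV (plateau a b n)" for j
    by (simp add: plateau_def[abs_def] algebra_simps)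
  moreover have "plateau a b n x = 0" if "x \<notin> {a + 1 / real n..b - 1 / real n}" for x
    using that assms(3) by (auto simp: plateau_def flat_def field_simps)
  moreover have "0 < a + 1 / real n" "b - 1 / real n < L"
    using assms by (auto intro: add_nonneg_pos) (metis add_increasing2 diff_less_eq less_add_same_cancel1 less_eq_real_def of_nat_0_less_iff order_le_less_trans zero_less_divide_1_iff)
  ultimately show ?thesis unfolding test_fun_def by blast
qed

lemma plateau_tendsto: "(\<lambda>n. plateau a b n x) \<longlonglongrightarrow> indicator {a<..<b} x"
proof -
  have 1: "(\<lambda>n. flat 1 (real n * d - 1)) \<longlonglongrightarrow> 1" if "d > 0" for d
  proof -
    have l: "filterlim (\<lambda>n. real n * d - 1) at_top sequentially"
      using filterlim_tendsto_add_at_top[OF tendsto_const[of "-1"] filterlim_at_top_mult_tendsto_pos[OF tendsto_const[of d] that filterlim_real_sequentially]]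
      by (simp add: add.commute)
    have "(\<lambda>n. exp (- (1 / (real n * d - 1)))) \<longlonglongrightarrow> exp (- 0)"
      by (intro tendsto_intros real_tendsto_divide_at_top[OF tendsto_const l])
    moreover have "\<forall>\<^sub>F n in sequentially. exp (- (1 / (real n * d - 1))) = flat 1 (real n * d - 1)"
      using filterlim_at_top_dense[THEN iffD1, OF l, rule_format, of 0]
      by eventually_elim (auto simp: flat_def)
    ultimately show ?thesis by (auto intro: Lim_transform_eventually)
  qed
  have 0: "flat 1 (real n * d - 1) = 0" if "d \<le> 0" for d n
  proof -
    have "real n * d \<le> 0" using that by (simp add: mult_nonneg_nonpos)
    then show ?thesis by (simp add: flat_def)
  qed
  show ?thesis
  proof (cases "x \<in> {a<..<b}")
    case True
    have "(\<lambda>n. plateau a b n x) \<longlonglongrightarrow> 1 * 1"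
      unfolding plateau_def using True by (intro tendsto_mult 1) auto
    then show ?thesis using True by simp
  next
    case False
    then have "plateau a b n x = 0" for n using 0 by (auto simp: plateau_def)
    then show ?thesis using False by simp
  qed
qed

section \<open>Lebesgue integrals on an interval and almost everywhere uniqueness\<close>

lemma LBINT_Icc_eq_integral:
  fixes f :: "real \<Rightarrow> real"
  assumes "continuous_on {a..b} f"
  shows "(LBINT x:{a..b}. f x) = integral {a..b} f"
  by (intro set_borel_integral_eq_integral borel_integrable_atLeastAtMost' assms)

lemma set_integrable_Ioo_continuous:
  fixes f :: "real \<Rightarrow> real"
  assumes "continuous_on {a..b} f"
  shows "set_integrable lborel {a<..<b} f"
  by (rule set_integrable_subset[OF borel_integrable_atLeastAtMost'[OF assms]]) auto

lemma LBINT_Ioo_eq_integral: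
  fixes f :: "real \<Rightarrow> real"
  assumes "continuous_on {a..b} f"
  shows "(LBINT x:{a<..<b}. f x) = integral {a..b} f"
  using set_borel_integral_eq_integral(2)[OF set_integrable_Ioo_continuous[OF assms]]
  by (simp add: integral_open_interval_real)

lemma continuous_in_L2:
  assumes "continuous_on {0..L} u"
  shows "u \<in> L2 L"
proof -
  have "set_borel_measurable lborel {0<..<L} u"
    using set_integrable_Ioo_continuous[OF assms] by (auto simp: set_integrable_def set_borel_measurable_def)
  then show ?thesis
    unfolding L2_def using assms by (auto intro!: set_integrable_Ioo_continuous continuous_intros)
qed

text \<open>The positive and negative parts of f are densities of measures with the same finite
  values on all right half-lines. Such half-lines determine a Borel measure, so the two densities
  agree almost everywhere.\<close>

lemma AE_zero_of_right_integrals: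
  fixes f :: "real \<Rightarrow> real"
  assumes f: "integrable lborel f" and 0: "\<And>a. (LBINT x:{a<..}. f x) = 0"
  shows "AE x in lborel. f x = 0"
proof -
  note [measurable] = borel_measurable_integrable[OF f]
  define fp fm where "fp x = max (f x) 0" and "fm x = max (- f x) 0" for x
  have int: "integrable lborel fp" "integrable lborel fm" using f unfolding fp_def[abs_def] fm_def[abs_def] by auto
  have pos: "0 \<le> fp x" "0 \<le> fm x" for x by (auto simp: fp_def fm_def)
  have [measurable]: "fp \<in> borel_measurable lborel" "fm \<in> borel_measurable lborel"
    using int by auto
  have em: "emeasure (density lborel (\<lambda>x. ennreal (g x))) {a<..} = ennreal (LBINT x:{a<..}. g x)"
    if "integrable lborel g" "\<And>x. 0 \<le> g x" for g and a :: real
  proof -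
    have [measurable]: "g \<in> borel_measurable lborel" using that by auto
    have "(\<integral>\<^sup>+x. ennreal (g x) * indicator {a<..} x \<partial>lborel) = (\<integral>\<^sup>+x. ennreal (indicator {a<..} x * g x) \<partial>lborel)"
      by (intro nn_integral_cong) (auto split: split_indicator)
    also have "\<dots> = ennreal (LBINT x:{a<..}. g x)"
      unfolding set_lebesgue_integral_def using that
      by (subst nn_integral_eq_integral) (auto intro!: integrable_mult_indicator[of "{a<..}" lborel g, simplified])
    finally show ?thesis by (simp add: emeasure_density)
  qed
  have eq: "(LBINT x:{a<..}. fp x) = (LBINT x:{a<..}. fm x)" for a
  proof -
    have si: "set_integrable lborel {a<..} fp" "set_integrable lborel {a<..} fm"
      unfolding set_integrable_def by (intro integrable_mult_indicator int; simp)+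
    have "(LBINT x:{a<..}. fp x) - (LBINT x:{a<..}. fm x) = (LBINT x:{a<..}. fp x - fm x)"
      using si by (intro set_integral_diff(2)[symmetric])
    also have "(\<lambda>x. fp x - fm x) = f" by (auto simp: fp_def fm_def)
    finally show ?thesis using 0[of a] by simp
  qed
  have "density lborel (\<lambda>x. ennreal (fp x)) = density lborel (\<lambda>x. ennreal (fm x))"
    by (rule measure_eqI_lessThan) (auto simp: em int eq pos)
  then have "AE x in lborel. ennreal (fp x) = ennreal (fm x)"
    by (intro sigma_finite_measure.density_unique[OF lborel.sigma_finite_measure_axioms]) auto
  then show ?thesis
    by eventually_elim (auto simp: fp_def fm_def max_def split: if_splits)
qed

lemma abs_le_one_add_square: "\<bar>y\<bar> \<le> 1 + y\<^sup>2" for y :: real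
  using zero_le_power2[of "\<bar>y\<bar> - 1 / 2"] by (simp add: power2_eq_square algebra_simps)

text \<open>On a bounded interval \<open>1 + (p x)\<^sup>2\<close> is an integrable majorant of
  |p|.\<close>

lemma L2_integrable:
  assumes "p \<in> L2 L"
  shows "set_integrable lborel {0<..<L} p"
proof -
  have p: "set_borel_measurable lborel {0<..<L} p" "set_integrable lborel {0<..<L} (\<lambda>x. (p x)\<^sup>2)"
    using assms by (auto simp: L2_def)
  have "set_integrable lborel {0<..<L} (\<lambda>x. 1 + (p x)\<^sup>2)"
    by (intro set_integral_add(1) p(2) set_integrable_Ioo_continuous continuous_on_const)
  then show ?thesis
    by (rule set_integrable_bound[OF _ p(1)]) (auto intro!: AE_I2 abs_le_one_add_square)
qed

lemma set_integrable_mult_bounded: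
  fixes p \<eta> :: "real \<Rightarrow> real"
  assumes "set_integrable lborel A p" "\<eta> \<in> borel_measurable borel" "\<And>x. \<bar>\<eta> x\<bar> \<le> B"
  shows "set_integrable lborel A (\<lambda>x. p x * \<eta> x)"
proof -
  have i: "integrable lborel (\<lambda>x. indicator A x *\<^sub>R p x)" using assms(1) by (simp add: set_integrable_def)
  have [measurable]: "(\<lambda>x. indicator A x *\<^sub>R p x) \<in> borel_measurable lborel"
    using borel_measurable_integrable[OF i] .
  note [measurable] = assms(2)
  have "integrable lborel (\<lambda>x. (indicator A x *\<^sub>R p x) * \<eta> x)"
  proof (rule Bochner_Integration.integrable_bound)
    show "integrable lborel (\<lambda>x. B * (indicator A x *\<^sub>R p x))" using i by (rule integrable_mult_right)
    show "AE x in lborel. norm ((indicator A x *\<^sub>R p x) * \<eta> x) \<le> norm (B * (indicator A x *\<^sub>R p x))"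
      using order_trans[OF assms(3) abs_ge_self]
      by (intro AE_I2) (simp add: abs_mult mult.commute[of _ "\<bar>\<eta> _\<bar>"] mult_right_mono)
  qed measurable
  then show ?thesis by (simp add: set_integrable_def mult.assoc)
qed

lemma borel_measurable_plateau [measurable]: "plateau a b n \<in> borel_measurable borel"
proof -
  have [measurable]: "flat 1 \<in> borel_measurable borel"
    using Ck_on_flat[of 0] by (auto intro: borel_measurable_continuous_onI)
  show ?thesis unfolding plateau_def[abs_def] by measurable
qed

text \<open>Testing the difference with plateaus and passing to the limit by dominated convergence
  shows that its integral over every right half-line vanishes.\<close>

lemma weak_derivs_AE_equal:
  assumes p: "p \<in> L2 L" "is_weak_deriv L u p" and p': "p' \<in> L2 L" "is_weak_deriv L u p'"
  shows "AE x in lborel. x \<in> {0<..<L} \<longrightarrow> p x = p' x"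
proof -
  note pi = L2_integrable[OF p(1)] and p'i = L2_integrable[OF p'(1)]
  define d where "d x = indicator {0<..<L} x *\<^sub>R (p x - p' x)" for x
  have di: "integrable lborel d"
    using set_integral_diff(1)[OF pi p'i] by (simp add: set_integrable_def d_def[abs_def])
  have test: "(\<integral>x. d x * plateau a L n x \<partial>lborel) = 0" if "0 \<le> a" "0 < n" for a n
  proof -
    note \<eta> = test_fun_plateau[OF that(1) order_refl that(2)]
    have i: "set_integrable lborel {0<..<L} (\<lambda>x. p x * plateau a L n x)"
      "set_integrable lborel {0<..<L} (\<lambda>x. p' x * plateau a L n x)"
      using plateau_bounds by (auto intro!: set_integrable_mult_bounded[where B=1] pi p'i)
    have "(LBINT x:{0<..<L}. p x * plateau a L n x) = (LBINT x:{0<..<L}. p' x * plateau a L n x)"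
      using p(2) p'(2) \<eta> by (simp add: is_weak_deriv_def)
    then have "(LBINT x:{0<..<L}. p x * plateau a L n x - p' x * plateau a L n x) = 0"
      using set_integral_diff(2)[OF i] by simp
    then show ?thesis by (simp add: set_lebesgue_integral_def d_def left_diff_distrib mult.assoc)
  qed
  have "(LBINT x:{a<..}. d x) = 0" for a
  proof -
    \<comment> \<open>A plateau is a test function only for a nonnegative left endpoint and positive
      index, hence \<open>max a 0\<close> and \<open>Suc n\<close>. The limit is still the half-line
      from a, because \<open>d\<close> is zero outside (0,L).\<close>
    have "(\<lambda>n. \<integral>x. d x * plateau (max a 0) L (Suc n) x \<partial>lborel) \<longlonglongrightarrow> (\<integral>x. indicator {a<..} x *\<^sub>R d x \<partial>lborel)"
    proof (rule integral_dominated_convergence)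
      show "integrable lborel (\<lambda>x. \<bar>d x\<bar>)" using di by simp
      show "AE x in lborel. (\<lambda>n. d x * plateau (max a 0) L (Suc n) x) \<longlonglongrightarrow> indicator {a<..} x *\<^sub>R d x"
      proof (rule AE_I2)
        fix x
        have "(\<lambda>n. d x * plateau (max a 0) L (Suc n) x) \<longlonglongrightarrow> d x * indicator {max a 0<..<L} x"
          by (intro tendsto_mult tendsto_const LIMSEQ_Suc plateau_tendsto)
        moreover have "d x * indicator {max a 0<..<L} x = indicator {a<..} x *\<^sub>R d x"
          by (auto simp: d_def split: split_indicator)
        ultimately show "(\<lambda>n. d x * plateau (max a 0) L (Suc n) x) \<longlonglongrightarrow> indicator {a<..} x *\<^sub>R d x" by simp
      qed
      show "AE x in lborel. norm (d x * plateau (max a 0) L (Suc n) x) \<le> \<bar>d x\<bar>" for n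
        using plateau_bounds by (intro AE_I2) (auto simp: abs_mult intro!: mult_left_le)
    qed (use borel_measurable_integrable[OF di] in measurable)
    then show ?thesis
      using LIMSEQ_unique[OF _ tendsto_const[of 0]] by (simp add: test set_lebesgue_integral_def)
  qed
  then have "AE x in lborel. d x = 0" by (rule AE_zero_of_right_integrals[OF di])
  then show ?thesis by eventually_elim (auto simp: d_def)
qed


section \<open>Weak derivatives of continuously differentiable profiles\<close>

lemma continuous_Ck_on_deriv:
  assumes "Ck_on 1 UNIV \<eta>"
  shows "continuous_on A \<eta>" "continuous_on A (deriv \<eta>)" "(\<eta> has_real_derivative deriv \<eta> x) (at x)"
proof -
  obtain \<eta>' where \<eta>': "\<And>x. (\<eta> has_real_derivative \<eta>' x) (at x)" "continuous_on UNIV \<eta>'"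
    using assms by auto
  then have "deriv \<eta> = \<eta>'" by (auto intro: DERIV_imp_deriv)
  with \<eta>' show "continuous_on A (deriv \<eta>)" "(\<eta> has_real_derivative deriv \<eta> x) (at x)"
    by (auto elim: continuous_on_subset)
  show "continuous_on A \<eta>" using \<eta>' by (meson DERIV_isCont continuous_at_imp_continuous_on)
qed

lemma C1_is_weak_deriv:
  assumes L: "0 \<le> L"
    and u: "\<And>x. x \<in> {0..L} \<Longrightarrow> (u has_real_derivative u' x) (at x within {0..L})"
    and u': "continuous_on {0..L} u'"
  shows "is_weak_deriv L u u'"
  unfolding is_weak_deriv_def
proof (intro allI impI)
  fix \<eta> assume \<eta>: "test_fun L \<eta>"
  have C1: "Ck_on 1 UNIV \<eta>" using \<eta> unfolding test_fun_def by blast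
  obtain a b where "0 < a" "b < L" "\<forall>x. x \<notin> {a..b} \<longrightarrow> \<eta> x = 0"
    using \<eta> unfolding test_fun_def by blast
  then have z: "\<eta> 0 = 0" "\<eta> L = 0" by auto
  note \<eta>c = continuous_Ck_on_deriv[OF C1]
  have uc: "continuous_on {0..L} u" using u by (rule DERIV_continuous_on)
  have "((\<lambda>x. u x * \<eta> x) has_real_derivative u' x * \<eta> x + deriv \<eta> x * u x) (at x within {0..L})"
    if "x \<in> {0..L}" for x
    by (intro DERIV_mult u[OF that] has_field_derivative_at_within[OF \<eta>c(3)])
  then have "((\<lambda>x. u' x * \<eta> x + deriv \<eta> x * u x) has_integral (u L * \<eta> L - u 0 * \<eta> 0)) {0..L}"
    using L by (intro fundamental_theorem_of_calculus)
      (auto simp: has_real_derivative_iff_has_vector_derivative[symmetric])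
  then have "integral {0..L} (\<lambda>x. u' x * \<eta> x + deriv \<eta> x * u x) = 0" using z by (simp add: integral_unique)
  moreover have "integral {0..L} (\<lambda>x. u' x * \<eta> x + deriv \<eta> x * u x) =
      integral {0..L} (\<lambda>x. u' x * \<eta> x) + integral {0..L} (\<lambda>x. u x * deriv \<eta> x)"
    unfolding mult.commute[of "deriv \<eta> _"]
    by (intro Henstock_Kurzweil_Integration.integral_add integrable_continuous_interval continuous_intros u' uc \<eta>c)
  ultimately show "(LBINT x:{0<..<L}. u x * deriv \<eta> x) = - (LBINT x:{0<..<L}. u' x * \<eta> x)"
    by (subst (1 2) LBINT_Ioo_eq_integral) (auto intro!: continuous_intros u' uc \<eta>c)
qed

text \<open>The classical derivative is one admissible weak derivative, so the choice by
  \<open>SOME\<close> is well founded, and uniqueness identifies its result with u' almost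
  everywhere.\<close>

lemma C1_weak_deriv:
  assumes L: "0 \<le> L"
    and u: "\<And>x. x \<in> {0..L} \<Longrightarrow> (u has_real_derivative u' x) (at x within {0..L})"
    and u': "continuous_on {0..L} u'"
  shows "u \<in> H1 L" "weak_deriv L u \<in> L2 L"
    "AE x in lborel. x \<in> {0<..<L} \<longrightarrow> weak_deriv L u x = u' x"
proof -
  have uc: "continuous_on {0..L} u" using u by (rule DERIV_continuous_on)
  have *: "u' \<in> L2 L" "is_weak_deriv L u u'"
    using continuous_in_L2[OF u'] C1_is_weak_deriv[OF assms] by auto
  then show "u \<in> H1 L" using continuous_in_L2[OF uc] by (auto simp: H1_def)
  have **: "weak_deriv L u \<in> L2 L \<and> is_weak_deriv L u (weak_deriv L u)"
    unfolding weak_deriv_def using * by (intro someI[of "\<lambda>p. p \<in> L2 L \<and> is_weak_deriv L u p"]) simp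
  then show "weak_deriv L u \<in> L2 L" by simp
  show "AE x in lborel. x \<in> {0<..<L} \<longrightarrow> weak_deriv L u x = u' x"
    using ** * by (intro weak_derivs_AE_equal) auto
qed

text \<open>The weighted square covers both places where \<open>weak_deriv\<close> occurs under an
  integral: the first term of V (a = 1/h, b = h v, c = \<mu>) and the norm of the slope (a = 1, b =
  0, c = 1).\<close>

lemma LBINT_weak_deriv:
  fixes F :: "real \<Rightarrow> real \<Rightarrow> real"
  assumes L: "0 \<le> L"
    and u: "\<And>x. x \<in> {0..L} \<Longrightarrow> (u has_real_derivative u' x) (at x within {0..L})"
    and u': "continuous_on {0..L} u'"
    and ab: "continuous_on {0..L} a" "continuous_on {0..L} b"
  shows "(LBINT x:{0<..<L}. a x * (b x + c * weak_deriv L u x)\<^sup>2) =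
    integral {0..L} (\<lambda>x. a x * (b x + c * u' x)\<^sup>2)"
proof -
  let ?i = "\<lambda>x. indicator {0<..<L} x :: real"
  have m: "(\<lambda>x. ?i x *\<^sub>R w x) \<in> borel_measurable borel" if "continuous_on {0..L} w" for w :: "real \<Rightarrow> real"
    using borel_measurable_integrable[OF set_integrable_Ioo_continuous[OF that, unfolded set_integrable_def]] by simp
  note [measurable] = m[OF ab(1)] m[OF ab(2)] m[OF u']
  have [measurable]: "(\<lambda>x. ?i x *\<^sub>R weak_deriv L u x) \<in> borel_measurable borel"
    using C1_weak_deriv(2)[OF L u u'] by (auto simp: L2_def set_borel_measurable_def)
  have ae: "AE x in lborel. x \<in> {0<..<L} \<longrightarrow> weak_deriv L u x = u' x"
    by (rule C1_weak_deriv(3)[OF L u u'])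
  \<comment> \<open>The functions are known to be measurable only after truncation to (0,L). Since
    the indicator is idempotent, it can be attached to each factor separately before the almost
    everywhere replacement.\<close>
  have "(LBINT x:{0<..<L}. a x * (b x + c * weak_deriv L u x)\<^sup>2) =
     (\<integral>x. (?i x *\<^sub>R a x) * (?i x *\<^sub>R b x + c * (?i x *\<^sub>R weak_deriv L u x))\<^sup>2 \<partial>lborel)"
    unfolding set_lebesgue_integral_def by (intro Bochner_Integration.integral_cong) (auto split: split_indicator)
  also have "\<dots> = (\<integral>x. (?i x *\<^sub>R a x) * (?i x *\<^sub>R b x + c * (?i x *\<^sub>R u' x))\<^sup>2 \<partial>lborel)"
  proof (rule integral_cong_AE)
    show "AE x in lborel. (?i x *\<^sub>R a x) * (?i x *\<^sub>R b x + c * (?i x *\<^sub>R weak_deriv L u x))\<^sup>2 =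
       (?i x *\<^sub>R a x) * (?i x *\<^sub>R b x + c * (?i x *\<^sub>R u' x))\<^sup>2"
      using ae by eventually_elim (auto split: split_indicator)
  qed measurable
  also have "\<dots> = (LBINT x:{0<..<L}. a x * (b x + c * u' x)\<^sup>2)"
    unfolding set_lebesgue_integral_def by (intro Bochner_Integration.integral_cong) (auto split: split_indicator)
  also have "\<dots> = integral {0..L} (\<lambda>x. a x * (b x + c * u' x)\<^sup>2)"
    by (intro LBINT_Ioo_eq_integral continuous_intros ab u')
  finally show ?thesis .
qed

section \<open>The level function \<open>G\<close>\<close>

text \<open>The polynomial in sqrt y is the antiderivative of (y - a) / sqrt y that vanishes at y =
  a: it is G for a = h^*, up to the sign factor.\<close>

lemma G_poly_has_derivative:
  fixes a y :: real
  assumes "0 < y"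
  shows "((\<lambda>y. 2 / 3 * (y * sqrt y - 3 * a * sqrt y + 2 * a * sqrt a)) has_real_derivative
    (y - a) / sqrt y) (at y)"
proof -
  have s: "sqrt y * sqrt y = y" "sqrt y > 0" using assms by auto
  have "((\<lambda>y. 2 / 3 * (y * sqrt y - 3 * a * sqrt y + 2 * a * sqrt a)) has_real_derivative
      2 / 3 * ((sqrt y + y * (inverse (sqrt y) / 2)) - 3 * a * (inverse (sqrt y) / 2))) (at y)"
    using assms by (auto intro!: derivative_eq_intros)
  also have "2 / 3 * ((sqrt y + y * (inverse (sqrt y) / 2)) - 3 * a * (inverse (sqrt y) / 2)) = (y - a) / sqrt y"
  proof -
    define r where "r = sqrt y"
    have r: "r > 0" "y = r * r" using s by (auto simp: r_def)
    have "2 / 3 * ((r + r * r * (inverse r / 2)) - 3 * a * (inverse r / 2)) = (r * r - a) / r"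
      using r(1) by (simp add: field_simps)
    then show ?thesis unfolding r_def[symmetric] r(2)[symmetric] .
  qed
  finally show ?thesis .
qed

context
  fixes L m hs :: real
  assumes hs: "hs = h_star L m" and hs_pos: "0 < hs"
begin

lemma G_fun_h_star: "G_fun L m hs = 0"
  by (simp add: G_fun_def hs)

lemma G_fun_ge: "hs \<le> y \<Longrightarrow> G_fun L m y = 2 / 3 * (y * sqrt y - 3 * hs * sqrt y + 2 * hs * sqrt hs)"
  by (cases "y = hs") (auto simp: G_fun_def hs[symmetric])

lemma G_fun_le: "y \<le> hs \<Longrightarrow> G_fun L m y = - (2 / 3 * (y * sqrt y - 3 * hs * sqrt y + 2 * hs * sqrt hs))"
  by (cases "y = hs") (auto simp: G_fun_def hs[symmetric])

lemma G_fun_has_derivative: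
  assumes y: "0 < y"
  shows "(G_fun L m has_real_derivative \<bar>y - hs\<bar> / sqrt y) (at y)"
proof -
  note P = G_poly_has_derivative[of _ hs]
  consider "y < hs" | "hs < y" | "y = hs" by linarith
  then show ?thesis
  proof cases
    case 1
    have "- ((y - hs) / sqrt y) = \<bar>y - hs\<bar> / sqrt y" using 1 by (simp add: minus_divide_left)
    with DERIV_minus[OF P[OF y]]
    have "((\<lambda>y. - (2 / 3 * (y * sqrt y - 3 * hs * sqrt y + 2 * hs * sqrt hs)))
        has_real_derivative \<bar>y - hs\<bar> / sqrt y) (at y)" by simp
    then show ?thesis
      by (rule has_field_derivative_transform_within_open[where S = "{..<hs}"]) (use 1 G_fun_le in auto)
  next
    case 2
    have "(y - hs) / sqrt y = \<bar>y - hs\<bar> / sqrt y" using 2 by simp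
    with P[OF y]
    have "((\<lambda>y. 2 / 3 * (y * sqrt y - 3 * hs * sqrt y + 2 * hs * sqrt hs))
        has_real_derivative \<bar>y - hs\<bar> / sqrt y) (at y)" by simp
    then show ?thesis
      by (rule has_field_derivative_transform_within_open[where S = "{hs<..}"]) (use 2 G_fun_ge in auto)
  next
    \<comment> \<open>At the point of sign change the difference quotients of G and of the unsigned
      polynomial agree in absolute value, and the latter tend to 0.\<close>
    case 3
    let ?p = "\<lambda>y. 2 / 3 * (y * sqrt y - 3 * hs * sqrt y + 2 * hs * sqrt hs)"
    have "((\<lambda>k. (?p (hs + k) - ?p hs) / k) \<longlongrightarrow> 0) (at 0)"
      using P[OF hs_pos] by (simp add: DERIV_def)
    then have "((\<lambda>k. \<bar>(?p (hs + k) - ?p hs) / k\<bar>) \<longlongrightarrow> 0) (at 0)" by (rule tendsto_rabs_zero)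
    moreover have "\<bar>(?p (hs + k) - ?p hs) / k\<bar> = \<bar>(G_fun L m (hs + k) - G_fun L m hs) / k\<bar>" for k
      by (cases "0 \<le> k") (auto simp: G_fun_ge G_fun_le abs_divide G_fun_h_star)
    ultimately have "((\<lambda>k. \<bar>(G_fun L m (hs + k) - G_fun L m hs) / k\<bar>) \<longlongrightarrow> 0) (at 0)" by simp
    then have "((\<lambda>k. (G_fun L m (hs + k) - G_fun L m hs) / k) \<longlongrightarrow> 0) (at 0)"
      by (rule tendsto_rabs_zero_cancel)
    then show ?thesis using 3 by (simp add: DERIV_def)
  qed
qed

lemma continuous_on_G_fun: "A \<subseteq> {0<..} \<Longrightarrow> continuous_on A (G_fun L m)"
  by (meson DERIV_isCont G_fun_has_derivative continuous_at_imp_continuous_on greaterThan_iff subsetD)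

text \<open>The derivative is positive except at \<open>hs\<close>, so monotonicity is obtained on
  either side and chained through \<open>hs\<close>.\<close>

lemma G_fun_strict_mono:
  assumes "0 < y" "y < z"
  shows "G_fun L m y < G_fun L m z"
proof -
  have *: "G_fun L m y < G_fun L m z" if "0 < y" "y < z" "z \<le> hs \<or> hs \<le> y" for y z
  proof (rule DERIV_pos_imp_increasing_open[OF that(2)])
    fix x assume "y < x" "x < z"
    then show "\<exists>d. (G_fun L m has_real_derivative d) (at x) \<and> 0 < d"
      using that G_fun_has_derivative[of x] by (intro exI[of _ "\<bar>x - hs\<bar> / sqrt x"]) auto
  qed (use that in \<open>auto intro: continuous_on_G_fun\<close>)
  show ?thesis
    using *[of y z] *[of y hs] *[of hs z] assms by linarith
qed

text \<open>The bound on |s| is minus the limit of G at 0, so the intermediate value theorem applies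
  below \<open>hs\<close> for s \<le> 0 and above \<open>hs\<close> for s > 0.\<close>

lemma G_inv_props:
  assumes s: "\<bar>s\<bar> < 4 / 3 * (hs * sqrt hs)"
  shows "0 < G_inv L m s" "G_fun L m (G_inv L m s) = s"
proof -
  have "\<exists>y>0. G_fun L m y = s"
  proof (cases "s \<le> 0")
    case True
    \<comment> \<open>This form is continuous down to y = 0, where it equals -4/3 times
      \<open>hs * sqrt hs\<close>; the strict bound on s then rules out the root y = 0.\<close>
    let ?p = "\<lambda>y. - (2 / 3 * (y * sqrt y - 3 * hs * sqrt y + 2 * hs * sqrt hs))"
    have "\<exists>y\<ge>0. y \<le> hs \<and> ?p y = s"
      using True s hs_pos by (intro IVT') (auto intro!: continuous_intros)
    then obtain y where y: "0 \<le> y" "y \<le> hs" "?p y = s" by auto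
    have "y \<noteq> 0" using y(3) s by auto
    then show ?thesis using y by (auto simp: G_fun_le intro!: exI[of _ y])
  next
    case False
    \<comment> \<open>The endpoint \<open>4 * hs\<close> has a simple square root, and G takes there
      twice the value that bounds |s|.\<close>
    have "sqrt (4 * hs) = 2 * sqrt hs" by (simp add: real_sqrt_mult)
    then have "G_fun L m (4 * hs) = 8 / 3 * (hs * sqrt hs)"
      using hs_pos by (simp add: G_fun_ge)
    moreover have "0 < hs * sqrt hs" using hs_pos by simp
    ultimately have "s \<le> G_fun L m (4 * hs)" using s by linarith
    then have "\<exists>y\<ge>hs. y \<le> 4 * hs \<and> G_fun L m y = s"
      using False hs_pos by (intro IVT') (auto simp: G_fun_h_star intro!: continuous_on_G_fun)
    then obtain y where "hs \<le> y" "G_fun L m y = s" by blast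
    then show ?thesis using hs_pos by (intro exI[of _ y]) auto
  qed
  then have "s \<in> G_fun L m ` {0<..}" by auto
  then show "0 < G_inv L m s" "G_fun L m (G_inv L m s) = s"
    using inv_into_into[of s "G_fun L m" "{0<..}"] f_inv_into_f[of s "G_fun L m" "{0<..}"]
    by (auto simp: G_inv_def)
qed

end

section \<open>Energy of a level profile\<close>

text \<open>Cauchy-Schwarz against the constant 1, obtained by integrating the nonnegative function
  (L |f| - I)^2, where I is the integral of |f|.\<close>

lemma abs_integral_power2_le:
  fixes f :: "real \<Rightarrow> real"
  assumes L: "0 < L" and f: "continuous_on {0..L} f"
  shows "(integral {0..L} (\<lambda>x. \<bar>f x\<bar>))\<^sup>2 \<le> L * integral {0..L} (\<lambda>x. (f x)\<^sup>2)"
proof -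
  define I where "I = integral {0..L} (\<lambda>x. \<bar>f x\<bar>)"
  note ci = integrable_continuous_interval continuous_intros f
  have "0 \<le> integral {0..L} (\<lambda>x. (L * \<bar>f x\<bar> - I)\<^sup>2)"
    by (intro integral_nonneg ci) auto
  also have "(\<lambda>x. (L * \<bar>f x\<bar> - I)\<^sup>2) = (\<lambda>x. L\<^sup>2 * (f x)\<^sup>2 - 2 * L * I * \<bar>f x\<bar> + I\<^sup>2)"
    by (auto simp: power2_eq_square algebra_simps)
  also have "integral {0..L} (\<lambda>x. L\<^sup>2 * (f x)\<^sup>2 - 2 * L * I * \<bar>f x\<bar> + I\<^sup>2) =
      integral {0..L} (\<lambda>x. L\<^sup>2 * (f x)\<^sup>2) - integral {0..L} (\<lambda>x. 2 * L * I * \<bar>f x\<bar>) + integral {0..L} (\<lambda>x. I\<^sup>2)"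
    by (subst integral_add integral_diff; (intro ci)?)+ simp
  also have "\<dots> = L\<^sup>2 * integral {0..L} (\<lambda>x. (f x)\<^sup>2) - 2 * L * I * I + I\<^sup>2 * L"
    using L by (simp add: I_def)
  also have "\<dots> = L * (L * integral {0..L} (\<lambda>x. (f x)\<^sup>2) - I\<^sup>2)"
    by (simp add: power2_eq_square algebra_simps)
  finally show ?thesis using L by (simp add: zero_le_mult_iff I_def)
qed

lemma increment_le_integral_deriv:
  fixes F F' :: "real \<Rightarrow> real"
  assumes F: "\<And>x. x \<in> {a..b} \<Longrightarrow> (F has_real_derivative F' x) (at x within {a..b})"
    and F': "continuous_on {a..b} F'" and xy: "a \<le> x" "x \<le> y" "y \<le> b"
  shows "\<bar>F y - F x\<bar> \<le> integral {x..y} (\<lambda>x. \<bar>F' x\<bar>)"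
proof -
  have c: "continuous_on {x..y} F'" using F' by (rule continuous_on_subset) (use xy in auto)
  have d: "(F has_real_derivative F' z) (at z within {x..y})" if "z \<in> {x..y}" for z
    by (rule DERIV_subset[OF F]) (use that xy in auto)
  have "(F' has_integral (F y - F x)) {x..y}"
    using xy d by (intro fundamental_theorem_of_calculus)
      (auto simp: has_real_derivative_iff_has_vector_derivative[symmetric])
  then have "F y - F x = integral {x..y} F'" by (simp add: integral_unique)
  also have "\<bar>\<dots>\<bar> \<le> integral {x..y} (\<lambda>x. \<bar>F' x\<bar>)"
    using integral_norm_bound_integral[of F' "{x..y}" "\<lambda>x. \<bar>F' x\<bar>"]
    by (auto intro!: integrable_continuous_interval continuous_intros c)
  finally show ?thesis .
qed

lemma oscillation_le_integral_deriv:
  fixes F F' :: "real \<Rightarrow> real"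
  assumes F: "\<And>x. x \<in> {a..b} \<Longrightarrow> (F has_real_derivative F' x) (at x within {a..b})"
    and F': "continuous_on {a..b} F'" and xy: "x \<in> {a..b}" "y \<in> {a..b}"
  shows "\<bar>F y - F x\<bar> \<le> integral {a..b} (\<lambda>x. \<bar>F' x\<bar>)"
proof -
  have *: "\<bar>F y - F x\<bar> \<le> integral {a..b} (\<lambda>x. \<bar>F' x\<bar>)" if "a \<le> x" "x \<le> y" "y \<le> b" for x y
  proof -
    have "integral {x..y} (\<lambda>x. \<bar>F' x\<bar>) \<le> integral {a..b} (\<lambda>x. \<bar>F' x\<bar>)"
      using that by (intro integral_subset_le)
        (auto intro!: integrable_continuous_interval continuous_intros continuous_on_subset[OF F'])
    then show ?thesis using increment_le_integral_deriv[OF F F' that] by linarith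
  qed
  show ?thesis using *[of x y] *[of y x] xy by (cases "x \<le> y") (auto simp: abs_minus_commute)
qed

section \<open>Pointwise estimates of the energy density\<close>

text \<open>The integrand of the fluid part of V at one point, as a function of level a, slope b and
  velocity c. In this form it can be estimated by algebra and differentiated along t as well as
  along x.\<close>

definition energy_density :: "real \<Rightarrow> real \<Rightarrow> real \<Rightarrow> real \<Rightarrow> real \<Rightarrow> real \<Rightarrow> real" where
  "energy_density g \<mu> hs a b c = (a * c + \<mu> * b)\<^sup>2 / (2 * a) + a * c\<^sup>2 / 2 + g * (a - hs)\<^sup>2"

lemma energy_density_alt:
  "energy_density g \<mu> hs a b c =
     1 / 2 * (inverse a * (a * c + \<mu> * b)\<^sup>2) + 1 / 2 * (a * c\<^sup>2) + g * (a - hs)\<^sup>2"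
proof -
  have "(a * c + \<mu> * b)\<^sup>2 / (2 * a) = 1 / 2 * (inverse a * (a * c + \<mu> * b)\<^sup>2)" "a * c\<^sup>2 / 2 = 1 / 2 * (a * c\<^sup>2)"
    by (simp_all add: inverse_eq_divide)
  then show ?thesis unfolding energy_density_def by linarith
qed

definition fluid_energy ::
  "real \<Rightarrow> real \<Rightarrow> real \<Rightarrow> real \<Rightarrow> (real \<Rightarrow> real) \<Rightarrow> (real \<Rightarrow> real) \<Rightarrow> (real \<Rightarrow> real) \<Rightarrow> real" where
  "fluid_energy L g \<mu> hs h hx v = integral {0..L} (\<lambda>x. energy_density g \<mu> hs (h x) (hx x) (v x))"

text \<open>The left side is the exact minimum over the velocity, attained where 2 a c = -\<mu> b;
  the gap is a square.\<close>

lemma energy_density_ge: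
  assumes "0 < a"
  shows "\<mu>\<^sup>2 * b\<^sup>2 / (4 * a) + g * (a - hs)\<^sup>2 \<le> energy_density g \<mu> hs a b c"
proof -
  have "energy_density g \<mu> hs a b c - (\<mu>\<^sup>2 * b\<^sup>2 / (4 * a) + g * (a - hs)\<^sup>2) = (2 * a * c + \<mu> * b)\<^sup>2 / (4 * a)"
    using assms by (simp add: energy_density_def field_simps power2_eq_square)
  also have "\<dots> \<ge> 0" using assms by simp
  finally show ?thesis by simp
qed

lemma energy_density_ge_kinetic:
  assumes "0 < a" "0 \<le> g"
  shows "a * c\<^sup>2 / 2 \<le> energy_density g \<mu> hs a b c"
  using assms by (simp add: energy_density_def)

text \<open>The gap is again a square. With level bounds inserted, the three coefficients on the
  right become the quantities whose maximum is the constant K of the theorem.\<close>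

lemma energy_density_le:
  assumes "0 < a"
  shows "energy_density g \<mu> hs a b c \<le> 3 / 2 * a * c\<^sup>2 + \<mu>\<^sup>2 * b\<^sup>2 / a + g * (a - hs)\<^sup>2"
proof -
  have "3 / 2 * a * c\<^sup>2 + \<mu>\<^sup>2 * b\<^sup>2 / a + g * (a - hs)\<^sup>2 - energy_density g \<mu> hs a b c = (a * c - \<mu> * b)\<^sup>2 / (2 * a)"
    using assms by (simp add: energy_density_def field_simps power2_eq_square)
  also have "\<dots> \<ge> 0" using assms by simp
  finally show ?thesis by simp
qed

text \<open>The inequality 2 x y \<le> x^2 + y^2 applied to the two terms of
  \<open>energy_density_ge\<close>. The left side is the modulus of the x-derivative of G(h), which
  is where the constant c = 1 / (\<mu> sqrt g) comes from.\<close>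

lemma energy_density_ge_cross:
  assumes "0 < a" "0 < \<mu>" "0 < g"
  shows "\<bar>\<bar>a - hs\<bar> / sqrt a * b\<bar> \<le> 1 / (\<mu> * sqrt g) * energy_density g \<mu> hs a b c"
proof -
  define r s where "r = sqrt a" and "s = sqrt g"
  have r: "0 < r" "a = r\<^sup>2" and s: "0 < s" "g = s\<^sup>2" using assms by (auto simp: r_def s_def)
  have "0 \<le> (\<mu> * \<bar>b\<bar> / (2 * r) - s * \<bar>a - hs\<bar>)\<^sup>2" by simp
  also have "\<dots> = \<mu>\<^sup>2 * b\<^sup>2 / (4 * a) + g * (a - hs)\<^sup>2 - \<mu> * s * (\<bar>a - hs\<bar> / r * \<bar>b\<bar>)"
    using r s by (simp add: power2_diff power_mult_distrib power_divide)
  also have "\<dots> \<le> energy_density g \<mu> hs a b c - \<mu> * s * (\<bar>a - hs\<bar> / r * \<bar>b\<bar>)"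
    using energy_density_ge[OF assms(1)] by simp
  finally have "\<mu> * s * (\<bar>a - hs\<bar> / r * \<bar>b\<bar>) \<le> energy_density g \<mu> hs a b c" by simp
  then have "\<bar>a - hs\<bar> / r * \<bar>b\<bar> \<le> energy_density g \<mu> hs a b c / (\<mu> * s)"
    using assms s by (simp add: field_simps)
  then show ?thesis using r(1) by (simp add: r_def[symmetric] s_def[symmetric] abs_mult)
qed

text \<open>A time slice of a classical solution. The level is continuously differentiable up to the
  walls while the velocity is merely continuous, so the slice at t = 0 qualifies as well.\<close>

locale level_profile =
  fixes L g \<mu> m hs :: real and h hx v :: "real \<Rightarrow> real"
  assumes pos: "0 < L" "0 < g" "0 < \<mu>" "0 < m" and hs: "hs = h_star L m"
    and h_deriv: "\<And>x. x \<in> {0..L} \<Longrightarrow> (h has_real_derivative hx x) (at x within {0..L})"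
    and cont_hx: "continuous_on {0..L} hx"
    and h_pos: "\<And>x. x \<in> {0..L} \<Longrightarrow> 0 < h x"
    and mass: "(LBINT x:{0..L}. h x) = m"
    and cont_v: "continuous_on {0..L} v"
begin

lemma hs_pos: "0 < hs" using pos by (simp add: hs h_star_def)

lemma cont_h: "continuous_on {0..L} h" using h_deriv by (rule DERIV_continuous_on)

lemma h_nonzero: "\<And>x. x \<in> {0..L} \<Longrightarrow> h x \<noteq> 0" using h_pos by force

lemma mass_integral: "integral {0..L} h = m" "m = hs * L"
  using mass LBINT_Icc_eq_integral[OF cont_h] pos by (auto simp: hs h_star_def)

lemma cont_energy_density: "continuous_on {0..L} (\<lambda>x. energy_density g \<mu> hs (h x) (hx x) (v x))"
  unfolding energy_density_def using h_nonzero
  by (intro continuous_intros cont_h cont_hx cont_v) auto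

abbreviation "E \<equiv> fluid_energy L g \<mu> hs h hx v"

lemma V_fun_eq: "V_fun L g \<mu> m q k (\<xi>, w, h, v) = E + q * k\<^sup>2 / 2 * \<xi>\<^sup>2 + q / 2 * (w + k * \<xi>)\<^sup>2"
proof -
  note c = continuous_intros cont_h cont_hx cont_v
  have ci: "continuous_on {0..L} (\<lambda>x. inverse (h x))"
    by (intro continuous_on_inverse cont_h ballI h_nonzero)
  let ?e1 = "\<lambda>x. inverse (h x) * (h x * v x + \<mu> * hx x)\<^sup>2"
  let ?e2 = "\<lambda>x. h x * (v x)\<^sup>2"
  let ?e3 = "\<lambda>x. (h x - hs)\<^sup>2"
  have e: "continuous_on {0..L} ?e1" "continuous_on {0..L} ?e2" "continuous_on {0..L} ?e3"
    by (intro ci cont_h cont_hx cont_v continuous_on_mult continuous_on_power continuous_on_add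
        continuous_on_diff continuous_on_const)+
  have 1: "(LBINT x:{0<..<L}. inverse (h x) * (h x * v x + \<mu> * weak_deriv L h x)\<^sup>2) = integral {0..L} ?e1"
    by (rule LBINT_weak_deriv[where u = h and u' = hx and a = "\<lambda>x. inverse (h x)"
          and b = "\<lambda>x. h x * v x" and c = \<mu> and L = L,
          OF less_imp_le[OF pos(1)] h_deriv cont_hx ci continuous_on_mult[OF cont_h cont_v]])
  have "E = integral {0..L} (\<lambda>x. 1 / 2 * ?e1 x + 1 / 2 * ?e2 x + g * ?e3 x)"
    unfolding fluid_energy_def energy_density_alt ..
  also have "\<dots> = integral {0..L} (\<lambda>x. 1 / 2 * ?e1 x + 1 / 2 * ?e2 x) + integral {0..L} (\<lambda>x. g * ?e3 x)"
    by (intro Henstock_Kurzweil_Integration.integral_add integrable_continuous_interval continuous_intros e)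
  also have "integral {0..L} (\<lambda>x. 1 / 2 * ?e1 x + 1 / 2 * ?e2 x) =
      integral {0..L} (\<lambda>x. 1 / 2 * ?e1 x) + integral {0..L} (\<lambda>x. 1 / 2 * ?e2 x)"
    by (intro Henstock_Kurzweil_Integration.integral_add integrable_continuous_interval continuous_intros e)
  finally have "E = 1 / 2 * integral {0..L} ?e1 + 1 / 2 * integral {0..L} ?e2 + g * integral {0..L} ?e3"
    by (simp only: integral_mult_right)
  then show ?thesis
    unfolding V_fun.simps 1 hs[symmetric] LBINT_Icc_eq_integral[OF e(2)] LBINT_Icc_eq_integral[OF e(3)] by simp
qed

lemma X_norm_power2:
  "(X_norm L (\<xi>, w, level_dev L m h, v))\<^sup>2 = \<xi>\<^sup>2 + w\<^sup>2 + integral {0..L} (\<lambda>x. (h x - hs)\<^sup>2)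
     + integral {0..L} (\<lambda>x. (hx x)\<^sup>2) + integral {0..L} (\<lambda>x. (v x)\<^sup>2)"
proof -
  note c = continuous_intros cont_h cont_hx cont_v
  have d: "(level_dev L m h has_real_derivative hx x) (at x within {0..L})" if "x \<in> {0..L}" for x
  proof (rule has_field_derivative_transform_within[where f = "\<lambda>x. h x - hs" and d = 1])
    show "((\<lambda>x. h x - hs) has_real_derivative hx x) (at x within {0..L})"
      using h_deriv[OF that] by (auto intro!: derivative_eq_intros)
  qed (use that in \<open>auto simp: level_dev_def hs\<close>)
  have "(LBINT x:{0<..<L}. (level_dev L m h x)\<^sup>2) = (LBINT x:{0<..<L}. (h x - hs)\<^sup>2)"
    by (intro set_lebesgue_integral_cong) (auto simp: level_dev_def hs)
  also have "\<dots> = integral {0..L} (\<lambda>x. (h x - hs)\<^sup>2)" by (intro LBINT_Ioo_eq_integral c)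
  finally have 1: "(L2_norm L (level_dev L m h))\<^sup>2 = integral {0..L} (\<lambda>x. (h x - hs)\<^sup>2)"
    by (simp add: L2_norm_def integral_nonneg integrable_continuous_interval c)
  have "(LBINT x:{0<..<L}. 1 * (0 + 1 * weak_deriv L (level_dev L m h) x)\<^sup>2) = integral {0..L} (\<lambda>x. 1 * (0 + 1 * hx x)\<^sup>2)"
    using pos by (intro LBINT_weak_deriv c d) auto
  then have 2: "(L2_norm L (weak_deriv L (level_dev L m h)))\<^sup>2 = integral {0..L} (\<lambda>x. (hx x)\<^sup>2)"
    by (simp add: L2_norm_def integral_nonneg integrable_continuous_interval c)
  have "(LBINT x:{0<..<L}. (v x)\<^sup>2) = integral {0..L} (\<lambda>x. (v x)\<^sup>2)" by (intro LBINT_Ioo_eq_integral c)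
  then have 3: "(L2_norm L v)\<^sup>2 = integral {0..L} (\<lambda>x. (v x)\<^sup>2)"
    by (simp add: L2_norm_def integral_nonneg integrable_continuous_interval c)
  show ?thesis unfolding X_norm.simps 1 2 3
    by (subst real_sqrt_pow2) (auto intro!: add_nonneg_nonneg integral_nonneg integrable_continuous_interval c)
qed

text \<open>Rolle's theorem for the primitive of h - \<open>hs\<close>, which vanishes at both ends
  because \<open>hs\<close> is the mean level.\<close>

lemma level_attained: obtains x where "x \<in> {0..L}" "h x = hs"
proof -
  define F where "F x = integral {0..x} (\<lambda>y. h y - hs)" for x
  have F: "(F has_real_derivative h x - hs) (at x within {0..L})" if "x \<in> {0..L}" for x
    unfolding F_def using that by (intro integral_has_real_derivative continuous_intros cont_h) auto
  have "F L = integral {0..L} h - hs * L"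
    unfolding F_def using pos by (subst integral_diff) (auto intro: integrable_continuous_interval cont_h)
  then have FL: "F L = F 0" using mass_integral by (simp add: F_def)
  have "\<exists>z. 0 < z \<and> z < L \<and> (\<lambda>y. (h z - hs) * y) = (\<lambda>v. 0)"
  proof (rule Rolle_deriv)
    show "continuous_on {0..L} F" using F by (rule DERIV_continuous_on)
    fix x assume x: "0 < x" "x < L"
    then have "(F has_real_derivative h x - hs) (at x)"
      using F[of x] at_within_interior[of x "{0..L}"] by auto
    then show "(F has_derivative (*) (h x - hs)) (at x)" by (simp add: has_field_derivative_def)
  qed (use pos FL in auto)
  then obtain z where z: "0 < z" "z < L" "(\<lambda>y. (h z - hs) * y) = (\<lambda>v. 0)" by auto
  have "h z = hs" using fun_cong[OF z(3), of 1] by simp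
  with z show ?thesis by (intro that[of z]) auto
qed

lemma G_fun_level_bound:
  assumes "x \<in> {0..L}"
  shows "\<bar>G_fun L m (h x)\<bar> \<le> c_const g \<mu> * E"
proof -
  obtain x0 where x0: "x0 \<in> {0..L}" "h x0 = hs" by (rule level_attained)
  let ?D = "\<lambda>x. \<bar>h x - hs\<bar> / sqrt (h x) * hx x"
  have c: "continuous_on {0..L} ?D"
    using h_pos by (intro continuous_intros cont_h cont_hx) force
  have "\<bar>G_fun L m (h x) - G_fun L m (h x0)\<bar> \<le> integral {0..L} (\<lambda>x. \<bar>?D x\<bar>)"
  proof (rule oscillation_le_integral_deriv[OF _ c x0(1) assms])
    fix x assume x: "x \<in> {0..L}"
    show "((\<lambda>x. G_fun L m (h x)) has_real_derivative ?D x) (at x within {0..L})"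
      by (rule DERIV_chain2[OF G_fun_has_derivative[OF hs hs_pos h_pos[OF x]] h_deriv[OF x]])
  qed
  also have "\<dots> \<le> integral {0..L} (\<lambda>x. c_const g \<mu> * energy_density g \<mu> hs (h x) (hx x) (v x))"
    unfolding c_const_def using h_pos pos
    by (intro integral_le energy_density_ge_cross integrable_continuous_interval continuous_intros c cont_energy_density)
  finally show ?thesis using x0 by (simp add: G_fun_h_star[OF hs hs_pos] fluid_energy_def)
qed

end

section \<open>Estimates of level, velocity and energy on a time slice\<close>

context level_profile
begin

abbreviation "H \<equiv> integral {0..L} (\<lambda>x. (hx x)\<^sup>2)"

lemma H_nonneg: "0 \<le> H"
  by (intro integral_nonneg integrable_continuous_interval continuous_on_power cont_hx) auto

lemma level_oscillation:
  assumes "x \<in> {0..L}" "y \<in> {0..L}"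
  shows "(h x - h y)\<^sup>2 \<le> L * H"
proof -
  have "\<bar>h x - h y\<bar> \<le> integral {0..L} (\<lambda>x. \<bar>hx x\<bar>)"
    using assms by (intro oscillation_le_integral_deriv h_deriv cont_hx)
  then have "(h x - h y)\<^sup>2 \<le> (integral {0..L} (\<lambda>x. \<bar>hx x\<bar>))\<^sup>2"
    by (metis abs_ge_zero power2_abs power_mono)
  also have "\<dots> \<le> L * H" using pos cont_hx by (intro abs_integral_power2_le)
  finally show ?thesis .
qed

lemma level_deviation: "x \<in> {0..L} \<Longrightarrow> (h x - hs)\<^sup>2 \<le> L * H"
  using level_attained level_oscillation by metis

lemma level_deviation_integral: "integral {0..L} (\<lambda>x. (h x - hs)\<^sup>2) \<le> L\<^sup>2 * H"
proof -
  have "integral {0..L} (\<lambda>x. (h x - hs)\<^sup>2) \<le> integral {0..L} (\<lambda>x. L * H)"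
    by (intro integral_le integrable_continuous_interval continuous_on_power continuous_on_diff
        continuous_on_const cont_h level_deviation)
  then show ?thesis using pos by (simp add: power2_eq_square mult.assoc)
qed

lemma integral_hx: "integral {0..L} hx = h L - h 0"
proof (rule integral_unique, rule fundamental_theorem_of_calculus)
  fix x assume "x \<in> {0..L}"
  then show "(h has_vector_derivative hx x) (at x within {0..L})"
    using h_deriv by (simp add: has_real_derivative_iff_has_vector_derivative)
qed (use pos in simp)

text \<open>Integrated pointwise bounds. Between two positive level bounds the energy is comparable
  to the fluid part of the squared norm, with constants depending only on these bounds and on g,
  \<mu>.\<close>

lemma fluid_energy_bounds:
  assumes a: "0 < a" and ab: "\<And>x. x \<in> {0..L} \<Longrightarrow> a \<le> h x \<and> h x \<le> b"
  shows "\<mu>\<^sup>2 / (4 * b) * H \<le> E" "a / 2 * integral {0..L} (\<lambda>x. (v x)\<^sup>2) \<le> E"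
    "g * integral {0..L} (\<lambda>x. (h x - hs)\<^sup>2) \<le> E"
    "E \<le> 3 / 2 * b * integral {0..L} (\<lambda>x. (v x)\<^sup>2) + \<mu>\<^sup>2 / a * H + g * integral {0..L} (\<lambda>x. (h x - hs)\<^sup>2)"
proof -
  note ci = integrable_continuous_interval continuous_intros cont_h cont_hx cont_v
  note I = integrable_continuous_interval[OF cont_energy_density]
  have b: "0 < b" using ab[of 0] a pos by force
  have 1: "\<mu>\<^sup>2 / (4 * b) * (hx x)\<^sup>2 \<le> energy_density g \<mu> hs (h x) (hx x) (v x)" if x: "x \<in> {0..L}" for x
  proof -
    have "\<mu>\<^sup>2 / (4 * b) * (hx x)\<^sup>2 \<le> \<mu>\<^sup>2 * (hx x)\<^sup>2 / (4 * h x)"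
      using ab[OF x] h_pos[OF x] by (simp add: frac_le)
    also have "\<dots> \<le> \<mu>\<^sup>2 * (hx x)\<^sup>2 / (4 * h x) + g * (h x - hs)\<^sup>2" using pos by simp
    finally show ?thesis using energy_density_ge[OF h_pos[OF x], of \<mu> "hx x" g hs "v x"] by linarith
  qed
  have 2: "a / 2 * (v x)\<^sup>2 \<le> energy_density g \<mu> hs (h x) (hx x) (v x)" if x: "x \<in> {0..L}" for x
  proof -
    have "a / 2 * (v x)\<^sup>2 \<le> h x * (v x)\<^sup>2 / 2" using ab[OF x] by (simp add: mult_right_mono)
    then show ?thesis
      using energy_density_ge_kinetic[OF h_pos[OF x], of g "v x" \<mu> hs "hx x"] pos by linarith
  qed
  have 3: "g * (h x - hs)\<^sup>2 \<le> energy_density g \<mu> hs (h x) (hx x) (v x)" if x: "x \<in> {0..L}" for x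
  proof -
    have "0 \<le> \<mu>\<^sup>2 * (hx x)\<^sup>2 / (4 * h x)" using h_pos[OF x] by simp
    then show ?thesis using energy_density_ge[OF h_pos[OF x], of \<mu> "hx x" g hs "v x"] by linarith
  qed
  have 4: "energy_density g \<mu> hs (h x) (hx x) (v x) \<le> 3 / 2 * b * (v x)\<^sup>2 + \<mu>\<^sup>2 / a * (hx x)\<^sup>2 + g * (h x - hs)\<^sup>2"
    if x: "x \<in> {0..L}" for x
  proof -
    have "3 / 2 * h x * (v x)\<^sup>2 \<le> 3 / 2 * b * (v x)\<^sup>2" using ab[OF x] by (simp add: mult_right_mono)
    moreover have "\<mu>\<^sup>2 * (hx x)\<^sup>2 / h x \<le> \<mu>\<^sup>2 / a * (hx x)\<^sup>2" using ab[OF x] a by (simp add: frac_le)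
    ultimately show ?thesis using energy_density_le[OF h_pos[OF x], of g \<mu> hs "hx x" "v x"] by linarith
  qed
  have "integral {0..L} (\<lambda>x. \<mu>\<^sup>2 / (4 * b) * (hx x)\<^sup>2) \<le> E"
    unfolding fluid_energy_def by (intro integral_le I 1 integrable_continuous_interval continuous_on_mult
      continuous_on_const continuous_on_power cont_hx)
  then show "\<mu>\<^sup>2 / (4 * b) * H \<le> E" by simp
  have "integral {0..L} (\<lambda>x. a / 2 * (v x)\<^sup>2) \<le> E"
    unfolding fluid_energy_def by (intro integral_le I 2 integrable_continuous_interval continuous_on_mult
      continuous_on_const continuous_on_power cont_v)
  then show "a / 2 * integral {0..L} (\<lambda>x. (v x)\<^sup>2) \<le> E" by simp
  have "integral {0..L} (\<lambda>x. g * (h x - hs)\<^sup>2) \<le> E"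
    unfolding fluid_energy_def by (intro integral_le I 3 integrable_continuous_interval continuous_on_mult
      continuous_on_diff continuous_on_const continuous_on_power cont_h)
  then show "g * integral {0..L} (\<lambda>x. (h x - hs)\<^sup>2) \<le> E" by simp
  have "E \<le> integral {0..L} (\<lambda>x. 3 / 2 * b * (v x)\<^sup>2 + \<mu>\<^sup>2 / a * (hx x)\<^sup>2 + g * (h x - hs)\<^sup>2)"
    unfolding fluid_energy_def using 4
    by (intro integral_le I integrable_continuous_interval continuous_on_add continuous_on_mult
      continuous_on_diff continuous_on_const continuous_on_power cont_h cont_v cont_hx)
  also have "\<dots> = integral {0..L} (\<lambda>x. 3 / 2 * b * (v x)\<^sup>2 + \<mu>\<^sup>2 / a * (hx x)\<^sup>2) + integral {0..L} (\<lambda>x. g * (h x - hs)\<^sup>2)"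
    by (intro Henstock_Kurzweil_Integration.integral_add integrable_continuous_interval continuous_on_add continuous_on_mult
      continuous_on_diff continuous_on_const continuous_on_power cont_h cont_v cont_hx)
  also have "integral {0..L} (\<lambda>x. 3 / 2 * b * (v x)\<^sup>2 + \<mu>\<^sup>2 / a * (hx x)\<^sup>2) =
     integral {0..L} (\<lambda>x. 3 / 2 * b * (v x)\<^sup>2) + integral {0..L} (\<lambda>x. \<mu>\<^sup>2 / a * (hx x)\<^sup>2)"
    by (intro Henstock_Kurzweil_Integration.integral_add integrable_continuous_interval continuous_on_add continuous_on_mult
      continuous_on_diff continuous_on_const continuous_on_power cont_h cont_v cont_hx)
  finally show "E \<le> 3 / 2 * b * integral {0..L} (\<lambda>x. (v x)\<^sup>2) + \<mu>\<^sup>2 / a * H + g * integral {0..L} (\<lambda>x. (h x - hs)\<^sup>2)"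
    by simp
qed

text \<open>Since v vanishes at both walls, |v(x)| is at most the integral of |v_x| on either side
  of x, so 2 |v(x)| is at most the full integral. Cauchy-Schwarz then gives 4 v^2 \<le> L J, an
  elementary Poincare inequality.\<close>

lemma velocity_bounds:
  assumes vd: "\<And>x. x \<in> {0..L} \<Longrightarrow> (v has_real_derivative vx x) (at x within {0..L})"
    and cvx: "continuous_on {0..L} vx" and v0: "v 0 = 0" "v L = 0"
    and a: "0 < a" and ab: "\<And>x. x \<in> {0..L} \<Longrightarrow> a \<le> h x \<and> h x \<le> b"
  shows "integral {0..L} (\<lambda>x. (v x)\<^sup>2) \<le> L\<^sup>2 / (4 * a) * integral {0..L} (\<lambda>x. h x * (vx x)\<^sup>2)"
    "(integral {0..L} (\<lambda>x. h x * v x))\<^sup>2 \<le> m * b * L\<^sup>2 / (4 * a) * integral {0..L} (\<lambda>x. h x * (vx x)\<^sup>2)"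
proof -
  define J where "J = integral {0..L} (\<lambda>x. (vx x)\<^sup>2)"
  define Q where "Q = integral {0..L} (\<lambda>x. h x * (vx x)\<^sup>2)"
  have b: "0 < b" using ab[of 0] a pos by force
  have J0: "0 \<le> J" unfolding J_def
    by (intro integral_nonneg integrable_continuous_interval continuous_on_power cvx) auto
  have "integral {0..L} (\<lambda>x. a * (vx x)\<^sup>2) \<le> Q"
    unfolding Q_def using ab
    by (intro integral_le integrable_continuous_interval continuous_on_mult continuous_on_const
        continuous_on_power cvx cont_h mult_right_mono) auto
  then have aJ: "a * J \<le> Q" by (simp add: J_def)
  have cabs: "continuous_on {0..L} (\<lambda>x. \<bar>vx x\<bar>)" by (intro continuous_intros cvx)
  have pt: "4 * (v x)\<^sup>2 \<le> L * J" if x: "x \<in> {0..L}" for x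
  proof -
    have "\<bar>v x\<bar> \<le> integral {0..x} (\<lambda>x. \<bar>vx x\<bar>)" "\<bar>v x\<bar> \<le> integral {x..L} (\<lambda>x. \<bar>vx x\<bar>)"
      using increment_le_integral_deriv[OF vd cvx, of 0 x] increment_le_integral_deriv[OF vd cvx, of x L] x v0
      by auto
    moreover have "integral {0..x} (\<lambda>x. \<bar>vx x\<bar>) + integral {x..L} (\<lambda>x. \<bar>vx x\<bar>) = integral {0..L} (\<lambda>x. \<bar>vx x\<bar>)"
      using x by (intro Henstock_Kurzweil_Integration.integral_combine integrable_continuous_interval cabs) auto
    ultimately have "\<bar>2 * v x\<bar> \<le> integral {0..L} (\<lambda>x. \<bar>vx x\<bar>)" by linarith
    then have "(2 * v x)\<^sup>2 \<le> (integral {0..L} (\<lambda>x. \<bar>vx x\<bar>))\<^sup>2"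
      by (metis abs_ge_zero power2_abs power_mono)
    also have "\<dots> \<le> L * J" unfolding J_def using pos cvx by (intro abs_integral_power2_le)
    finally show ?thesis by (simp add: power_mult_distrib)
  qed
  have "integral {0..L} (\<lambda>x. (v x)\<^sup>2) \<le> integral {0..L} (\<lambda>x. L * J / 4)"
    using pt by (intro integral_le integrable_continuous_interval continuous_on_power continuous_on_const cont_v) force
  also have "\<dots> = L\<^sup>2 / (4 * a) * (a * J)" using pos a by (simp add: power2_eq_square)
  also have "\<dots> \<le> L\<^sup>2 / (4 * a) * Q" using aJ a by (intro mult_left_mono) auto
  finally show "integral {0..L} (\<lambda>x. (v x)\<^sup>2) \<le> L\<^sup>2 / (4 * a) * integral {0..L} (\<lambda>x. h x * (vx x)\<^sup>2)"
    unfolding Q_def .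
  define s where "s = sqrt (L * J / 4)"
  have s: "0 \<le> s" "s\<^sup>2 = L * J / 4" using pos J0 by (auto simp: s_def)
  have vs: "\<bar>v x\<bar> \<le> s" if "x \<in> {0..L}" for x
    unfolding s_def using pt[OF that] by (intro real_le_rsqrt) simp
  have "\<bar>integral {0..L} (\<lambda>x. h x * v x)\<bar> \<le> integral {0..L} (\<lambda>x. h x * s)"
    using vs integral_norm_bound_integral[of "\<lambda>x. h x * v x" "{0..L}" "\<lambda>x. h x * s"]
      integrable_continuous_interval[OF continuous_on_mult[OF cont_h cont_v]]
      integrable_continuous_interval[OF continuous_on_mult[OF cont_h continuous_on_const]]
    by (auto simp: abs_mult h_pos less_imp_le intro!: mult_left_mono)
  also have "\<dots> = m * s" using mass_integral by simp
  finally have "(integral {0..L} (\<lambda>x. h x * v x))\<^sup>2 \<le> (m * s)\<^sup>2"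
    by (metis abs_ge_zero power2_abs power_mono)
  also have "\<dots> = m * L / (4 * a) * (m * (a * J))" using s a by (simp add: power_mult_distrib power2_eq_square)
  \<comment> \<open>One of the two factors m is weakened to b L, so that the level ratio b / a
    appears as in the condition on \<sigma>.\<close>
  also have "\<dots> \<le> m * L / (4 * a) * (b * L * Q)"
  proof -
    have "integral {0..L} h \<le> integral {0..L} (\<lambda>x. b)"
      using ab by (intro integral_le integrable_continuous_interval cont_h continuous_on_const) auto
    then have "m \<le> b * L" using mass_integral pos by (simp add: mult.commute)
    then have "m * (a * J) \<le> b * L * Q" using aJ a J0 b pos by (intro mult_mono) auto
    then show ?thesis using pos a by (intro mult_left_mono) auto
  qed
  also have "\<dots> = m * b * L\<^sup>2 / (4 * a) * Q" by (simp add: power2_eq_square)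
  finally show "(integral {0..L} (\<lambda>x. h x * v x))\<^sup>2 \<le> m * b * L\<^sup>2 / (4 * a) * integral {0..L} (\<lambda>x. h x * (vx x)\<^sup>2)"
    unfolding Q_def .
qed

end

text \<open>After completing squares, only the margin between the constants \<open>8 / 5\<close> and \<open>7 / 5\<close> in front of
  \<open>\<sigma> N\<^sup>2\<close> is used.\<close>

lemma dissipation_inequality:
  fixes L g \<mu> q \<sigma> k H Q N Y e z \<xi> \<Delta> :: real
  assumes pos: "0 < L" "0 < g" "0 < \<mu>" "0 < q" "0 < \<sigma>" "0 < k" "0 \<le> H" "0 \<le> Q"
    and \<sigma>: "\<sigma> < 2 * g / (\<mu> * L)" "8 * k / q < \<sigma>"
    and \<Delta>: "\<Delta>\<^sup>2 \<le> L * H" and N: "8 / 5 * \<sigma> * N\<^sup>2 \<le> \<mu> * Q"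
    and Y: "Y = \<mu> * \<Delta> - q * z"
  shows "- \<mu> * g * H - \<mu> * Q - q * k ^ 3 * \<xi>\<^sup>2 + q * k * z\<^sup>2 - \<sigma> * (Y - q * e) * (2 * N + Y) - 2 * \<sigma> * (q * e)\<^sup>2
    \<le> - (\<mu> * g / 2 * H + \<mu> / 16 * Q + q * k ^ 3 * \<xi>\<^sup>2 + \<sigma> / 100 * Y\<^sup>2 + \<sigma> / 100 * (q * e)\<^sup>2)"
proof -
  \<comment> \<open>The only term of the wrong sign is q k z^2. Writing z through \<Delta> and Y,
    the condition \<sigma> > 8 k / q bounds it by \<Delta>^2 and Y^2, and \<sigma> < 2 g / (\<mu> L)
    makes the \<Delta>^2 part at most half of the slope dissipation.\<close>
  have "q * z = \<mu> * \<Delta> - Y" using Y by simp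
  moreover have "q * k * z\<^sup>2 = k / q * (q * z)\<^sup>2" using pos by (simp add: power2_eq_square)
  ultimately have "q * k * z\<^sup>2 = k / q * (\<mu> * \<Delta> - Y)\<^sup>2" by simp
  also have "\<dots> \<le> \<sigma> / 8 * (2 * \<mu>\<^sup>2 * \<Delta>\<^sup>2 + 2 * Y\<^sup>2)"
  proof (intro mult_mono)
    show "k / q \<le> \<sigma> / 8" using less_imp_le[OF \<sigma>(2)] pos by (simp add: field_simps)
    have "0 \<le> (\<mu> * \<Delta> + Y)\<^sup>2" by simp
    then show "(\<mu> * \<Delta> - Y)\<^sup>2 \<le> 2 * \<mu>\<^sup>2 * \<Delta>\<^sup>2 + 2 * Y\<^sup>2"
      by (simp add: power2_eq_square algebra_simps)
  qed (use pos in auto)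
  also have "\<dots> = \<sigma> * \<mu>\<^sup>2 / 4 * \<Delta>\<^sup>2 + \<sigma> / 4 * Y\<^sup>2" by (simp add: algebra_simps)
  also have "\<sigma> * \<mu>\<^sup>2 / 4 * \<Delta>\<^sup>2 \<le> \<mu> * g / 2 * H"
  proof -
    have "\<sigma> * (\<mu> * L) \<le> 2 * g" using \<sigma>(1) pos by (simp add: field_simps)
    have "\<sigma> * \<mu>\<^sup>2 / 4 * \<Delta>\<^sup>2 \<le> \<sigma> * \<mu>\<^sup>2 / 4 * (L * H)" using \<Delta> pos by (intro mult_left_mono) auto
    also have "\<dots> = \<mu> / 4 * H * (\<sigma> * (\<mu> * L))" by (simp add: power2_eq_square)
    also have "\<dots> \<le> \<mu> / 4 * H * (2 * g)" using \<open>\<sigma> * (\<mu> * L) \<le> 2 * g\<close> pos by (intro mult_left_mono) auto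
    finally show ?thesis by (simp add: mult_ac)
  qed
  finally have 1: "q * k * z\<^sup>2 \<le> \<mu> * g / 2 * H + \<sigma> / 4 * Y\<^sup>2" by simp
  define C where "C = q * e"
  \<comment> \<open>Here 3/4 is 1 minus the quarter spent on z, and 3/2 is 15/16 of 8/5, the
    remaining 1/16 of the viscous term being kept as dissipation. Completing squares first in C and
    then in N leaves a positive multiple of Y^2.\<close>
  have form: "0 \<le> 3 / 4 * Y\<^sup>2 + 2 * Y * N + 3 / 2 * N\<^sup>2 - C * (Y + 2 * N) + 2 * C\<^sup>2 - (Y\<^sup>2 + C\<^sup>2) / 100"
  proof -
    have "3 / 4 * Y\<^sup>2 + 2 * Y * N + 3 / 2 * N\<^sup>2 - C * (Y + 2 * N) + 2 * C\<^sup>2 - (Y\<^sup>2 + C\<^sup>2) / 100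
      = 199 / 100 * (C - 50 / 199 * (Y + 2 * N))\<^sup>2 + 397 / 398 * (N + 298 / 397 * Y)\<^sup>2
        + 1039 / 19850 * Y\<^sup>2"
      by (simp add: power2_eq_square field_simps)
    then show ?thesis by simp
  qed
  \<comment> \<open>Normalizes all products to common atoms, after which the claim is
    linear.\<close>
  have e: "\<sigma> * (Y - C) * (2 * N + Y) = 2 * (\<sigma> * Y * N) + \<sigma> * Y\<^sup>2 - 2 * (\<sigma> * C * N) - \<sigma> * C * Y"
    "2 * \<sigma> * C\<^sup>2 = 2 * (\<sigma> * C\<^sup>2)" "\<sigma> / 100 * Y\<^sup>2 = (\<sigma> * Y\<^sup>2) / 100" "\<sigma> / 100 * C\<^sup>2 = (\<sigma> * C\<^sup>2) / 100"
    "\<sigma> / 4 * Y\<^sup>2 = (\<sigma> * Y\<^sup>2) / 4" "8 / 5 * \<sigma> * N\<^sup>2 = 8 / 5 * (\<sigma> * N\<^sup>2)"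
    "\<mu> / 16 * Q = (\<mu> * Q) / 16" "\<mu> * g / 2 * H = (\<mu> * g * H) / 2" "- \<mu> * g * H = - (\<mu> * g * H)" "- \<mu> * Q = - (\<mu> * Q)"
    by (simp_all add: algebra_simps power2_eq_square)
  have "0 \<le> \<sigma> * (3 / 4 * Y\<^sup>2 + 2 * Y * N + 3 / 2 * N\<^sup>2 - C * (Y + 2 * N) + 2 * C\<^sup>2 - (Y\<^sup>2 + C\<^sup>2) / 100)"
    using form pos by simp
  also have "\<dots> = 3 / 4 * (\<sigma> * Y\<^sup>2) + 2 * (\<sigma> * Y * N) + 3 / 2 * (\<sigma> * N\<^sup>2) - \<sigma> * C * Y - 2 * (\<sigma> * C * N)
      + 2 * (\<sigma> * C\<^sup>2) - (\<sigma> * Y\<^sup>2) / 100 - (\<sigma> * C\<^sup>2) / 100"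
    by (simp add: field_simps)
  finally show ?thesis using 1 N mult_nonneg_nonneg[of \<mu> Q] pos unfolding C_def[symmetric] e by linarith
qed

section \<open>Energy balance along classical solutions\<close>

text \<open>Existence of the derivative of u_t in x is a conclusion. Writing u(t,y) as u(t,c) plus
  the integral of u_x and differentiating under the integral expresses u_t through an integral of
  u_xt, whose y-derivative is immediate. For the level this lets the mass equation be differentiated
  in x.\<close>

lemma mixed_partials_swap:
  fixes u ut ux uxt :: "real \<Rightarrow> real \<Rightarrow> real"
  assumes ux: "\<And>t x. 0 < t \<Longrightarrow> x \<in> {0<..<L} \<Longrightarrow> (u t has_real_derivative ux t x) (at x)"
    and ut: "\<And>t x. 0 < t \<Longrightarrow> x \<in> {0<..<L} \<Longrightarrow> ((\<lambda>s. u s x) has_real_derivative ut t x) (at t)"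
    and uxt: "\<And>t x. 0 < t \<Longrightarrow> x \<in> {0<..<L} \<Longrightarrow> ((\<lambda>s. ux s x) has_real_derivative uxt t x) (at t)"
    and cux: "continuous_on ({0<..} \<times> {0<..<L}) (\<lambda>(t, x). ux t x)"
    and cuxt: "continuous_on ({0<..} \<times> {0<..<L}) (\<lambda>(t, x). uxt t x)"
    and t: "0 < t" and x: "x \<in> {0<..<L}"
  shows "(ut t has_real_derivative uxt t x) (at x)"
proof -
  define c d where "c = x / 2" and "d = (x + L) / 2"
  have cd: "0 < c" "c < x" "x < d" "d < L" using x by (auto simp: c_def d_def)
  have slice: "continuous_on {a..b} (f s)"
    if "continuous_on ({0<..} \<times> {0<..<L}) (\<lambda>(t, x). f t x)" "s > 0" "c \<le> a" "b \<le> d"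
    for f :: "real \<Rightarrow> real \<Rightarrow> real" and s a b
    using continuous_on_compose2[OF that(1), of "{a..b}" "\<lambda>x. (s, x)"] that cd
    by (force intro: continuous_on_Pair continuous_on_const continuous_on_id)
  have eq: "ut t y = ut t c + integral {c..y} (uxt t)" if y: "c \<le> y" "y \<le> d" for y
  proof -
    have FTC: "u s y = u s c + integral {c..y} (ux s)" if "s > 0" for s
    proof -
      have "(ux s has_integral (u s y - u s c)) {c..y}"
        using ux that y cd by (intro fundamental_theorem_of_calculus)
          (auto simp: has_real_derivative_iff_has_vector_derivative[symmetric] intro: has_field_derivative_at_within)
      then show ?thesis by (simp add: integral_unique)
    qed
    have "((\<lambda>s. integral (cbox c y) (ux s)) has_field_derivative integral (cbox c y) (uxt t)) (at t within {0<..})"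
    proof (rule leibniz_rule_field_derivative)
      fix s z :: real assume "s \<in> {0<..}" "z \<in> cbox c y"
      then show "((\<lambda>s. ux s z) has_field_derivative uxt s z) (at s within {0<..})"
        using uxt[of s z] y cd by (auto intro: has_field_derivative_at_within)
    next
      fix s :: real assume "s \<in> {0<..}"
      then show "ux s integrable_on cbox c y"
        using slice[OF cux, of s c y] y by (auto intro: integrable_continuous_interval)
    next
      show "continuous_on ({0<..} \<times> cbox c y) (\<lambda>(s, z). uxt s z)"
        by (rule continuous_on_subset[OF cuxt]) (use y cd in auto)
    qed (use t in auto)
    then have "((\<lambda>s. integral {c..y} (ux s)) has_real_derivative integral {c..y} (uxt t)) (at t)"
      using t by (simp add: at_within_open[of t "{0<..}"])
    then have "((\<lambda>s. u s c + integral {c..y} (ux s)) has_real_derivative ut t c + integral {c..y} (uxt t)) (at t)"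
      using cd t by (intro DERIV_add ut) auto
    then have "((\<lambda>s. u s y) has_real_derivative ut t c + integral {c..y} (uxt t)) (at t)"
      by (rule has_field_derivative_transform_within_open[of _ _ _ "{0<..}"]) (use t in \<open>auto intro!: FTC[symmetric]\<close>)
    moreover have "((\<lambda>s. u s y) has_real_derivative ut t y) (at t)"
      using cd t y by (intro ut) auto
    ultimately show ?thesis by (rule DERIV_unique[symmetric])
  qed
  have "((\<lambda>y. integral {c..y} (uxt t)) has_real_derivative uxt t x) (at x within {c..d})"
    using slice[OF cuxt t, of c d] cd by (intro integral_has_real_derivative) auto
  then have "((\<lambda>y. ut t c + integral {c..y} (uxt t)) has_real_derivative uxt t x) (at x)"
    using cd by (auto simp: at_within_interior[of x "{c..d}"] intro!: derivative_eq_intros)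
  then show ?thesis
    by (rule has_field_derivative_transform_within_open[of _ _ _ "{c<..<d}"]) (use cd in \<open>auto intro!: eq[symmetric]\<close>)
qed

text \<open>\<open>Ck_on2\<close> with positive order gives partial derivatives but not directly
  joint continuity of the function itself. Rescaling u(t,x) = u(t,0) + x times the integral of
  u_x(t, x s) over s in [0,1] fixes the domain of integration, so continuity in the parameters
  applies.\<close>

lemma C1_jointly_continuous:
  fixes u ux :: "real \<Rightarrow> real \<Rightarrow> real"
  assumes u0: "continuous_on I (\<lambda>t. u t 0)"
    and ux: "\<And>t x. t \<in> I \<Longrightarrow> x \<in> {0..L} \<Longrightarrow> (u t has_real_derivative ux t x) (at x within {0..L})"
    and cux: "continuous_on (I \<times> {0..L}) (\<lambda>(t, x). ux t x)"
  shows "continuous_on (I \<times> {0..L}) (\<lambda>(t, x). u t x)"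
proof -
  have sub: "y * s \<in> {0..L}" if "y \<in> {0..L}" "s \<in> {0..1}" for y s
    using that mult_left_le[of s y] by auto
  have eq: "u t x = u t 0 + x * integral {0..1} (\<lambda>s. ux t (x * s))" if t: "t \<in> I" and x: "x \<in> {0..L}" for t x
  proof -
    have "((\<lambda>s. u t (x * s)) has_real_derivative ux t (x * s) * x) (at s within {0..1})" if s: "s \<in> {0..1}" for s
    proof (rule DERIV_image_chain[where f = "u t" and g = "\<lambda>s. x * s", unfolded o_def])
      show "(u t has_real_derivative ux t (x * s)) (at (x * s) within (\<lambda>s. x * s) ` {0..1})"
        by (rule DERIV_subset[OF ux[OF t sub[OF x s]]]) (use sub x in auto)
      show "((\<lambda>s. x * s) has_real_derivative x) (at s within {0..1})"
        using DERIV_cmult_Id by (rule has_field_derivative_at_within)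
    qed
    then have "((\<lambda>s. ux t (x * s) * x) has_integral (u t (x * 1) - u t (x * 0))) {0..1}"
      by (intro fundamental_theorem_of_calculus) (auto simp: has_real_derivative_iff_has_vector_derivative)
    then have "integral {0..1} (\<lambda>s. ux t (x * s) * x) = u t (x * 1) - u t (x * 0)" by (rule integral_unique)
    then show ?thesis by (simp add: mult.commute)
  qed
  have "continuous_on ((I \<times> {0..L}) \<times> cbox 0 1) (\<lambda>(p, s). ux (fst p) (snd p * s))"
  proof -
    have "continuous_on ((I \<times> {0..L}) \<times> cbox 0 1) (\<lambda>z. (\<lambda>(t, x). ux t x) (fst (fst z), snd (fst z) * snd z))"
      by (rule continuous_on_compose2[OF cux]) (use sub in \<open>auto intro!: continuous_intros\<close>)
    then show ?thesis by (simp add: case_prod_beta)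
  qed
  then have "continuous_on (I \<times> {0..L}) (\<lambda>p. integral {0..1} (\<lambda>s. ux (fst p) (snd p * s)))"
    using integral_continuous_on_param by fastforce
  moreover have "continuous_on (I \<times> {0..L}) (\<lambda>p. u (fst p) 0)"
    by (rule continuous_on_compose2[OF u0]) (auto intro!: continuous_intros)
  ultimately have "continuous_on (I \<times> {0..L}) (\<lambda>p. u (fst p) 0 + snd p * integral {0..1} (\<lambda>s. ux (fst p) (snd p * s)))"
    by (intro continuous_intros)
  then show ?thesis by (rule continuous_on_eq) (auto intro!: eq[symmetric])
qed

text \<open>Stated for three functions of one variable, so that the same formula serves the time
  derivative and the derivative of the flux. The quotient (a c + \<mu> b) / a is W = v + \<mu> h_x /
  h.\<close>

lemma DERIV_energy_density:
  assumes "(a has_real_derivative a') F" "(b has_real_derivative b') F" "(c has_real_derivative c') F"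
    and F: "F = at x within S" and a: "a x \<noteq> 0"
  shows "((\<lambda>x. energy_density g \<mu> hs (a x) (b x) (c x)) has_real_derivative
     (a x * c x + \<mu> * b x) / a x * (a' * c x + a x * c' + \<mu> * b')
      - ((a x * c x + \<mu> * b x) / a x)\<^sup>2 * a' / 2
      + a' * (c x)\<^sup>2 / 2 + a x * c x * c' + 2 * g * (a x - hs) * a') F"
proof -
  have 1: "((\<lambda>x. (a x * c x + \<mu> * b x)\<^sup>2 / (2 * a x)) has_real_derivative
     (a x * c x + \<mu> * b x) / a x * (a' * c x + a x * c' + \<mu> * b') - ((a x * c x + \<mu> * b x) / a x)\<^sup>2 * a' / 2) F"
  proof -
    define P where "P x = a x * c x + \<mu> * b x" for x
    define P' where "P' = a' * c x + a x * c' + \<mu> * b'"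
    have P: "(P has_real_derivative P') F"
      unfolding P_def[abs_def] P'_def F using assms(1-3)[unfolded F] by (auto intro!: derivative_eq_intros)
    have "((\<lambda>x. (P x)\<^sup>2 / (2 * a x)) has_real_derivative
        (2 * P x * P' * (2 * a x) - (P x)\<^sup>2 * (2 * a')) / ((2 * a x) * (2 * a x))) F"
      unfolding F using P[unfolded F] assms(1)[unfolded F] a by (auto intro!: derivative_eq_intros)
    also have "(2 * P x * P' * (2 * a x) - (P x)\<^sup>2 * (2 * a')) / ((2 * a x) * (2 * a x)) =
       P x / a x * P' - (P x / a x)\<^sup>2 * a' / 2"
      using a by (simp add: field_simps power2_eq_square)
    finally show ?thesis unfolding P_def P'_def .
  qed
  have 2: "((\<lambda>x. a x * (c x)\<^sup>2 / 2) has_real_derivative a' * (c x)\<^sup>2 / 2 + a x * c x * c') F"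
    unfolding F using assms(1,3)[unfolded F] by (auto intro!: derivative_eq_intros)
  have 3: "((\<lambda>x. g * (a x - hs)\<^sup>2) has_real_derivative 2 * g * (a x - hs) * a') F"
    unfolding F using assms(1)[unfolded F] by (auto intro!: derivative_eq_intros)
  show ?thesis
    unfolding energy_density_def
    using DERIV_add[OF DERIV_add[OF 1[unfolded F] 2[unfolded F]] 3[unfolded F]] unfolding F
    by (simp add: add.assoc)
qed

text \<open>In terms of \<open>W = v + \<mu> h\<^sub>x / h\<close> the momentum balance reads \<open>h (W\<^sub>t + v W\<^sub>x) = h (f - g h\<^sub>x)\<close>:
  the viscous term cancels against the time derivative of \<open>\<mu> h\<^sub>x\<close>.\<close>

lemma energy_balance_pointwise:
  fixes a hx ht v vx vt hxx hxt vxx f g \<mu> hs :: real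
  assumes a: "a \<noteq> 0"
    and mass: "ht = - (hx * v + a * vx)"
    and mass_x: "hxt = - (hxx * v + 2 * hx * vx + a * vxx)"
    and mom: "ht * v + a * vt + hx * v\<^sup>2 + 2 * a * v * vx + g * a * hx = \<mu> * (hx * vx + a * vxx) + a * f"
  defines "P \<equiv> a * v + \<mu> * hx"
  defines "et \<equiv> P / a * (ht * v + a * vt + \<mu> * hxt) - (P / a)\<^sup>2 * ht / 2 + ht * v\<^sup>2 / 2 + a * v * vt + 2 * g * (a - hs) * ht"
  defines "ex \<equiv> P / a * (hx * v + a * vx + \<mu> * hxx) - (P / a)\<^sup>2 * hx / 2 + hx * v\<^sup>2 / 2 + a * v * vx + 2 * g * (a - hs) * hx"
  shows "vx * energy_density g \<mu> hs a hx v + v * ex - \<mu> * (hx * v * vx + a * vx\<^sup>2 + a * v * vxx)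
      + 2 * g * (hx * a * v + (a - hs) * (hx * v + a * vx))
      - g * (2 * (a - hs) * hx * v + (a - hs)\<^sup>2 * vx)
    = f * (2 * a * v + \<mu> * hx) - \<mu> * g * hx\<^sup>2 - \<mu> * a * vx\<^sup>2 - et"
proof -
  \<comment> \<open>Replacing P by a W removes every division by a, so the identity becomes
    polynomial.\<close>
  define W where "W = P / a"
  have P: "P = a * W" using a by (simp add: W_def)
  have dens: "energy_density g \<mu> hs a hx v = a * W\<^sup>2 / 2 + a * v\<^sup>2 / 2 + g * (a - hs)\<^sup>2"
    using a by (simp add: energy_density_def W_def P_def power_divide power2_eq_square)
  have avt: "a * vt = \<mu> * (hx * vx + a * vxx) + a * f - (ht * v + hx * v\<^sup>2 + 2 * a * v * vx + g * a * hx)"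
    using mom by simp
  have Pt: "ht * v + a * vt + \<mu> * hxt = - (vx * P + v * (hx * v + a * vx + \<mu> * hxx)) - g * a * hx + a * f"
    unfolding avt mass_x P_def by (simp add: algebra_simps power2_eq_square)
  have kin: "a * v * vt = v * (\<mu> * (hx * vx + a * vxx) + a * f - (ht * v + hx * v\<^sup>2 + 2 * a * v * vx + g * a * hx))"
    unfolding avt[symmetric] by simp
  have et: "et = W * (- (vx * (a * W) + v * (hx * v + a * vx + \<mu> * hxx)) - g * a * hx + a * f) - W\<^sup>2 * ht / 2 + ht * v\<^sup>2 / 2
     + v * (\<mu> * (hx * vx + a * vxx) + a * f - (ht * v + hx * v\<^sup>2 + 2 * a * v * vx + g * a * hx)) + 2 * g * (a - hs) * ht"
    unfolding et_def Pt kin W_def[symmetric] unfolding P ..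
  have ex: "ex = W * (hx * v + a * vx + \<mu> * hxx) - W\<^sup>2 * hx / 2 + hx * v\<^sup>2 / 2 + a * v * vx + 2 * g * (a - hs) * hx"
    unfolding ex_def W_def ..
  have Wf: "f * (2 * a * v + \<mu> * hx) = f * (a * v + a * W)"
    unfolding P[symmetric] P_def by (simp add: algebra_simps)
  have Whx: "\<mu> * hx = a * W - a * v" using P unfolding P_def by simp
  have \<mu>hx: "\<mu> * g * hx\<^sup>2 = g * hx * (a * W - a * v)"
    unfolding Whx[symmetric] by (simp add: power2_eq_square)
  show ?thesis
    unfolding dens et ex Wf \<mu>hx mass
    by (simp add: field_simps power2_eq_square)
qed

lemma dt_eqI:
  assumes "0 < t" "((\<lambda>s. u s x) has_real_derivative D) (at t)"
  shows "dt u t x = D"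
  using assms at_within_interior[of t "{0..}"]
  by (simp add: dt_def vector_derivative_at has_real_derivative_iff_has_vector_derivative)

lemma dx_eqI:
  assumes "x \<in> {0<..<L}" "(u t has_real_derivative D) (at x)"
  shows "dx L u t x = D"
  using assms at_within_interior[of x "{0..L}"]
  by (simp add: dx_def vector_derivative_at has_real_derivative_iff_has_vector_derivative)

lemma Ck_on2_0_iff: "Ck_on2 0 I J u \<longleftrightarrow> continuous_on (I \<times> J) (\<lambda>p. u (fst p) (snd p))"
  by (simp add: case_prod_beta)

lemma Ck_on2_SucD:
  assumes "Ck_on2 (Suc n) I J u"
  shows "\<exists>ut ux. (\<forall>t\<in>I. \<forall>x\<in>J. ((\<lambda>s. u s x) has_real_derivative ut t x) (at t within I))
      \<and> (\<forall>t\<in>I. \<forall>x\<in>J. (u t has_real_derivative ux t x) (at x within J))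
      \<and> Ck_on2 n I J ut \<and> Ck_on2 n I J ux"
  using assms by (simp only: Ck_on2.simps) blast

text \<open>The solution class supplies derivatives of h separately on the closed and on the open
  strip; uniqueness of derivatives identifies them. The resulting slopes are valid up to the walls,
  whereas the mass and momentum equations are differentiated only inside.\<close>

lemma classical_solution_energy:
  assumes pos: "0 < L" "0 < g" "0 < \<mu>"
    and sol: "classical_solution L g \<mu> m q \<sigma> k \<gamma> \<xi> w h v \<zeta>"
  obtains hx vx where
    "\<And>t x. 0 \<le> t \<Longrightarrow> x \<in> {0..L} \<Longrightarrow> (h t has_real_derivative hx t x) (at x within {0..L})"
    "continuous_on ({0..} \<times> {0..L}) (\<lambda>p. h (fst p) (snd p))"
    "continuous_on ({0..} \<times> {0..L}) (\<lambda>p. hx (fst p) (snd p))"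
    "\<And>t x. 0 < t \<Longrightarrow> x \<in> {0..L} \<Longrightarrow> (v t has_real_derivative vx t x) (at x within {0..L})"
    "continuous_on ({0<..} \<times> {0..L}) (\<lambda>p. vx (fst p) (snd p))"
    "\<And>t. 0 < t \<Longrightarrow> ((\<lambda>t. fluid_energy L g \<mu> hs (h t) (hx t) (v t)) has_real_derivative
       integral {0..L} (\<lambda>x. feedback L \<mu> q \<sigma> k \<gamma> \<xi> h \<zeta> t * (2 * h t x * v t x + \<mu> * hx t x)
         - \<mu> * g * (hx t x)\<^sup>2 - \<mu> * h t x * (vx t x)\<^sup>2)) (at t)"
proof -
  define f where "f = feedback L \<mu> q \<sigma> k \<gamma> \<xi> h \<zeta>"
  note S = sol[unfolded classical_solution_def Let_def, folded f_def]
  have hpos: "\<And>t x. 0 \<le> t \<Longrightarrow> x \<in> {0..L} \<Longrightarrow> 0 < h t x" using S by blast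
  have fc: "continuous_on {0..} f" using S by simp
  have v0: "\<And>t. 0 \<le> t \<Longrightarrow> v t 0 = 0 \<and> v t L = 0" using S by blast
  have vc: "continuous_on ({0..} \<times> {0..L}) (\<lambda>p. v (fst p) (snd p))"
    using S by (simp add: case_prod_beta)
  have "Ck_on2 (Suc 0) {0..} {0..L} h" using S by (metis One_nat_def)
  from Ck_on2_SucD[OF this] obtain ht hx where
    ht: "\<forall>t\<in>{0..}. \<forall>x\<in>{0..L}. ((\<lambda>s. h s x) has_real_derivative ht t x) (at t within {0..})"
    and hx: "\<forall>t\<in>{0..}. \<forall>x\<in>{0..L}. (h t has_real_derivative hx t x) (at x within {0..L})"
    and c0: "Ck_on2 0 {0..} {0..L} ht" "Ck_on2 0 {0..} {0..L} hx"
    by (elim exE conjE) (rule that)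
  note htc = c0(1)[unfolded Ck_on2_0_iff] and hxc = c0(2)[unfolded Ck_on2_0_iff]
  have "Ck_on2 (Suc 0) {0<..} {0..L} v" using S by (metis One_nat_def)
  from Ck_on2_SucD[OF this] obtain vt vx where
    vt: "\<forall>t\<in>{0<..}. \<forall>x\<in>{0..L}. ((\<lambda>s. v s x) has_real_derivative vt t x) (at t within {0<..})"
    and vx: "\<forall>t\<in>{0<..}. \<forall>x\<in>{0..L}. (v t has_real_derivative vx t x) (at x within {0..L})"
    and c0: "Ck_on2 0 {0<..} {0..L} vt" "Ck_on2 0 {0<..} {0..L} vx"
    by (elim exE conjE) (rule that)
  note vtc = c0(1)[unfolded Ck_on2_0_iff] and vxc = c0(2)[unfolded Ck_on2_0_iff]
  have "Ck_on2 (Suc (Suc 0)) {0<..} {0<..<L} h" using S by (metis numeral_2_eq_2)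
  from Ck_on2_SucD[OF this] obtain ht2 hx2 where
    "\<forall>t\<in>{0<..}. \<forall>x\<in>{0<..<L}. ((\<lambda>s. h s x) has_real_derivative ht2 t x) (at t within {0<..})"
    and hx2: "\<forall>t\<in>{0<..}. \<forall>x\<in>{0<..<L}. (h t has_real_derivative hx2 t x) (at x within {0<..<L})"
    and "Ck_on2 (Suc 0) {0<..} {0<..<L} ht2" and C1: "Ck_on2 (Suc 0) {0<..} {0<..<L} hx2"
    by (elim exE conjE) (rule that)
  from Ck_on2_SucD[OF C1] obtain hxt hxx where
    hxt2: "\<forall>t\<in>{0<..}. \<forall>x\<in>{0<..<L}. ((\<lambda>s. hx2 s x) has_real_derivative hxt t x) (at t within {0<..})"
    and hxx2: "\<forall>t\<in>{0<..}. \<forall>x\<in>{0<..<L}. (hx2 t has_real_derivative hxx t x) (at x within {0<..<L})"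
    and c0: "Ck_on2 0 {0<..} {0<..<L} hxt" "Ck_on2 0 {0<..} {0<..<L} hxx"
    by (elim exE conjE) (rule that)
  note hxtc = c0(1)[unfolded Ck_on2_0_iff]
  have atx: "at x within {0..L} = at x" "at x within {0<..<L} = at x" if "x \<in> {0<..<L}" for x
    using that at_within_interior[of x "{0..L}"] at_within_open[of x "{0<..<L}"] by auto
  have att: "at t within {0..} = at t" "at t within {0<..} = at t" if "0 < t" for t :: real
    using that at_within_interior[of t "{0..}"] at_within_open[of t "{0<..}"] by auto
  have hxi: "(h t has_real_derivative hx t x) (at x)" if "0 < t" "x \<in> {0<..<L}" for t x
    using hx[rule_format, of t x] that atx[OF that(2)] by simp
  have hti: "((\<lambda>s. h s x) has_real_derivative ht t x) (at t)" if "0 < t" "x \<in> {0..L}" for t x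
    using ht[rule_format, of t x] that att[OF that(1)] by simp
  have vxi: "(v t has_real_derivative vx t x) (at x)" if "0 < t" "x \<in> {0<..<L}" for t x
    using vx[rule_format, of t x] that atx[OF that(2)] by simp
  have vti: "((\<lambda>s. v s x) has_real_derivative vt t x) (at t)" if "0 < t" "x \<in> {0..L}" for t x
    using vt[rule_format, of t x] that att[OF that(1)] by simp
  have hx2_eq: "hx2 t x = hx t x" if "0 < t" "x \<in> {0<..<L}" for t x
    using DERIV_unique[of "h t" "hx2 t x" x "hx t x"] hx2[rule_format, of t x] hxi[OF that] that atx[OF that(2)] by simp
  have hxti: "((\<lambda>s. hx s x) has_real_derivative hxt t x) (at t)" if "0 < t" "x \<in> {0<..<L}" for t x
  proof -
    have "((\<lambda>s. hx2 s x) has_real_derivative hxt t x) (at t)"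
      using hxt2[rule_format, of t x] att[OF that(1)] that by simp
    then show ?thesis
      by (rule has_field_derivative_transform_within_open[of _ _ _ "{0<..}"]) (use that hx2_eq in auto)
  qed
  have hxxi: "(hx t has_real_derivative hxx t x) (at x)" if "0 < t" "x \<in> {0<..<L}" for t x
  proof -
    have "(hx2 t has_real_derivative hxx t x) (at x)"
      using hxx2[rule_format, of t x] atx[OF that(2)] that by simp
    then show ?thesis
      by (rule has_field_derivative_transform_within_open[of _ _ _ "{0<..<L}"]) (use that hx2_eq in auto)
  qed
  \<comment> \<open>No continuity of v_xx in t is available. It enters only the derivative of the
    flux, and neither \<open>et\<close> nor \<open>src\<close>, whose joint continuity the balance
    law requires.\<close>
  have "\<exists>vxx. \<forall>x\<in>{0<..<L}. (vx t has_real_derivative vxx x) (at x)" if t: "0 < t" for t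
  proof -
    have "Ck_on (Suc (Suc 0)) {0<..<L} (v t)" using S t by (metis numeral_2_eq_2)
    then obtain v1 v2 where v1: "\<And>x. x \<in> {0<..<L} \<Longrightarrow> (v t has_real_derivative v1 x) (at x within {0<..<L})"
      and v2: "\<And>x. x \<in> {0<..<L} \<Longrightarrow> (v1 has_real_derivative v2 x) (at x within {0<..<L})"
      by (simp only: Ck_on.simps) blast
    have "v1 x = vx t x" if "x \<in> {0<..<L}" for x
      using DERIV_unique[OF v1[OF that, unfolded atx[OF that]] vxi[OF t that]] .
    then have "(vx t has_real_derivative v2 x) (at x)" if "x \<in> {0<..<L}" for x
      using v2[OF that, unfolded atx[OF that]]
      by (rule has_field_derivative_transform_within_open[of _ _ _ "{0<..<L}", rotated 3]) (use that in auto)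
    then show ?thesis by blast
  qed
  then obtain vxx where vxxi: "\<And>t x. 0 < t \<Longrightarrow> x \<in> {0<..<L} \<Longrightarrow> (vx t has_real_derivative vxx t x) (at x)"
    by metis
  have h0: "continuous_on {0..} (\<lambda>t. h t 0)"
    using ht pos by (intro DERIV_continuous_on[where D = "\<lambda>t. ht t 0"]) auto
  have hc: "continuous_on ({0..} \<times> {0..L}) (\<lambda>p. h (fst p) (snd p))"
    using C1_jointly_continuous[where u = h and ux = hx and I = "{0..}" and L = L, OF h0] hx hxc by (simp add: case_prod_beta)
  have htxi: "(ht t has_real_derivative hxt t x) (at x)" if "0 < t" "x \<in> {0<..<L}" for t x
  proof (rule mixed_partials_swap[where u = h and ux = hx and ut = ht and uxt = hxt and L = L])
    show "continuous_on ({0<..} \<times> {0<..<L}) (\<lambda>(t, x). hx t x)"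
      by (simp add: case_prod_beta) (rule continuous_on_subset[OF hxc], auto)
    show "continuous_on ({0<..} \<times> {0<..<L}) (\<lambda>(t, x). hxt t x)"
      using hxtc by (simp add: case_prod_beta)
  qed (use hti hxi hxti that in auto)

  have mass: "ht t x = - (hx t x * v t x + h t x * vx t x)" if "0 < t" "x \<in> {0<..<L}" for t x
  proof -
    have "dt h t x + dx L (\<lambda>t x. h t x * v t x) t x = 0" using S that by auto
    moreover have "dt h t x = ht t x" using that hti by (intro dt_eqI) auto
    moreover have "dx L (\<lambda>t x. h t x * v t x) t x = hx t x * v t x + vx t x * h t x"
      using that hxi vxi by (intro dx_eqI DERIV_mult) auto
    ultimately show ?thesis by (simp add: mult.commute)
  qed
  have mass_x: "hxt t x = - (hxx t x * v t x + 2 * hx t x * vx t x + h t x * vxx t x)"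
    if "0 < t" "x \<in> {0<..<L}" for t x
  proof -
    have "((\<lambda>x. - (hx t x * v t x + h t x * vx t x)) has_real_derivative
        - ((hxx t x * v t x + vx t x * hx t x) + (hx t x * vx t x + vxx t x * h t x))) (at x)"
      by (intro DERIV_minus DERIV_add DERIV_mult hxxi vxi hxi vxxi that)
    then have "(ht t has_real_derivative
        - ((hxx t x * v t x + vx t x * hx t x) + (hx t x * vx t x + vxx t x * h t x))) (at x)"
      by (rule has_field_derivative_transform_within_open[of _ _ _ "{0<..<L}"]) (use that mass in auto)
    from DERIV_unique[OF htxi[OF that] this] show ?thesis by (simp add: algebra_simps)
  qed
  have mom: "ht t x * v t x + h t x * vt t x + hx t x * (v t x)\<^sup>2 + 2 * h t x * v t x * vx t x + g * h t x * hx t x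
      = \<mu> * (hx t x * vx t x + h t x * vxx t x) + h t x * f t" if t: "0 < t" and x: "x \<in> {0<..<L}" for t x
  proof -
    have "dt (\<lambda>t x. h t x * v t x) t x + dx L (\<lambda>t x. h t x * (v t x)\<^sup>2 + 1 / 2 * g * (h t x)\<^sup>2) t x
          = \<mu> * dx L (\<lambda>t x. h t x * dx L v t x) t x + h t x * f t" using S t x by blast
    moreover have "dt (\<lambda>t x. h t x * v t x) t x = ht t x * v t x + vt t x * h t x"
      using t x by (intro dt_eqI DERIV_mult hti vti) auto
    moreover have "dx L (\<lambda>t x. h t x * (v t x)\<^sup>2 + 1 / 2 * g * (h t x)\<^sup>2) t x =
        hx t x * (v t x)\<^sup>2 + 2 * h t x * v t x * vx t x + g * h t x * hx t x"
      using hxi[OF t x] vxi[OF t x] by (intro dx_eqI x) (auto intro!: derivative_eq_intros)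
    moreover have "dx L (\<lambda>t x. h t x * dx L v t x) t x = hx t x * vx t x + vxx t x * h t x"
    proof (rule dx_eqI[OF x])
      have e: "vx t y = dx L v t y" if "y \<in> {0<..<L}" for y
        using dx_eqI[where u = v, OF that vxi[OF t that]] by simp
      have "((\<lambda>x. h t x * vx t x) has_real_derivative hx t x * vx t x + vxx t x * h t x) (at x)"
        by (intro DERIV_mult hxi vxxi t x)
      then show "((\<lambda>x. h t x * dx L v t x) has_real_derivative hx t x * vx t x + vxx t x * h t x) (at x)"
        by (rule has_field_derivative_transform_within_open[of _ _ _ "{0<..<L}"])
          (use x e in auto)
    qed
    ultimately show ?thesis by (simp add: algebra_simps)
  qed

  \<comment> \<open>\<open>et\<close> is the time derivative of the density, \<open>src\<close> the
    claimed dissipation, and \<open>flux\<close> a primitive in x of their difference. Every term of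
    \<open>flux\<close> has the factor v, so the boundary condition makes it vanish at the
    walls.\<close>
  define et where "et t x = (h t x * v t x + \<mu> * hx t x) / h t x * (ht t x * v t x + h t x * vt t x + \<mu> * hxt t x)
      - ((h t x * v t x + \<mu> * hx t x) / h t x)\<^sup>2 * ht t x / 2
      + ht t x * (v t x)\<^sup>2 / 2 + h t x * v t x * vt t x + 2 * g * (h t x - hs) * ht t x" for t x
  define flux where "flux t x = v t x * energy_density g \<mu> hs (h t x) (hx t x) (v t x)
      - \<mu> * (h t x * v t x * vx t x) + 2 * g * (h t x - hs) * (h t x * v t x) - g * (h t x - hs)\<^sup>2 * v t x" for t x
  define src where "src t x = f t * (2 * h t x * v t x + \<mu> * hx t x)
         - \<mu> * g * (hx t x)\<^sup>2 - \<mu> * h t x * (vx t x)\<^sup>2" for t x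

  have sub: "{0<..} \<times> {0..L} \<subseteq> {0::real..} \<times> {0..L}" "{0<..} \<times> {0<..<L} \<subseteq> {0::real..} \<times> {0..L}"
    "{0<..} \<times> {0<..<L} \<subseteq> {0::real<..} \<times> {0..L}" by auto
  note c1 = hc[THEN continuous_on_subset[OF _ sub(1)]] hxc[THEN continuous_on_subset[OF _ sub(1)]]
    vc[THEN continuous_on_subset[OF _ sub(1)]] vxc
  note c2 = hc[THEN continuous_on_subset[OF _ sub(2)]] hxc[THEN continuous_on_subset[OF _ sub(2)]]
    vc[THEN continuous_on_subset[OF _ sub(2)]] htc[THEN continuous_on_subset[OF _ sub(2)]] hxtc
    vtc[THEN continuous_on_subset[OF _ sub(3)]]
  have nz: "h (fst p) (snd p) \<noteq> 0" if "p \<in> {0<..} \<times> {0..L}" for p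
    using hpos[of "fst p" "snd p"] that by auto
  have cu: "continuous_on ({0<..} \<times> {0..L}) (\<lambda>p. energy_density g \<mu> hs (h (fst p) (snd p)) (hx (fst p) (snd p)) (v (fst p) (snd p)))"
    unfolding energy_density_def by (intro continuous_intros c1) (use nz in auto)
  have cf: "continuous_on ({0<..} \<times> {0..L}) (\<lambda>p. f (fst p))"
    by (rule continuous_on_compose2[OF fc]) (auto intro!: continuous_intros)
  have der: "((\<lambda>t. integral {0..L} (\<lambda>x. energy_density g \<mu> hs (h t x) (hx t x) (v t x))) has_real_derivative
      integral {0..L} (src t)) (at t)" if t: "0 < t" for t
  proof (rule balance_law_integral[where u = "\<lambda>t x. energy_density g \<mu> hs (h t x) (hx t x) (v t x)"
      and q = flux and s = src and ut = et, OF pos(1) t])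
    show "continuous_on ({0<..} \<times> {0..L}) (\<lambda>(t, x). energy_density g \<mu> hs (h t x) (hx t x) (v t x))"
      using cu by (simp add: case_prod_beta)
    show "continuous_on ({0<..} \<times> {0..L}) (\<lambda>(t, x). flux t x)"
      unfolding flux_def case_prod_beta by (intro continuous_intros cu c1)
    show "continuous_on ({0<..} \<times> {0..L}) (\<lambda>(t, x). src t x)"
      unfolding src_def case_prod_beta by (intro continuous_intros cf c1)
    show "continuous_on ({0<..} \<times> {0<..<L}) (\<lambda>(t, x). et t x)"
      unfolding et_def case_prod_beta
      by (intro continuous_on_add continuous_on_diff continuous_on_mult continuous_on_divide continuous_on_power
          continuous_on_const c2) (use nz in auto)
    show "flux t 0 = 0" "flux t L = 0" if "0 < t" for t
      using v0[of t] that by (auto simp: flux_def)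
  next
    fix t x :: real assume t: "0 < t" and x: "x \<in> {0<..<L}"
    have x': "x \<in> {0..L}" using x by auto
    have nz: "h t x \<noteq> 0" using hpos[of t x] t x by auto
    show "((\<lambda>t. energy_density g \<mu> hs (h t x) (hx t x) (v t x)) has_real_derivative et t x) (at t)"
      unfolding et_def by (rule DERIV_energy_density[OF hti[OF t x'] hxti[OF t x] vti[OF t x'] refl nz])
    define ex where "ex = (h t x * v t x + \<mu> * hx t x) / h t x * (hx t x * v t x + h t x * vx t x + \<mu> * hxx t x)
       - ((h t x * v t x + \<mu> * hx t x) / h t x)\<^sup>2 * hx t x / 2
       + hx t x * (v t x)\<^sup>2 / 2 + h t x * v t x * vx t x + 2 * g * (h t x - hs) * hx t x"
    note de = DERIV_energy_density[OF hxi[OF t x] hxxi[OF t x] vxi[OF t x] refl nz, of g \<mu> hs, folded ex_def]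
    have d3: "((\<lambda>x. 2 * g * (h t x - hs)) has_real_derivative 2 * g * hx t x) (at x)"
      and d4: "((\<lambda>x. g * (h t x - hs)\<^sup>2) has_real_derivative g * (2 * (h t x - hs) * hx t x)) (at x)"
      using hxi[OF t x] by (auto intro!: derivative_eq_intros)
    note dflux = DERIV_diff[OF DERIV_add[OF DERIV_diff[OF DERIV_mult[OF vxi[OF t x] de]
          DERIV_cmult[OF DERIV_mult[OF DERIV_mult[OF hxi[OF t x] vxi[OF t x]] vxxi[OF t x]], where c = \<mu>]]
        DERIV_mult[OF d3 DERIV_mult[OF hxi[OF t x] vxi[OF t x]]]] DERIV_mult[OF d4 vxi[OF t x]]]
    note bal = energy_balance_pointwise[OF nz mass[OF t x] mass_x[OF t x] mom[OF t x], where hs = hs,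
        folded et_def src_def ex_def]
    show "(flux t has_real_derivative src t x - et t x) (at x)"
      unfolding flux_def[abs_def] bal[symmetric]
      by (rule DERIV_cong[OF dflux]) (simp add: algebra_simps power2_eq_square)
  qed
  have fin: "((\<lambda>t. fluid_energy L g \<mu> hs (h t) (hx t) (v t)) has_real_derivative
       integral {0..L} (\<lambda>x. feedback L \<mu> q \<sigma> k \<gamma> \<xi> h \<zeta> t * (2 * h t x * v t x + \<mu> * hx t x)
         - \<mu> * g * (hx t x)\<^sup>2 - \<mu> * h t x * (vx t x)\<^sup>2)) (at t)" if "0 < t" for t
    using der[OF that] unfolding src_def f_def fluid_energy_def .
  show thesis
    by (rule that[of hx vx]) (simp_all add: hx hc hxc vx vxc fin)
qed

section \<open>Exponential decay\<close>

text \<open>Up to the first time \<open>t1\<close> at which P reaches r', the function exp (\<kappa>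
  t) P is nonincreasing, whence P(t1) \<le> P(0) < r', a contradiction. At t = 0 only continuity
  enters, so the strict gap between P(0) and r' carries the start.\<close>

lemma differential_inequality_decay:
  fixes P :: "real \<Rightarrow> real"
  assumes cont: "continuous_on {0..} P"
    and deriv: "\<And>t. 0 < t \<Longrightarrow> P t \<le> r' \<Longrightarrow> \<exists>d. (P has_real_derivative d) (at t) \<and> d \<le> - \<kappa> * P t"
    and P0: "0 \<le> P 0" "P 0 < r'" and \<kappa>: "0 < \<kappa>" and T: "0 \<le> T"
  shows "P T \<le> exp (- \<kappa> * T) * P 0"
proof -
  have decay: "P T \<le> exp (- \<kappa> * T) * P 0" if T: "0 \<le> T" and le: "\<And>t. 0 < t \<Longrightarrow> t < T \<Longrightarrow> P t \<le> r'" for T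
  proof -
    have "exp (\<kappa> * T) * P T \<le> exp (\<kappa> * 0) * P 0"
    proof (rule DERIV_nonpos_imp_decreasing_open[OF T])
      fix t assume t: "0 < t" "t < T"
      obtain d where d: "(P has_real_derivative d) (at t)" "d \<le> - \<kappa> * P t" using deriv le t by blast
      have "((\<lambda>t. exp (\<kappa> * t) * P t) has_real_derivative exp (\<kappa> * t) * (\<kappa> * P t + d)) (at t)"
        using d(1) by (auto intro!: derivative_eq_intros simp: algebra_simps)
      moreover have "exp (\<kappa> * t) * (\<kappa> * P t + d) \<le> 0" using d(2) by (simp add: mult_nonneg_nonpos)
      ultimately show "\<exists>y. ((\<lambda>t. exp (\<kappa> * t) * P t) has_real_derivative y) (at t) \<and> y \<le> 0" by blast
    next
      show "continuous_on {0..T} (\<lambda>t. exp (\<kappa> * t) * P t)"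
        by (intro continuous_intros continuous_on_subset[OF cont]) auto
    qed
    then have "exp (- (\<kappa> * T)) * (exp (\<kappa> * T) * P T) \<le> exp (- (\<kappa> * T)) * P 0" by simp
    then show ?thesis by (simp add: mult.assoc[symmetric] exp_add[symmetric])
  qed
  have below: "P t < r'" if "0 \<le> t" for t
  proof (rule ccontr)
    assume neg: "\<not> P t < r'"
    define A where "A = {0..t} \<inter> P -` {r'..}"
    have "closed A"
      unfolding A_def
      by (intro continuous_closed_preimage continuous_on_subset[OF cont]) auto
    then have A: "closed A" "A \<noteq> {}" "bdd_below A" using neg that by (auto simp: A_def)
    define t1 where "t1 = Inf A"
    have t1: "t1 \<in> A" unfolding t1_def using closed_contains_Inf[OF A(2,3,1)] .
    have lt: "P s < r'" if "0 \<le> s" "s < t1" for s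
    proof (rule ccontr)
      assume "\<not> P s < r'"
      then have "s \<in> A" using that t1 by (auto simp: A_def)
      then show False using cInf_lower[OF _ A(3), of s] that by (simp add: t1_def)
    qed
    have "P t1 \<le> exp (- \<kappa> * t1) * P 0" using t1 lt by (intro decay) (auto simp: A_def less_imp_le)
    also have "\<dots> \<le> 1 * P 0" using t1 \<kappa> P0 by (intro mult_right_mono) (auto simp: A_def)
    finally show False using t1 P0 by (auto simp: A_def)
  qed
  show ?thesis using T below by (intro decay) (auto intro: less_imp_le)
qed

lemma square_sum_le: "(x + y)\<^sup>2 \<le> 2 * x\<^sup>2 + 2 * y\<^sup>2" for x y :: real
  using zero_le_power2[of "x - y"] by (simp add: power2_eq_square algebra_simps)

text \<open>The term z^2 is not dissipated directly; since q z = \<mu> \<Delta> - Y, it is shared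
  between H and Y^2. The rate is fixed before the numbers it is applied to, so it is the same for
  all times and solutions.\<close>

lemma lyapunov_rate:
  fixes L g \<mu> q \<sigma> k \<gamma> C\<^sub>Q C\<^sub>H :: real
  assumes pos: "0 < L" "0 < g" "0 < \<mu>" "0 < q" "0 < \<sigma>" "0 < k" "0 < \<gamma>" "0 < C\<^sub>Q" "0 < C\<^sub>H"
  obtains \<kappa> where "0 < \<kappa>"
    "\<And>E H Q \<xi> z e \<Delta> Y. E \<le> C\<^sub>Q * Q + C\<^sub>H * H \<Longrightarrow> \<Delta>\<^sup>2 \<le> L * H \<Longrightarrow> Y = \<mu> * \<Delta> - q * z \<Longrightarrow> 0 \<le> H \<Longrightarrow> 0 \<le> Q \<Longrightarrow>
      \<kappa> * (E + q * k\<^sup>2 / 2 * \<xi>\<^sup>2 + q / 2 * z\<^sup>2 + \<sigma> * q\<^sup>2 / \<gamma> * e\<^sup>2)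
      \<le> \<mu> * g / 2 * H + \<mu> / 16 * Q + q * k ^ 3 * \<xi>\<^sup>2 + \<sigma> / 100 * Y\<^sup>2 + \<sigma> / 100 * (q * e)\<^sup>2"
proof -
  define B where "B = C\<^sub>H + \<mu>\<^sup>2 * L / q"
  have B: "0 < B" using pos by (simp add: B_def add_pos_pos)
  \<comment> \<open>The five entries match, in order, the terms in Q, H, \<xi>^2, Y^2 and (q
    e)^2.\<close>
  define \<kappa> where "\<kappa> = Min {\<mu> / 16 / C\<^sub>Q, \<mu> * g / 2 / B, 2 * k, \<sigma> * q / 100, \<gamma> / 100}"
  have \<kappa>0: "0 < \<kappa>" using pos B by (simp add: \<kappa>_def)
  have "\<kappa> \<le> \<mu> / 16 / C\<^sub>Q" "\<kappa> \<le> \<mu> * g / 2 / B" "\<kappa> \<le> 2 * k" "\<kappa> \<le> \<sigma> * q / 100" "\<kappa> \<le> \<gamma> / 100"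
    unfolding \<kappa>_def by (intro Min_le; simp)+
  then have le: "\<kappa> * C\<^sub>Q \<le> \<mu> / 16" "\<kappa> * B \<le> \<mu> * g / 2" "\<kappa> * (q * k\<^sup>2 / 2) \<le> q * k ^ 3" "\<kappa> * (1 / q) \<le> \<sigma> / 100"
    "\<kappa> * (\<sigma> / \<gamma>) \<le> \<sigma> / 100"
    using pos B by (simp_all add: pos_le_divide_eq field_simps power3_eq_cube power2_eq_square)
  show thesis
  proof (rule that[OF \<kappa>0])
    fix E H Q \<xi> z e \<Delta> Y :: real
    assume E: "E \<le> C\<^sub>Q * Q + C\<^sub>H * H" and \<Delta>: "\<Delta>\<^sup>2 \<le> L * H" and Y: "Y = \<mu> * \<Delta> - q * z" and H: "0 \<le> H" and Q: "0 \<le> Q"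
    have "q\<^sup>2 * z\<^sup>2 = (\<mu> * \<Delta> + (- Y))\<^sup>2" using Y by (simp add: power_mult_distrib[symmetric])
    also have "\<dots> \<le> 2 * \<mu>\<^sup>2 * \<Delta>\<^sup>2 + 2 * Y\<^sup>2"
      using square_sum_le[of "\<mu> * \<Delta>" "- Y"] by (simp add: power_mult_distrib mult.assoc)
    also have "\<dots> \<le> 2 * \<mu>\<^sup>2 * (L * H) + 2 * Y\<^sup>2" using \<Delta> by (simp add: mult_left_mono)
    finally have "q / 2 * z\<^sup>2 \<le> \<mu>\<^sup>2 * L / q * H + 1 / q * Y\<^sup>2"
      using pos by (simp add: field_simps power2_eq_square)
    moreover have "\<sigma> * q\<^sup>2 / \<gamma> * e\<^sup>2 = \<sigma> / \<gamma> * (q * e)\<^sup>2" by (simp add: power_mult_distrib)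
    ultimately have "E + q * k\<^sup>2 / 2 * \<xi>\<^sup>2 + q / 2 * z\<^sup>2 + \<sigma> * q\<^sup>2 / \<gamma> * e\<^sup>2
       \<le> C\<^sub>Q * Q + B * H + q * k\<^sup>2 / 2 * \<xi>\<^sup>2 + 1 / q * Y\<^sup>2 + \<sigma> / \<gamma> * (q * e)\<^sup>2"
      using E unfolding B_def distrib_right by linarith
    then have "\<kappa> * (E + q * k\<^sup>2 / 2 * \<xi>\<^sup>2 + q / 2 * z\<^sup>2 + \<sigma> * q\<^sup>2 / \<gamma> * e\<^sup>2)
       \<le> \<kappa> * (C\<^sub>Q * Q + B * H + q * k\<^sup>2 / 2 * \<xi>\<^sup>2 + 1 / q * Y\<^sup>2 + \<sigma> / \<gamma> * (q * e)\<^sup>2)"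
      using \<kappa>0 by (intro mult_left_mono) auto
    also have "\<dots> = (\<kappa> * C\<^sub>Q) * Q + (\<kappa> * B) * H + (\<kappa> * (q * k\<^sup>2 / 2)) * \<xi>\<^sup>2 + (\<kappa> * (1 / q)) * Y\<^sup>2 + (\<kappa> * (\<sigma> / \<gamma>)) * (q * e)\<^sup>2"
      by (simp only: distrib_left mult.assoc)
    also have "\<dots> \<le> \<mu> / 16 * Q + \<mu> * g / 2 * H + q * k ^ 3 * \<xi>\<^sup>2 + \<sigma> / 100 * Y\<^sup>2 + \<sigma> / 100 * (q * e)\<^sup>2"
      by (intro add_mono mult_right_mono le H Q zero_le_power2)
    finally show "\<kappa> * (E + q * k\<^sup>2 / 2 * \<xi>\<^sup>2 + q / 2 * z\<^sup>2 + \<sigma> * q\<^sup>2 / \<gamma> * e\<^sup>2)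
      \<le> \<mu> * g / 2 * H + \<mu> / 16 * Q + q * k ^ 3 * \<xi>\<^sup>2 + \<sigma> / 100 * Y\<^sup>2 + \<sigma> / 100 * (q * e)\<^sup>2" by simp
  qed
qed

text \<open>The constant is produced before the numbers E, D, H, U, \<xi>, w, e, hence depends only
  on the parameters and the level bounds; this is what allows one M for all solutions.\<close>

lemma lyapunov_norm_equivalence:
  fixes g \<mu> q \<sigma> k \<gamma> a b :: real
  assumes pos: "0 < g" "0 < \<mu>" "0 < q" "0 < \<sigma>" "0 < k" "0 < \<gamma>" "0 < a" "0 < b"
  obtains C where "0 < C"
    "\<And>E D H U \<xi> w e. \<mu>\<^sup>2 / (4 * b) * H \<le> E \<Longrightarrow> a / 2 * U \<le> E \<Longrightarrow> g * D \<le> E \<Longrightarrow>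
      E \<le> 3 / 2 * b * U + \<mu>\<^sup>2 / a * H + g * D \<Longrightarrow> 0 \<le> H \<Longrightarrow> 0 \<le> U \<Longrightarrow> 0 \<le> D \<Longrightarrow>
      \<xi>\<^sup>2 + w\<^sup>2 + D + H + U + e\<^sup>2 \<le> C * (E + q * k\<^sup>2 / 2 * \<xi>\<^sup>2 + q / 2 * (w + k * \<xi>)\<^sup>2 + \<sigma> * q\<^sup>2 / \<gamma> * e\<^sup>2) \<and>
      E + q * k\<^sup>2 / 2 * \<xi>\<^sup>2 + q / 2 * (w + k * \<xi>)\<^sup>2 + \<sigma> * q\<^sup>2 / \<gamma> * e\<^sup>2 \<le> C * (\<xi>\<^sup>2 + w\<^sup>2 + D + H + U + e\<^sup>2)"
proof -
  define C1 where "C1 = 4 * b / \<mu>\<^sup>2 + 2 / a + 1 / g + 2 / (q * k\<^sup>2) + 8 / q + \<gamma> / (\<sigma> * q\<^sup>2)"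
  define C2 where "C2 = 3 / 2 * b + \<mu>\<^sup>2 / a + g + 3 / 2 * (q * k\<^sup>2) + q + \<sigma> * q\<^sup>2 / \<gamma>"
  have C: "0 < C1" "0 < C2" using pos by (simp_all add: C1_def C2_def add_pos_pos)
  show thesis
  proof (rule that[of "max C1 C2"])
    fix E D H U \<xi> w e :: real
    assume lo: "\<mu>\<^sup>2 / (4 * b) * H \<le> E" "a / 2 * U \<le> E" "g * D \<le> E"
      and up: "E \<le> 3 / 2 * b * U + \<mu>\<^sup>2 / a * H + g * D" and nn: "0 \<le> H" "0 \<le> U" "0 \<le> D"
    define \<Psi> where "\<Psi> = E + q * k\<^sup>2 / 2 * \<xi>\<^sup>2 + q / 2 * (w + k * \<xi>)\<^sup>2 + \<sigma> * q\<^sup>2 / \<gamma> * e\<^sup>2"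
    define N where "N = \<xi>\<^sup>2 + w\<^sup>2 + D + H + U + e\<^sup>2"
    have E0: "0 \<le> E" using order_trans[OF mult_nonneg_nonneg lo(3)] pos nn by simp
    have t: "0 \<le> q * k\<^sup>2 / 2 * \<xi>\<^sup>2" "0 \<le> q / 2 * (w + k * \<xi>)\<^sup>2" "0 \<le> \<sigma> * q\<^sup>2 / \<gamma> * e\<^sup>2" using pos by auto
    then have le: "E \<le> \<Psi>" "q * k\<^sup>2 / 2 * \<xi>\<^sup>2 \<le> \<Psi>" "q / 2 * (w + k * \<xi>)\<^sup>2 \<le> \<Psi>" "\<sigma> * q\<^sup>2 / \<gamma> * e\<^sup>2 \<le> \<Psi>"
      using E0 unfolding \<Psi>_def by linarith+
    have \<Psi>0: "0 \<le> \<Psi>" using E0 le(1) by simp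
    have "H \<le> 4 * b / \<mu>\<^sup>2 * \<Psi>" "U \<le> 2 / a * \<Psi>" "D \<le> 1 / g * \<Psi>" "\<xi>\<^sup>2 \<le> 2 / (q * k\<^sup>2) * \<Psi>" "e\<^sup>2 \<le> \<gamma> / (\<sigma> * q\<^sup>2) * \<Psi>"
      using order_trans[OF lo(1) le(1)] order_trans[OF lo(2) le(1)] order_trans[OF lo(3) le(1)] le(2,4) pos
      by (simp_all add: field_simps)
    moreover have "w\<^sup>2 \<le> 8 / q * \<Psi>"
    proof -
      have "w\<^sup>2 = ((w + k * \<xi>) + (- (k * \<xi>)))\<^sup>2" by simp
      also have "\<dots> \<le> 2 * (w + k * \<xi>)\<^sup>2 + 2 * (k * \<xi>)\<^sup>2" using square_sum_le[of "w + k * \<xi>" "- (k * \<xi>)"] by simp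
      also have "\<dots> = 4 / q * (q / 2 * (w + k * \<xi>)\<^sup>2) + 4 / q * (q * k\<^sup>2 / 2 * \<xi>\<^sup>2)"
        using pos by (simp add: power_mult_distrib)
      also have "\<dots> \<le> 4 / q * \<Psi> + 4 / q * \<Psi>"
        using pos le by (intro add_mono mult_left_mono) auto
      finally show ?thesis by simp
    qed
    ultimately have "N \<le> C1 * \<Psi>" by (simp add: N_def C1_def algebra_simps)
    also have "\<dots> \<le> max C1 C2 * \<Psi>" using \<Psi>0 by (intro mult_right_mono) auto
    finally have 1: "N \<le> max C1 C2 * \<Psi>" .
    have N: "\<xi>\<^sup>2 \<le> N" "w\<^sup>2 \<le> N" "D \<le> N" "H \<le> N" "U \<le> N" "e\<^sup>2 \<le> N" "0 \<le> N" using nn by (auto simp: N_def)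
    have "q / 2 * (w + k * \<xi>)\<^sup>2 \<le> q / 2 * (2 * w\<^sup>2 + 2 * (k * \<xi>)\<^sup>2)"
      using square_sum_le[of w "k * \<xi>"] pos by (intro mult_left_mono) auto
    also have "\<dots> = q * w\<^sup>2 + q * k\<^sup>2 * \<xi>\<^sup>2" by (simp add: power_mult_distrib algebra_simps)
    finally have "\<Psi> \<le> 3 / 2 * b * U + \<mu>\<^sup>2 / a * H + g * D + 3 / 2 * (q * k\<^sup>2) * \<xi>\<^sup>2 + q * w\<^sup>2 + \<sigma> * q\<^sup>2 / \<gamma> * e\<^sup>2"
      using up by (simp add: \<Psi>_def)
    also have "\<dots> \<le> 3 / 2 * b * N + \<mu>\<^sup>2 / a * N + g * N + 3 / 2 * (q * k\<^sup>2) * N + q * N + \<sigma> * q\<^sup>2 / \<gamma> * N"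
      using pos by (intro add_mono mult_left_mono N) auto
    also have "\<dots> = C2 * N" by (simp add: C2_def distrib_right)
    also have "\<dots> \<le> max C1 C2 * N" using N by (intro mult_right_mono) auto
    finally show "\<xi>\<^sup>2 + w\<^sup>2 + D + H + U + e\<^sup>2 \<le> max C1 C2 * (E + q * k\<^sup>2 / 2 * \<xi>\<^sup>2 + q / 2 * (w + k * \<xi>)\<^sup>2 + \<sigma> * q\<^sup>2 / \<gamma> * e\<^sup>2) \<and>
      E + q * k\<^sup>2 / 2 * \<xi>\<^sup>2 + q / 2 * (w + k * \<xi>)\<^sup>2 + \<sigma> * q\<^sup>2 / \<gamma> * e\<^sup>2 \<le> max C1 C2 * (\<xi>\<^sup>2 + w\<^sup>2 + D + H + U + e\<^sup>2)"
      using 1 unfolding N_def \<Psi>_def by blast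
  qed (use C in auto)
qed

text \<open>The strict inequality between \<open>\<sigma>\<close> and the ratio of level bounds leaves room to enlarge the
  energy bound from \<open>r\<close> to \<open>r'\<close>; this makes the continuation argument work at \<open>t = 0\<close>, where the
  Lyapunov functional need not be differentiable. The hypothesis is tailored to the Poincare constant
  \<open>L\<^sup>2 / \<pi>\<^sup>2\<close>, while the velocity bounds above use \<open>L\<^sup>2 / 4\<close>; the factor lost, \<open>\<pi>\<^sup>2 / 4 < 2.5\<close>, still
  leaves the coefficient \<open>8 / 5\<close> out of \<open>4\<close>.\<close>

lemma level_margins:
  fixes L m hs \<mu> \<sigma> c r :: real
  assumes hs: "hs = h_star L m" and hs_pos: "0 < hs"
    and pos: "0 < L" "0 < m" "0 < \<mu>" "0 < \<sigma>" "0 < c" "0 < r"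
    and cr: "c * r < 4 / 3 * (hs * sqrt hs)"
    and \<sigma>: "2 * pi\<^sup>2 * \<mu> * G_inv L m (- c * r) / (m * L\<^sup>2 * G_inv L m (c * r)) > 8 * \<sigma>"
  obtains a b r' where "0 < a" "0 < b" "r < r'"
    "\<And>y. 0 < y \<Longrightarrow> \<bar>G_fun L m y\<bar> \<le> c * r' \<Longrightarrow> a \<le> y \<and> y \<le> b"
    "8 / 5 * \<sigma> * (m * b * L\<^sup>2 / (4 * a)) \<le> \<mu>"
proof -
  define lo hi where "lo = G_inv L m (- c * r)" and "hi = G_inv L m (c * r)"
  have lo: "0 < lo" "G_fun L m lo = - (c * r)" and hi: "0 < hi" "G_fun L m hi = c * r"
    using G_inv_props[OF hs hs_pos, of "- c * r"] G_inv_props[OF hs hs_pos, of "c * r"] cr pos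
    by (auto simp: lo_def hi_def)
  \<comment> \<open>Widening the interval between \<open>lo\<close> and \<open>hi\<close> makes room
    for an energy threshold strictly above r.\<close>
  define a b where "a = 999 / 1000 * lo" and "b = 1000 / 999 * hi"
  have ab: "0 < a" "a < lo" "hi < b" "0 < b" using lo hi by (auto simp: a_def b_def)
  \<comment> \<open>The largest threshold for which |G(y)| \<le> c r' still confines y to the
    interval from a to b.\<close>
  define r' where "r' = min (- G_fun L m a) (G_fun L m b) / c"
  have "G_fun L m a < - (c * r)" "c * r < G_fun L m b"
    using G_fun_strict_mono[OF hs hs_pos, of a lo] G_fun_strict_mono[OF hs hs_pos, of hi b] ab lo hi by auto
  then have r': "r < r'" using pos by (simp add: r'_def field_simps)
  have bounds: "a \<le> y \<and> y \<le> b" if y: "0 < y" "\<bar>G_fun L m y\<bar> \<le> c * r'" for y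
  proof -
    have "c * r' \<le> - G_fun L m a" "c * r' \<le> G_fun L m b" using pos by (auto simp: r'_def)
    then have "G_fun L m a \<le> G_fun L m y" "G_fun L m y \<le> G_fun L m b" using y by auto
    then show ?thesis
      using G_fun_strict_mono[OF hs hs_pos, of y a] G_fun_strict_mono[OF hs hs_pos, of b y] y ab by force
  qed
  \<comment> \<open>The value 63/20 suffices: 2/5 times (63/20)^2 / 4 is 0.99225, still below
    (999/1000)^2, the price of widening the level bounds.\<close>
  have "pi\<^sup>2 \<le> (63 / 20)\<^sup>2" using pi_approx(2) by (intro power_mono) auto
  then have "8 * \<sigma> * (m * L\<^sup>2 * hi) < 2 * (63 / 20)\<^sup>2 * (\<mu> * lo)"
  proof -
    have "8 * \<sigma> * (m * L\<^sup>2 * hi) < 2 * pi\<^sup>2 * (\<mu> * lo)"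
      using \<sigma>[folded lo_def hi_def] pos hi(1) by (simp add: pos_less_divide_eq mult.assoc)
    also have "\<dots> \<le> 2 * (63 / 20)\<^sup>2 * (\<mu> * lo)"
      using \<open>pi\<^sup>2 \<le> (63 / 20)\<^sup>2\<close> pos lo by (intro mult_right_mono mult_left_mono) auto
    finally show ?thesis .
  qed
  then have "2 / 5 * \<sigma> * m * L\<^sup>2 * b \<le> \<mu> * a"
    using mult_pos_pos[OF pos(3) lo(1)] by (simp add: a_def b_def power2_eq_square mult_ac)
  then have "8 / 5 * \<sigma> * (m * b * L\<^sup>2 / (4 * a)) \<le> \<mu>"
    using ab by (simp add: field_simps)
  then show thesis using that[OF ab(1,4) r' bounds] by blast
qed

text \<open>For h^* < H_max, c R is the smaller of G(H_max) and minus the limit of G at 0. The first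
  keeps the level below the wall; the second, which is the displayed bound, puts c r and -c r into
  the range of G.\<close>

lemma R_const_bound:
  assumes "0 < g" "0 < \<mu>" "0 < Hmax"
  shows "c_const g \<mu> * R_const L g \<mu> m Hmax =
    2 / 3 * (2 * h_star L m * sqrt (h_star L m) + sqrt Hmax * min (Hmax - 3 * h_star L m) 0)"
    "c_const g \<mu> * R_const L g \<mu> m Hmax \<le> 4 / 3 * (h_star L m * sqrt (h_star L m))"
proof -
  show 1: "c_const g \<mu> * R_const L g \<mu> m Hmax =
    2 / 3 * (2 * h_star L m * sqrt (h_star L m) + sqrt Hmax * min (Hmax - 3 * h_star L m) 0)"
    using assms by (simp add: c_const_def R_const_def)
  have "sqrt Hmax * min (Hmax - 3 * h_star L m) 0 \<le> 0"
    using assms by (intro mult_nonneg_nonpos) auto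
  then show "c_const g \<mu> * R_const L g \<mu> m Hmax \<le> 4 / 3 * (h_star L m * sqrt (h_star L m))"
    unfolding 1 by simp
qed

lemma classical_solution_profile:
  assumes pos: "0 < L" "0 < g" "0 < \<mu>" "0 < m" and hs: "hs = h_star L m"
    and sol: "classical_solution L g \<mu> m q \<sigma> k \<gamma> \<xi> w h v \<zeta>" and t: "0 \<le> t"
    and hx: "\<And>x. x \<in> {0..L} \<Longrightarrow> (h t has_real_derivative hx x) (at x within {0..L})"
    and chx: "continuous_on {0..L} hx"
  shows "level_profile L g \<mu> m hs (h t) hx (v t)" "(\<xi> t, w t, h t, v t) \<in> S_set L m"
proof -
  note S = sol[unfolded classical_solution_def Let_def]
  have hpos: "\<And>x. x \<in> {0..L} \<Longrightarrow> 0 < h t x" using S t by blast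
  have mass: "(LBINT x:{0..L}. h t x) = m" using S t by blast
  have v0: "v t 0 = 0" "v t L = 0" using S t by blast+
  have "continuous_on ({0..} \<times> {0..L}) (\<lambda>p. v (fst p) (snd p))"
    using S by (simp add: case_prod_beta)
  then have "continuous_on {0..L} (\<lambda>x. v (fst (t, x)) (snd (t, x)))"
    by (rule continuous_on_compose2) (use t in \<open>auto intro!: continuous_intros\<close>)
  then have cv: "continuous_on {0..L} (v t)" by simp
  show "level_profile L g \<mu> m hs (h t) hx (v t)"
    by unfold_locales (fact pos hs hx chx hpos mass cv)+
  have "h t \<in> H1 L" by (rule C1_weak_deriv(1)[OF less_imp_le[OF pos(1)] hx chx])
  moreover have "continuous_on {0..L} (h t)" using hx by (rule DERIV_continuous_on)
  ultimately show "(\<xi> t, w t, h t, v t) \<in> S_set L m"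
    using hpos mass v0 cv by (auto simp: S_set_def)
qed

lemma exponential_decay:
  fixes L g \<mu> m Hmax hs r q \<sigma> k \<gamma> :: real
  assumes pos: "0 < L" "0 < g" "0 < \<mu>" "0 < m" "0 < Hmax"
    and hs: "hs = h_star L m"
    and r: "0 < r" "r < R_const L g \<mu> m Hmax"
    and par: "0 < q" "0 < \<sigma>" "0 < k" "0 < \<gamma>"
    and \<sigma>: "\<sigma> < 2 * g / (\<mu> * L)" "8 * k / q < \<sigma>"
    and \<sigma>G: "2 * pi\<^sup>2 * \<mu> * G_inv L m (- c_const g \<mu> * r) / (m * L\<^sup>2 * G_inv L m (c_const g \<mu> * r)) > 8 * \<sigma>"
  shows "\<exists>M \<phi>. 0 < M \<and> 0 < \<phi> \<and> exp_decay_property L g \<mu> m Hmax r q \<sigma> k \<gamma> M \<phi>"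
proof -
  have hs_pos: "0 < hs" using pos by (simp add: hs h_star_def)
  define c where "c = c_const g \<mu>"
  have c: "0 < c" using pos by (simp add: c_def c_const_def)
  have "c * r < c * R_const L g \<mu> m Hmax" using r c by simp
  also have "\<dots> \<le> 4 / 3 * (hs * sqrt hs)" unfolding c_def hs using pos by (intro R_const_bound)
  finally have cr: "c * r < 4 / 3 * (hs * sqrt hs)" .
  obtain a b r' where ab: "0 < a" "0 < b" and r': "r < r'"
    and bounds: "\<And>y. 0 < y \<Longrightarrow> \<bar>G_fun L m y\<bar> \<le> c * r' \<Longrightarrow> a \<le> y \<and> y \<le> b"
    and margin: "8 / 5 * \<sigma> * (m * b * L\<^sup>2 / (4 * a)) \<le> \<mu>"
    using level_margins[OF hs hs_pos pos(1,4,3) par(2) c r(1) cr \<sigma>G[folded c_def]] by blast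
  \<comment> \<open>In the upper energy bound the velocity term is paid by viscous dissipation, via
    the Poincare factor L^2 / (4 a); slope and level deviation are paid by H.\<close>
  define C\<^sub>Q C\<^sub>H where "C\<^sub>Q = 3 / 2 * b * (L\<^sup>2 / (4 * a))" and "C\<^sub>H = \<mu>\<^sup>2 / a + g * L\<^sup>2"
  have C: "0 < C\<^sub>Q" "0 < C\<^sub>H" using pos ab by (auto simp: C\<^sub>Q_def C\<^sub>H_def add_pos_pos)
  obtain \<kappa> where \<kappa>: "0 < \<kappa>"
    "\<And>E H Q \<xi> z e \<Delta> Y. E \<le> C\<^sub>Q * Q + C\<^sub>H * H \<Longrightarrow> \<Delta>\<^sup>2 \<le> L * H \<Longrightarrow> Y = \<mu> * \<Delta> - q * z \<Longrightarrow> 0 \<le> H \<Longrightarrow> 0 \<le> Q \<Longrightarrow>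
      \<kappa> * (E + q * k\<^sup>2 / 2 * \<xi>\<^sup>2 + q / 2 * z\<^sup>2 + \<sigma> * q\<^sup>2 / \<gamma> * e\<^sup>2)
      \<le> \<mu> * g / 2 * H + \<mu> / 16 * Q + q * k ^ 3 * \<xi>\<^sup>2 + \<sigma> / 100 * Y\<^sup>2 + \<sigma> / 100 * (q * e)\<^sup>2"
    using lyapunov_rate[OF pos(1-3) par C] by blast
  obtain A where A: "0 < A"
    and equiv: "\<And>E D H U \<xi> w e. \<mu>\<^sup>2 / (4 * b) * H \<le> E \<Longrightarrow> a / 2 * U \<le> E \<Longrightarrow> g * D \<le> E \<Longrightarrow>
      E \<le> 3 / 2 * b * U + \<mu>\<^sup>2 / a * H + g * D \<Longrightarrow> 0 \<le> H \<Longrightarrow> 0 \<le> U \<Longrightarrow> 0 \<le> D \<Longrightarrow>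
      \<xi>\<^sup>2 + w\<^sup>2 + D + H + U + e\<^sup>2 \<le> A * (E + q * k\<^sup>2 / 2 * \<xi>\<^sup>2 + q / 2 * (w + k * \<xi>)\<^sup>2 + \<sigma> * q\<^sup>2 / \<gamma> * e\<^sup>2) \<and>
      E + q * k\<^sup>2 / 2 * \<xi>\<^sup>2 + q / 2 * (w + k * \<xi>)\<^sup>2 + \<sigma> * q\<^sup>2 / \<gamma> * e\<^sup>2 \<le> A * (\<xi>\<^sup>2 + w\<^sup>2 + D + H + U + e\<^sup>2)"
    using lyapunov_norm_equivalence[OF pos(2,3) par ab] by blast
  \<comment> \<open>The factor sqrt 2 comes from (x + y)^2 \<le> 2 x^2 + 2 y^2, A from using the
    norm equivalence at times t and 0, and the rate is halved because \<Psi> is quadratic in the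
    norm.\<close>
  have "exp_decay_property L g \<mu> m Hmax r q \<sigma> k \<gamma> (sqrt 2 * A) (\<kappa> / 2)"
    unfolding exp_decay_property_def
  proof (intro allI impI)
    fix \<xi> w h v \<zeta> t
    assume sol: "classical_solution L g \<mu> m q \<sigma> k \<gamma> \<xi> w h v \<zeta>"
      and init: "\<Psi>_fun L g \<mu> m q \<sigma> k \<gamma> (\<xi> 0, w 0, h 0, v 0) (\<zeta> 0) \<le> r"
      and t: "(0::real) \<le> t"
    define f where "f = feedback L \<mu> q \<sigma> k \<gamma> \<xi> h \<zeta>"
    note S = sol[unfolded classical_solution_def Let_def, folded f_def]
    obtain hx vx where
      hx: "\<And>t x. 0 \<le> t \<Longrightarrow> x \<in> {0..L} \<Longrightarrow> (h t has_real_derivative hx t x) (at x within {0..L})"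
      and hc: "continuous_on ({0..} \<times> {0..L}) (\<lambda>p. h (fst p) (snd p))"
      and hxc: "continuous_on ({0..} \<times> {0..L}) (\<lambda>p. hx (fst p) (snd p))"
      and vx: "\<And>t x. 0 < t \<Longrightarrow> x \<in> {0..L} \<Longrightarrow> (v t has_real_derivative vx t x) (at x within {0..L})"
      and vxc: "continuous_on ({0<..} \<times> {0..L}) (\<lambda>p. vx (fst p) (snd p))"
      and E': "\<And>t. 0 < t \<Longrightarrow> ((\<lambda>t. fluid_energy L g \<mu> hs (h t) (hx t) (v t)) has_real_derivative
         integral {0..L} (\<lambda>x. f t * (2 * h t x * v t x + \<mu> * hx t x)
           - \<mu> * g * (hx t x)\<^sup>2 - \<mu> * h t x * (vx t x)\<^sup>2)) (at t)"
      by (rule classical_solution_energy[OF pos(1-3) sol, of hs, folded f_def]) (rule that)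
    have slice: "continuous_on {0..L} (u t)"
      if "continuous_on (I \<times> {0..L}) (\<lambda>p. u (fst p) (snd p))" "t \<in> I" for I t and u :: "real \<Rightarrow> real \<Rightarrow> real"
    proof -
      have "continuous_on {0..L} (\<lambda>x. u (fst (t, x)) (snd (t, x)))"
        by (rule continuous_on_compose2[OF that(1)]) (use that(2) in \<open>auto intro!: continuous_intros\<close>)
      then show ?thesis by simp
    qed
    have chx: "continuous_on {0..L} (hx t)" if "0 \<le> t" for t using slice[OF hxc] that by simp
    have cvx: "continuous_on {0..L} (vx t)" if "0 < t" for t using slice[OF vxc] that by simp
    have prof: "level_profile L g \<mu> m hs (h t) (hx t) (v t)" "(\<xi> t, w t, h t, v t) \<in> S_set L m" if "0 \<le> t" for t
      using classical_solution_profile[OF pos(1-4) hs sol that hx[OF that] chx[OF that]] by blast+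
    define e where "e t = \<zeta> t - w t + \<gamma> * \<xi> t" for t
    define E where "E t = fluid_energy L g \<mu> hs (h t) (hx t) (v t)" for t
    define P where "P t = E t + q * k\<^sup>2 / 2 * (\<xi> t)\<^sup>2 + q / 2 * (w t + k * \<xi> t)\<^sup>2 + \<sigma> * q\<^sup>2 / \<gamma> * (e t)\<^sup>2" for t
    have V_eq: "V_fun L g \<mu> m q k (\<xi> t, w t, h t, v t) = E t + q * k\<^sup>2 / 2 * (\<xi> t)\<^sup>2 + q / 2 * (w t + k * \<xi> t)\<^sup>2"
      if "0 \<le> t" for t
      using level_profile.V_fun_eq[OF prof(1)[OF that]] unfolding E_def .
    have \<Psi>_eq: "\<Psi>_fun L g \<mu> m q \<sigma> k \<gamma> (\<xi> t, w t, h t, v t) (\<zeta> t) = P t" if "0 \<le> t" for t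
      unfolding \<Psi>_fun.simps V_eq[OF that] P_def e_def ..
    have V_le: "V_fun L g \<mu> m q k (\<xi> t, w t, h t, v t) \<le> P t" if "0 \<le> t" for t
      unfolding V_eq[OF that] P_def using par by simp
    have E_le: "E t \<le> P t" for t using par by (simp add: P_def)
    have level: "a \<le> h t x \<and> h t x \<le> b" if "0 \<le> t" "P t \<le> r'" "x \<in> {0..L}" for t x
    proof -
      have "\<bar>G_fun L m (h t x)\<bar> \<le> c * E t"
        using level_profile.G_fun_level_bound[OF prof(1)[OF that(1)] that(3)] by (simp add: c_def E_def)
      also have "\<dots> \<le> c * r'" using E_le[of t] that(2) c by (intro mult_left_mono) auto
      finally show ?thesis
        using bounds level_profile.h_pos[OF prof(1)[OF that(1)] that(3)] by blast
    qed

    have deriv: "\<exists>d. (P has_real_derivative d) (at t) \<and> d \<le> - \<kappa> * P t" if t: "0 < t" and Pt: "P t \<le> r'" for t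
    proof -
      interpret level_profile L g \<mu> m hs "h t" "hx t" "v t" using prof(1) t by simp
      define Q where "Q = integral {0..L} (\<lambda>x. h t x * (vx t x)\<^sup>2)"
      define N where "N = integral {0..L} (\<lambda>x. h t x * v t x)"
      define z where "z = w t + k * \<xi> t"
      define \<Delta> where "\<Delta> = h t L - h t 0"
      define Y where "Y = \<mu> * \<Delta> - q * z"
      have lev: "\<And>x. x \<in> {0..L} \<Longrightarrow> a \<le> h t x \<and> h t x \<le> b" using level[of t] t Pt by simp
      have v0: "v t 0 = 0" "v t L = 0" using S t by (metis less_imp_le)+
      note vb = velocity_bounds[OF vx[OF t] cvx[OF t] v0 ab(1) lev, folded Q_def N_def]
      note eb = fluid_energy_bounds[OF ab(1) lev, folded E_def]
      have Q0: "0 \<le> Q" unfolding Q_def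
        by (intro integral_nonneg integrable_continuous_interval continuous_on_mult continuous_on_power cont_h cvx[OF t]
            mult_nonneg_nonneg less_imp_le[OF h_pos] zero_le_power2)
      have "integral {0..L} (\<lambda>x. f t * (2 * h t x * v t x + \<mu> * hx t x) - \<mu> * g * (hx t x)\<^sup>2 - \<mu> * h t x * (vx t x)\<^sup>2)
        = integral {0..L} (\<lambda>x. 2 * f t * (h t x * v t x) + f t * \<mu> * hx t x - \<mu> * g * (hx t x)\<^sup>2 - \<mu> * (h t x * (vx t x)\<^sup>2))"
        by (intro Henstock_Kurzweil_Integration.integral_cong) (simp add: algebra_simps)
      also have "\<dots> = 2 * f t * N + f t * \<mu> * \<Delta> - \<mu> * g * H - \<mu> * Q"
      proof (rule integral_unique)
        have i: "((\<lambda>x. h t x * v t x) has_integral N) {0..L}" "(hx t has_integral \<Delta>) {0..L}"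
          "((\<lambda>x. (hx t x)\<^sup>2) has_integral H) {0..L}" "((\<lambda>x. h t x * (vx t x)\<^sup>2) has_integral Q) {0..L}"
          unfolding N_def Q_def \<Delta>_def integral_hx[symmetric]
          by (intro integrable_integral integrable_continuous_interval continuous_on_mult continuous_on_power cont_h
              cont_hx cont_v cvx[OF t])+
        show "((\<lambda>x. 2 * f t * (h t x * v t x) + f t * \<mu> * hx t x - \<mu> * g * (hx t x)\<^sup>2 - \<mu> * (h t x * (vx t x)\<^sup>2))
           has_integral (2 * f t * N + f t * \<mu> * \<Delta> - \<mu> * g * H - \<mu> * Q)) {0..L}"
          by (intro has_integral_diff has_integral_add has_integral_mult_right i)
      qed
      finally have dE: "(E has_real_derivative 2 * f t * N + f t * \<mu> * \<Delta> - \<mu> * g * H - \<mu> * Q) (at t)"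
        using E'[OF t] by (simp add: E_def[abs_def])
      have d\<xi>: "(\<xi> has_real_derivative w t) (at t)" and dw: "(w has_real_derivative - f t) (at t)"
        and d\<zeta>: "(\<zeta> has_real_derivative - \<gamma> * \<zeta> t - \<gamma>\<^sup>2 * \<xi> t - f t) (at t)" using S t by blast+
      have de: "(e has_real_derivative - \<gamma> * e t) (at t)"
        unfolding e_def[abs_def] using d\<xi> dw d\<zeta>
        by (auto intro!: derivative_eq_intros simp: algebra_simps power2_eq_square)
      have dz: "((\<lambda>t. w t + k * \<xi> t) has_real_derivative - f t + k * w t) (at t)"
        using d\<xi> dw by (auto intro!: derivative_eq_intros)
      have sq: "((\<lambda>t. C * (u t)\<^sup>2) has_real_derivative 2 * C * u t * u') (at t)"
        if "(u has_real_derivative u') (at t)" for C u' and u :: "real \<Rightarrow> real"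
        using that by (auto intro!: derivative_eq_intros)
      define d where "d = 2 * f t * N + f t * \<mu> * \<Delta> - \<mu> * g * H - \<mu> * Q + 2 * (q * k\<^sup>2 / 2) * \<xi> t * w t
          + 2 * (q / 2) * z * (- f t + k * w t) + 2 * (\<sigma> * q\<^sup>2 / \<gamma>) * e t * (- \<gamma> * e t)"
      have dP: "(P has_real_derivative d) (at t)"
        unfolding P_def[abs_def] d_def z_def by (intro DERIV_add dE sq d\<xi> dz de)
      \<comment> \<open>The measured combination \<zeta> + (\<gamma> + k) \<xi> equals e + z: the
        control is the full-state feedback -\<sigma> Y perturbed by the observer error.\<close>
      have f: "f t = - \<sigma> * (Y - q * e t)"
        unfolding f_def feedback_def Y_def e_def z_def \<Delta>_def by (simp add: algebra_simps)
      have w: "w t = z - k * \<xi> t" by (simp add: z_def)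
      \<comment> \<open>The factor \<gamma> from the error dynamics cancels the 1/\<gamma> in the
        weight.\<close>
      have "2 * (\<sigma> * q\<^sup>2 / \<gamma>) * e t * (- \<gamma> * e t) = - 2 * \<sigma> * (q * e t)\<^sup>2"
        using par by (simp add: power2_eq_square)
      then have "d = - \<mu> * g * H - \<mu> * Q + f t * (2 * N + \<mu> * \<Delta> - q * z) + q * k\<^sup>2 * \<xi> t * w t + q * k * z * w t - 2 * \<sigma> * (q * e t)\<^sup>2"
        unfolding d_def by (simp add: algebra_simps)
      also have "\<dots> = - \<mu> * g * H - \<mu> * Q - q * k ^ 3 * (\<xi> t)\<^sup>2 + q * k * z\<^sup>2 - \<sigma> * (Y - q * e t) * (2 * N + Y) - 2 * \<sigma> * (q * e t)\<^sup>2"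
        unfolding w f Y_def by (simp add: algebra_simps power2_eq_square power3_eq_cube)
      also have "\<dots> \<le> - (\<mu> * g / 2 * H + \<mu> / 16 * Q + q * k ^ 3 * (\<xi> t)\<^sup>2 + \<sigma> / 100 * Y\<^sup>2 + \<sigma> / 100 * (q * e t)\<^sup>2)"
      proof (rule dissipation_inequality[OF pos(1-3) par(1-3) H_nonneg Q0 \<sigma>])
        show "\<Delta>\<^sup>2 \<le> L * H" unfolding \<Delta>_def using pos by (intro level_oscillation) auto
        show "8 / 5 * \<sigma> * N\<^sup>2 \<le> \<mu> * Q"
        proof -
          have "8 / 5 * \<sigma> * N\<^sup>2 \<le> 8 / 5 * \<sigma> * (m * b * L\<^sup>2 / (4 * a) * Q)"
            using vb(2) par by (intro mult_left_mono) auto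
          also have "\<dots> = (8 / 5 * \<sigma> * (m * b * L\<^sup>2 / (4 * a))) * Q" by simp
          also have "\<dots> \<le> \<mu> * Q" using margin Q0 by (rule mult_right_mono)
          finally show ?thesis .
        qed
      qed (rule Y_def)
      also have "\<dots> \<le> - (\<kappa> * P t)"
      proof -
        have "E t \<le> 3 / 2 * b * (L\<^sup>2 / (4 * a) * Q) + \<mu>\<^sup>2 / a * H + g * (L\<^sup>2 * H)"
        proof (rule order_trans[OF eb(4)])
          show "3 / 2 * b * integral {0..L} (\<lambda>x. (v t x)\<^sup>2) + \<mu>\<^sup>2 / a * H + g * integral {0..L} (\<lambda>x. (h t x - hs)\<^sup>2)
            \<le> 3 / 2 * b * (L\<^sup>2 / (4 * a) * Q) + \<mu>\<^sup>2 / a * H + g * (L\<^sup>2 * H)"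
            using ab pos vb(1) level_deviation_integral by (intro add_mono mult_left_mono) auto
        qed
        then have "E t \<le> C\<^sub>Q * Q + C\<^sub>H * H" by (simp add: C\<^sub>Q_def C\<^sub>H_def algebra_simps)
        moreover have "\<Delta>\<^sup>2 \<le> L * H" unfolding \<Delta>_def using pos by (intro level_oscillation) auto
        ultimately have "\<kappa> * (E t + q * k\<^sup>2 / 2 * (\<xi> t)\<^sup>2 + q / 2 * z\<^sup>2 + \<sigma> * q\<^sup>2 / \<gamma> * (e t)\<^sup>2)
          \<le> \<mu> * g / 2 * H + \<mu> / 16 * Q + q * k ^ 3 * (\<xi> t)\<^sup>2 + \<sigma> / 100 * Y\<^sup>2 + \<sigma> / 100 * (q * e t)\<^sup>2"
          by (rule \<kappa>(2)[OF _ _ Y_def H_nonneg Q0])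
        then show ?thesis unfolding P_def z_def[symmetric] by (rule le_imp_neg_le)
      qed
      finally show ?thesis using dP by auto
    qed

    have P0: "0 \<le> P 0" "P 0 < r'"
    proof -
      interpret level_profile L g \<mu> m hs "h 0" "hx 0" "v 0" using prof(1) by simp
      have "0 \<le> E 0" unfolding E_def fluid_energy_def
      proof (rule integral_nonneg[OF integrable_continuous_interval[OF cont_energy_density]])
        fix x assume "x \<in> {0..L}"
        then have "0 < h 0 x" by (rule h_pos)
        then show "0 \<le> energy_density g \<mu> hs (h 0 x) (hx 0 x) (v 0 x)"
          using pos by (simp add: energy_density_def)
      qed
      then show "0 \<le> P 0" using E_le[of 0] by simp
      show "P 0 < r'" using init r' \<Psi>_eq[of 0] by simp
    qed
    have contP: "continuous_on {0..} P"
    proof -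
      have vc: "continuous_on ({0..} \<times> {0..L}) (\<lambda>p. v (fst p) (snd p))"
        using S by (simp add: case_prod_beta)
      have nz: "h (fst p) (snd p) \<noteq> 0" if "p \<in> {0..} \<times> {0..L}" for p
        using level_profile.h_pos[OF prof(1), of "fst p" "snd p"] that by auto
      have "continuous_on ({0..} \<times> cbox 0 L) (\<lambda>(t, x). energy_density g \<mu> hs (h t x) (hx t x) (v t x))"
        unfolding energy_density_def case_prod_beta using hc hxc vc nz by (auto intro!: continuous_intros)
      from integral_continuous_on_param[OF this] have "continuous_on {0..} E"
        by (simp add: E_def[abs_def] fluid_energy_def)
      moreover have "continuous_on {0..} \<xi>"
      proof -
        have "Ck_on (Suc 0) {0..} \<xi>" using S by (metis One_nat_def)
        from Ck_on_SucD[OF this] show ?thesis by simp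
      qed
      moreover have "continuous_on {0..} w" "continuous_on {0..} \<zeta>" using S by simp_all
      ultimately show ?thesis unfolding P_def[abs_def] e_def[abs_def] by (intro continuous_intros)
    qed
    have decay: "P t \<le> exp (- \<kappa> * t) * P 0" if "0 \<le> t" for t
      using differential_inequality_decay[OF contP deriv P0 \<kappa>(1) that] by blast
    have P_le: "P t \<le> P 0" if "0 \<le> t" for t
    proof -
      have "exp (- \<kappa> * t) * P 0 \<le> 1 * P 0" using that \<kappa>(1) P0(1) by (intro mult_right_mono) auto
      then show ?thesis using decay[OF that] by simp
    qed
    have norm: "(X_norm L (\<xi> t, w t, level_dev L m (h t), v t))\<^sup>2 + (e t)\<^sup>2 \<le> A * P t"
      "P t \<le> A * ((X_norm L (\<xi> t, w t, level_dev L m (h t), v t))\<^sup>2 + (e t)\<^sup>2)" if t: "0 \<le> t" for t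
    proof -
      interpret level_profile L g \<mu> m hs "h t" "hx t" "v t" using prof(1) t by simp
      have lev: "\<And>x. x \<in> {0..L} \<Longrightarrow> a \<le> h t x \<and> h t x \<le> b"
        using level[of t] t P_le[OF t] P0(2) by simp
      note eb = fluid_energy_bounds[OF ab(1) lev, folded E_def]
      have nn: "0 \<le> integral {0..L} (\<lambda>x. (v t x)\<^sup>2)" "0 \<le> integral {0..L} (\<lambda>x. (h t x - hs)\<^sup>2)"
        by (intro integral_nonneg integrable_continuous_interval continuous_on_power continuous_on_diff
            continuous_on_const cont_h cont_v; simp)+
      show "(X_norm L (\<xi> t, w t, level_dev L m (h t), v t))\<^sup>2 + (e t)\<^sup>2 \<le> A * P t"
        "P t \<le> A * ((X_norm L (\<xi> t, w t, level_dev L m (h t), v t))\<^sup>2 + (e t)\<^sup>2)"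
        using equiv[OF eb H_nonneg nn, of "\<xi> t" "w t" "e t"] unfolding X_norm_power2 P_def by auto
    qed
    define X where "X t = X_norm L (\<xi> t, w t, level_dev L m (h t), v t)" for t
    have X0: "0 \<le> X t" for t
      unfolding X_def X_norm.simps by (intro real_sqrt_ge_zero add_nonneg_nonneg zero_le_power2)
    have "(X t + \<bar>e t\<bar>)\<^sup>2 \<le> 2 * ((X t)\<^sup>2 + (e t)\<^sup>2)" using square_sum_le[of "X t" "\<bar>e t\<bar>"] by simp
    also have "\<dots> \<le> 2 * (A * P t)" using norm(1)[OF t] by (simp add: X_def)
    also have "\<dots> \<le> 2 * (A * (exp (- \<kappa> * t) * (A * ((X 0)\<^sup>2 + (e 0)\<^sup>2))))"
      using norm(2)[of 0] decay[OF t] A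
      by (intro mult_left_mono order_trans[OF decay[OF t]]) (auto simp: X_def)
    also have "\<dots> \<le> 2 * (A * (exp (- \<kappa> * t) * (A * (X 0 + \<bar>e 0\<bar>)\<^sup>2)))"
      using A X0[of 0] by (intro mult_left_mono) (auto simp: power2_sum)
    also have "\<dots> = (sqrt 2 * A * exp (- (\<kappa> / 2) * t) * (X 0 + \<bar>e 0\<bar>))\<^sup>2"
    proof -
      have "(exp (- (\<kappa> / 2) * t))\<^sup>2 = exp (- \<kappa> * t)" by (simp add: exp_double[symmetric])
      then show ?thesis by (simp add: power_mult_distrib power2_eq_square[of A])
    qed
    finally have "X t + \<bar>e t\<bar> \<le> sqrt 2 * A * exp (- (\<kappa> / 2) * t) * (X 0 + \<bar>e 0\<bar>)"
      by (rule power2_le_imp_le) (use A X0[of 0] in auto)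
    moreover have "(\<xi> t, w t, h t, v t) \<in> X_set L g \<mu> m Hmax q k"
      using prof(2)[OF t] V_le[OF t] P_le[OF t] \<Psi>_eq[of 0] init r(2) by (simp add: X_set_def)
    ultimately show "(\<xi> t, w t, h t, v t) \<in> X_set L g \<mu> m Hmax q k \<and>
        X_norm L (\<xi> t, w t, level_dev L m (h t), v t) + \<bar>\<zeta> t - w t + \<gamma> * \<xi> t\<bar>
        \<le> sqrt 2 * A * exp (- (\<kappa> / 2) * t) *
          (X_norm L (\<xi> 0, w 0, level_dev L m (h 0), v 0) + \<bar>\<zeta> 0 - w 0 + \<gamma> * \<xi> 0\<bar>)"
      unfolding X_def e_def by blast
  qed
  moreover have "0 < sqrt 2 * A" "0 < \<kappa> / 2" using A \<kappa>(1) by auto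
  ultimately show ?thesis by blast
qed

section \<open>The spill-free transfer\<close>

lemma (in level_profile) level_below_wall:
  assumes Hmax: "hs < Hmax" and E: "E < R_const L g \<mu> m Hmax" and x: "x \<in> {0..L}"
  shows "h x < Hmax"
proof (rule ccontr)
  assume "\<not> h x < Hmax"
  then have "G_fun L m Hmax \<le> G_fun L m (h x)"
    using G_fun_strict_mono[OF hs hs_pos, of Hmax "h x"] Hmax hs_pos by (cases "h x = Hmax") auto
  also have "\<dots> \<le> c_const g \<mu> * E" using G_fun_level_bound[OF x] by simp
  also have "\<dots> < c_const g \<mu> * R_const L g \<mu> m Hmax"
    using E pos by (intro mult_strict_left_mono) (auto simp: c_const_def)
  also have "\<dots> = 2 / 3 * (2 * hs * sqrt hs + sqrt Hmax * min (Hmax - 3 * hs) 0)"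
    unfolding hs using pos Hmax hs_pos by (intro R_const_bound(1)) auto
  \<comment> \<open>Dropping the minimum with 0 can only increase the bound, and what remains is
    exactly G at the wall height.\<close>
  also have "\<dots> \<le> 2 / 3 * (2 * hs * sqrt hs + sqrt Hmax * (Hmax - 3 * hs))"
    using Hmax hs_pos by (simp add: mult_left_mono)
  also have "\<dots> = G_fun L m Hmax"
    using G_fun_ge[OF hs hs_pos, of Hmax] Hmax by (simp add: algebra_simps)
  finally show False by simp
qed

text \<open>Budget for r, with d = \<epsilon>^2 K and x = q k^2 \<xi>0^2: E and the w0-part of the
  kinetic term use at most d, the position terms at most 3 x / 2, the observer term at most (r - d)
  / 2. The bound on k says x \<le> (r - d) / 3, and the bound on \<gamma> gives the last share; the
  sum is r.\<close>

lemma initial_energy_bound: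
  fixes \<epsilon> \<xi>0 w0 q \<sigma> k \<gamma> K r E U D H a b g \<mu> :: real
  assumes par: "0 < q" "0 < \<sigma>" "0 < k" "0 < \<gamma>" and q: "q \<le> K" and r: "\<epsilon>\<^sup>2 * K < r" and \<xi>0: "\<xi>0 \<noteq> 0"
    and \<gamma>: "\<gamma> \<ge> 2 * \<sigma> * q\<^sup>2 * \<epsilon>\<^sup>2 / (r - K * \<epsilon>\<^sup>2)"
    and k: "k \<le> sqrt (1 / (3 * q)) * (sqrt (r - \<epsilon>\<^sup>2 * K) / \<bar>\<xi>0\<bar>)"
    and E: "E \<le> 3 / 2 * b * U + \<mu>\<^sup>2 / a * H + g * D" and K: "3 / 2 * b \<le> K" "\<mu>\<^sup>2 / a \<le> K" "g \<le> K"
    and nn: "0 \<le> U" "0 \<le> H" "0 \<le> D" and \<epsilon>: "w0\<^sup>2 + D + H + U \<le> \<epsilon>\<^sup>2"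
  shows "E + q * k\<^sup>2 / 2 * \<xi>0\<^sup>2 + q / 2 * (w0 + k * \<xi>0)\<^sup>2 + \<sigma> * q\<^sup>2 / \<gamma> * w0\<^sup>2 \<le> r"
proof -
  have rK: "0 < r - \<epsilon>\<^sup>2 * K" using r by simp
  have "k * \<bar>\<xi>0\<bar> \<le> sqrt (1 / (3 * q)) * sqrt (r - \<epsilon>\<^sup>2 * K)"
    using mult_right_mono[OF k, of "\<bar>\<xi>0\<bar>"] \<xi>0 by simp
  then have "(k * \<bar>\<xi>0\<bar>)\<^sup>2 \<le> (sqrt (1 / (3 * q)) * sqrt (r - \<epsilon>\<^sup>2 * K))\<^sup>2"
    using par by (intro power_mono) auto
  also have "\<dots> = 1 / (3 * q) * (r - \<epsilon>\<^sup>2 * K)" using par rK by (simp add: power_mult_distrib)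
  finally have "q * (k\<^sup>2 * \<xi>0\<^sup>2) \<le> q * (1 / (3 * q) * (r - \<epsilon>\<^sup>2 * K))"
    using par by (intro mult_left_mono) (auto simp: power_mult_distrib)
  then have 1: "q * k\<^sup>2 * \<xi>0\<^sup>2 \<le> (r - \<epsilon>\<^sup>2 * K) / 3" using par by (simp add: mult.assoc)
  have w0: "w0\<^sup>2 \<le> \<epsilon>\<^sup>2" using \<epsilon> nn by simp
  have "2 * \<sigma> * q\<^sup>2 * \<epsilon>\<^sup>2 \<le> \<gamma> * (r - \<epsilon>\<^sup>2 * K)"
    using \<gamma> rK by (simp add: pos_divide_le_eq mult.commute[of K])
  then have "\<sigma> * q\<^sup>2 / \<gamma> * \<epsilon>\<^sup>2 \<le> (r - \<epsilon>\<^sup>2 * K) / 2" using par by (simp add: field_simps)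
  moreover have "\<sigma> * q\<^sup>2 / \<gamma> * w0\<^sup>2 \<le> \<sigma> * q\<^sup>2 / \<gamma> * \<epsilon>\<^sup>2" using w0 par by (intro mult_left_mono) auto
  ultimately have 2: "\<sigma> * q\<^sup>2 / \<gamma> * w0\<^sup>2 \<le> (r - \<epsilon>\<^sup>2 * K) / 2" by linarith
  have "q / 2 * (w0 + k * \<xi>0)\<^sup>2 \<le> q / 2 * (2 * w0\<^sup>2 + 2 * (k * \<xi>0)\<^sup>2)"
    using par square_sum_le by (intro mult_left_mono) auto
  also have "\<dots> = q * w0\<^sup>2 + q * k\<^sup>2 * \<xi>0\<^sup>2" by (simp add: power_mult_distrib algebra_simps)
  also have "q * w0\<^sup>2 \<le> K * w0\<^sup>2" using q by (intro mult_right_mono) auto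
  finally have 3: "q / 2 * (w0 + k * \<xi>0)\<^sup>2 \<le> K * w0\<^sup>2 + q * k\<^sup>2 * \<xi>0\<^sup>2" by simp
  have "E \<le> K * U + K * H + K * D"
    using E by (rule order_trans) (intro add_mono mult_right_mono K nn)
  then have "E + K * w0\<^sup>2 \<le> K * (w0\<^sup>2 + D + H + U)" by (simp add: algebra_simps)
  also have "\<dots> \<le> K * \<epsilon>\<^sup>2" using \<epsilon> q par by (intro mult_left_mono) auto
  finally have "E + K * w0\<^sup>2 \<le> \<epsilon>\<^sup>2 * K" by (simp add: mult.commute)
  moreover have "E + x / 2 + y + s \<le> r"
    if "E + p \<le> d" "x \<le> (r - d) / 3" "s \<le> (r - d) / 2" "y \<le> p + x" for p d x s y :: real
    using that by (simp add: field_simps)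
  ultimately have "E + q * k\<^sup>2 * \<xi>0\<^sup>2 / 2 + q / 2 * (w0 + k * \<xi>0)\<^sup>2 + \<sigma> * q\<^sup>2 / \<gamma> * w0\<^sup>2 \<le> r"
    using 1 2 3 by blast
  then show ?thesis by simp
qed

lemma X_norm_nonneg: "0 \<le> X_norm L s"
  by (cases s) (auto intro!: add_nonneg_nonneg)

lemma X_norm_position_le: "\<bar>\<xi>\<bar> \<le> X_norm L (\<xi>, w, h, v)"
  unfolding X_norm.simps by (rule real_le_rsqrt) simp

lemma X_norm_position_triangle: "X_norm L (\<xi>, w, h, v) \<le> \<bar>\<xi>\<bar> + X_norm L (0, w, h, v)"
  using sqrt_add_le_add_sqrt[of "\<xi>\<^sup>2" "w\<^sup>2 + (L2_norm L h)\<^sup>2 + (L2_norm L (weak_deriv L h))\<^sup>2 + (L2_norm L v)\<^sup>2"]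
  by (simp add: add.assoc)

lemma X_norm_velocity_le: "\<bar>w\<bar> \<le> X_norm L (\<xi>, w, h, v)"
  unfolding X_norm.simps by (rule real_le_rsqrt) simp

text \<open>The initial norm bounds H by \<epsilon>^2, so the level deviates from \<open>hs\<close>
  by at most \<epsilon> sqrt L; the condition on \<epsilon> keeps the resulting bounds positive and
  below H_max, and K dominates the energy coefficients. The observer start makes e(0) =
  -w(0).\<close>

lemma initial_lyapunov_bound:
  fixes L g \<mu> m Hmax \<epsilon> \<xi>0 hs K r q \<sigma> k \<gamma> :: real
  assumes pos: "0 < L" "0 < g" "0 < \<mu>" "0 < m"
    and hs: "hs = h_star L m"
    and K: "K = max (\<mu>\<^sup>2 * inverse (hs - \<epsilon> * sqrt L)) (max g (3 * Hmax / 2))"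
    and eps_pos: "0 < \<epsilon>" and eps_small: "\<epsilon> < min hs (Hmax - hs) / sqrt L"
    and xi0: "\<xi>0 \<noteq> 0"
    and par: "0 < q" "0 < \<sigma>" "0 < k" "0 < \<gamma>" and q: "q \<le> K" and r: "\<epsilon>\<^sup>2 * K < r"
    and \<gamma>: "\<gamma> \<ge> 2 * \<sigma> * q\<^sup>2 * \<epsilon>\<^sup>2 / (r - K * \<epsilon>\<^sup>2)"
    and k: "k \<le> sqrt (1 / (3 * q)) * (sqrt (r - \<epsilon>\<^sup>2 * K) / \<bar>\<xi>0\<bar>)"
    and prof: "level_profile L g \<mu> m hs h hx v"
    and \<epsilon>: "X_norm L (0, w, level_dev L m h, v) \<le> \<epsilon>"
  shows "\<Psi>_fun L g \<mu> m q \<sigma> k \<gamma> (\<xi>0, w, h, v) (- \<gamma> * \<xi>0) \<le> r"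
proof -
  interpret level_profile L g \<mu> m hs h hx v by (rule prof)
  define a b where "a = hs - \<epsilon> * sqrt L" and "b = hs + \<epsilon> * sqrt L"
  have "\<epsilon> * sqrt L < min hs (Hmax - hs)" using eps_small pos by (simp add: pos_less_divide_eq)
  then have ab: "0 < a" "b < Hmax" by (auto simp: a_def b_def)
  have nn: "0 \<le> integral {0..L} (\<lambda>x. (v x)\<^sup>2)" "0 \<le> integral {0..L} (\<lambda>x. (h x - hs)\<^sup>2)"
    by (intro integral_nonneg integrable_continuous_interval continuous_on_power continuous_on_diff
        continuous_on_const cont_h cont_v; simp)+
  have "(X_norm L (0, w, level_dev L m h, v))\<^sup>2 \<le> \<epsilon>\<^sup>2" using \<epsilon> X_norm_nonneg by (rule power_mono)
  then have X: "w\<^sup>2 + integral {0..L} (\<lambda>x. (h x - hs)\<^sup>2) + H + integral {0..L} (\<lambda>x. (v x)\<^sup>2) \<le> \<epsilon>\<^sup>2"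
    unfolding X_norm_power2 by simp
  then have H: "H \<le> \<epsilon>\<^sup>2" using nn zero_le_power2[of w] by linarith
  have lev: "a \<le> h x \<and> h x \<le> b" if "x \<in> {0..L}" for x
  proof -
    have "(h x - hs)\<^sup>2 \<le> L * \<epsilon>\<^sup>2"
      using level_deviation[OF that] mult_left_mono[OF H, of L] pos by linarith
    also have "\<dots> = (\<epsilon> * sqrt L)\<^sup>2" using pos by (simp add: power_mult_distrib)
    finally have "\<bar>h x - hs\<bar> \<le> \<epsilon> * sqrt L"
      using eps_pos pos by (simp add: abs_le_square_iff[symmetric])
    then show ?thesis by (auto simp: a_def b_def abs_le_iff)
  qed
  have "\<Psi>_fun L g \<mu> m q \<sigma> k \<gamma> (\<xi>0, w, h, v) (- \<gamma> * \<xi>0) =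
      E + q * k\<^sup>2 / 2 * \<xi>0\<^sup>2 + q / 2 * (w + k * \<xi>0)\<^sup>2 + \<sigma> * q\<^sup>2 / \<gamma> * w\<^sup>2"
    unfolding \<Psi>_fun.simps V_fun_eq by simp
  also have "\<dots> \<le> r"
  proof (rule initial_energy_bound[OF par q r xi0 \<gamma> k fluid_energy_bounds(4)[OF ab(1) lev] _ _ _ nn(1) H_nonneg nn(2) X])
    show "3 / 2 * b \<le> K" using ab(2) by (simp add: K)
    show "\<mu>\<^sup>2 / a \<le> K" by (simp add: K a_def divide_inverse[symmetric] max_def)
    show "g \<le> K" by (simp add: K)
  qed
  finally show ?thesis .
qed

text \<open>T is the solution of the displayed equation; for M \<ge> 1 the argument of the logarithm
  is at least 2.\<close>

lemma transfer_conclusion: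
  fixes M \<phi> T \<epsilon> \<xi>0 :: real
  assumes "0 < M" "0 < \<phi>" "0 < \<epsilon>" and T: "T = 1 / \<phi> * ln ((M * \<bar>\<xi>0\<bar> + 2 * M * \<epsilon>) / \<epsilon>)"
  shows "M * exp (- \<phi> * T) * (\<bar>\<xi>0\<bar> + 2 * \<epsilon>) = \<epsilon>" "1 \<le> M \<Longrightarrow> 0 \<le> T"
proof -
  have s: "0 < M * \<bar>\<xi>0\<bar> + 2 * M * \<epsilon>" using assms by (intro add_nonneg_pos) auto
  have "exp (- \<phi> * T) = inverse ((M * \<bar>\<xi>0\<bar> + 2 * M * \<epsilon>) / \<epsilon>)"
    using assms s by (simp add: T exp_minus)
  then have "M * exp (- \<phi> * T) * (\<bar>\<xi>0\<bar> + 2 * \<epsilon>) = \<epsilon> * ((M * \<bar>\<xi>0\<bar> + 2 * M * \<epsilon>) / (M * \<bar>\<xi>0\<bar> + 2 * M * \<epsilon>))"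
    by (simp add: field_simps)
  then show "M * exp (- \<phi> * T) * (\<bar>\<xi>0\<bar> + 2 * \<epsilon>) = \<epsilon>" using s by simp
  assume M: "1 \<le> M"
  have "\<epsilon> \<le> 2 * M * \<epsilon>" using M assms(3) by simp
  also have "\<dots> \<le> M * \<bar>\<xi>0\<bar> + 2 * M * \<epsilon>" using assms by simp
  finally have "1 \<le> (M * \<bar>\<xi>0\<bar> + 2 * M * \<epsilon>) / \<epsilon>" using assms(3) by simp
  then show "0 \<le> T" using assms(2) by (simp add: T)
qed

theorem mainTheorem5:
  fixes L g \<mu> m Hmax \<epsilon> \<xi>0 hs c R K :: real
  assumes pos: "0 < L" "0 < g" "0 < \<mu>" "0 < m" "0 < Hmax"
    and hs: "hs = h_star L m"
    and c: "c = c_const g \<mu>"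
    and R: "R = R_const L g \<mu> m Hmax"
    and K: "K = max (\<mu>\<^sup>2 * inverse (hs - \<epsilon> * sqrt L)) (max g (3 * Hmax / 2))"
    and hs_less: "hs < Hmax"
    and eps_pos: "0 < \<epsilon>"
    and eps_R: "\<epsilon>\<^sup>2 * K < R"
    and eps_small: "\<epsilon> < min hs (Hmax - hs) / sqrt L"
    and xi0: "\<xi>0 \<noteq> 0"
  shows
    "(\<exists>r q. 0 < r \<and> r < R \<and> 0 < q \<and> q \<le> K \<and> \<epsilon>\<^sup>2 * K < r) \<and>
     (\<forall>r q \<sigma> k \<gamma>.
        0 < r \<and> r < R \<and> 0 < q \<and> q \<le> K \<and> \<epsilon>\<^sup>2 * K < r \<and>
        0 < \<sigma> \<and> 0 < k \<and> 0 < \<gamma> \<and>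
        2 * g / (\<mu> * L) > \<sigma> \<and> \<sigma> > 8 * k / q \<and>
        2 * pi\<^sup>2 * \<mu> * G_inv L m (- c * r) / (m * L\<^sup>2 * G_inv L m (c * r)) > 8 * \<sigma> \<and>
        \<gamma> \<ge> 2 * \<sigma> * q\<^sup>2 * \<epsilon>\<^sup>2 / (r - K * \<epsilon>\<^sup>2) \<and>
        k \<le> sqrt (1 / (3 * q)) * (sqrt (r - \<epsilon>\<^sup>2 * K) / \<bar>\<xi>0\<bar>) \<longrightarrow>
        (\<exists>M \<phi>. 0 < M \<and> 0 < \<phi> \<and> exp_decay_property L g \<mu> m Hmax r q \<sigma> k \<gamma> M \<phi>) \<and>
        (\<forall>M \<phi> T.
           0 < M \<and> 0 < \<phi> \<and> exp_decay_property L g \<mu> m Hmax r q \<sigma> k \<gamma> M \<phi> \<and>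
           T = 1 / \<phi> * ln ((M * \<bar>\<xi>0\<bar> + 2 * M * \<epsilon>) / \<epsilon>) \<longrightarrow>
           (\<forall>\<xi> w h v \<zeta>.
              classical_solution L g \<mu> m q \<sigma> k \<gamma> \<xi> w h v \<zeta> \<and>
              (\<xi> 0, w 0, h 0, v 0) \<in> S_set L m \<and>
              \<xi> 0 = \<xi>0 \<and> \<zeta> 0 = - \<gamma> * \<xi>0 \<and>
              X_norm L (0, w 0, level_dev L m (h 0), v 0) \<le> \<epsilon> \<longrightarrow>
              \<Psi>_fun L g \<mu> m q \<sigma> k \<gamma> (\<xi> 0, w 0, h 0, v 0) (\<zeta> 0) \<le> r \<and>
              X_norm L (\<xi> T, w T, level_dev L m (h T), v T)
                \<le> M * exp (- \<phi> * T) * (\<bar>\<xi>0\<bar> + 2 * \<epsilon>) \<and>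
              M * exp (- \<phi> * T) * (\<bar>\<xi>0\<bar> + 2 * \<epsilon>) = \<epsilon> \<and>
              (\<forall>t\<in>{0..T}. max (h t 0) (h t L) < Hmax))))"
proof (intro conjI allI impI)
  have K0: "0 < K" "g \<le> K" using pos by (auto simp: K)
  show "\<exists>r q. 0 < r \<and> r < R \<and> 0 < q \<and> q \<le> K \<and> \<epsilon>\<^sup>2 * K < r"
  proof (intro exI conjI)
    have "0 < \<epsilon>\<^sup>2 * K" using K0 eps_pos by simp
    \<comment> \<open>The witness for r is the midpoint between \<epsilon>^2 K and R; the witness
      for q is K itself, fixed by unification below.\<close>
    then show "0 < (\<epsilon>\<^sup>2 * K + R) / 2" "(\<epsilon>\<^sup>2 * K + R) / 2 < R" "\<epsilon>\<^sup>2 * K < (\<epsilon>\<^sup>2 * K + R) / 2"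
      using eps_R by (auto simp: mult.commute)
  qed (rule K0 order_refl)+
next
  fix r q \<sigma> k \<gamma>
  assume "0 < r \<and> r < R \<and> 0 < q \<and> q \<le> K \<and> \<epsilon>\<^sup>2 * K < r \<and>
        0 < \<sigma> \<and> 0 < k \<and> 0 < \<gamma> \<and>
        2 * g / (\<mu> * L) > \<sigma> \<and> \<sigma> > 8 * k / q \<and>
        2 * pi\<^sup>2 * \<mu> * G_inv L m (- c * r) / (m * L\<^sup>2 * G_inv L m (c * r)) > 8 * \<sigma> \<and>
        \<gamma> \<ge> 2 * \<sigma> * q\<^sup>2 * \<epsilon>\<^sup>2 / (r - K * \<epsilon>\<^sup>2) \<and>
        k \<le> sqrt (1 / (3 * q)) * (sqrt (r - \<epsilon>\<^sup>2 * K) / \<bar>\<xi>0\<bar>)"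
  then have r: "0 < r" "r < R" and q: "0 < q" "q \<le> K" and \<epsilon>r: "\<epsilon>\<^sup>2 * K < r"
    and par: "0 < \<sigma>" "0 < k" "0 < \<gamma>" and \<sigma>: "\<sigma> < 2 * g / (\<mu> * L)" "8 * k / q < \<sigma>"
    and \<sigma>G: "2 * pi\<^sup>2 * \<mu> * G_inv L m (- c * r) / (m * L\<^sup>2 * G_inv L m (c * r)) > 8 * \<sigma>"
    and \<gamma>: "\<gamma> \<ge> 2 * \<sigma> * q\<^sup>2 * \<epsilon>\<^sup>2 / (r - K * \<epsilon>\<^sup>2)"
    and k: "k \<le> sqrt (1 / (3 * q)) * (sqrt (r - \<epsilon>\<^sup>2 * K) / \<bar>\<xi>0\<bar>)" by blast+
  show "\<exists>M \<phi>. 0 < M \<and> 0 < \<phi> \<and> exp_decay_property L g \<mu> m Hmax r q \<sigma> k \<gamma> M \<phi>"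
    by (rule exponential_decay[OF pos hs r(1) r(2)[unfolded R] q(1) par \<sigma> \<sigma>G[unfolded c]])
  fix M \<phi> T \<xi> w h v \<zeta>
  assume "0 < M \<and> 0 < \<phi> \<and> exp_decay_property L g \<mu> m Hmax r q \<sigma> k \<gamma> M \<phi> \<and>
           T = 1 / \<phi> * ln ((M * \<bar>\<xi>0\<bar> + 2 * M * \<epsilon>) / \<epsilon>)"
  then have M: "0 < M" "0 < \<phi>" and decay: "exp_decay_property L g \<mu> m Hmax r q \<sigma> k \<gamma> M \<phi>"
    and T: "T = 1 / \<phi> * ln ((M * \<bar>\<xi>0\<bar> + 2 * M * \<epsilon>) / \<epsilon>)" by blast+
  assume "classical_solution L g \<mu> m q \<sigma> k \<gamma> \<xi> w h v \<zeta> \<and>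
              (\<xi> 0, w 0, h 0, v 0) \<in> S_set L m \<and>
              \<xi> 0 = \<xi>0 \<and> \<zeta> 0 = - \<gamma> * \<xi>0 \<and>
              X_norm L (0, w 0, level_dev L m (h 0), v 0) \<le> \<epsilon>"
  then have sol: "classical_solution L g \<mu> m q \<sigma> k \<gamma> \<xi> w h v \<zeta>"
    and init: "\<xi> 0 = \<xi>0" "\<zeta> 0 = - \<gamma> * \<xi>0"
    and X_init: "X_norm L (0, w 0, level_dev L m (h 0), v 0) \<le> \<epsilon>" by blast+
  obtain hx where
    hx: "\<And>t x. 0 \<le> t \<Longrightarrow> x \<in> {0..L} \<Longrightarrow> (h t has_real_derivative hx t x) (at x within {0..L})"
    and hxc: "continuous_on ({0..} \<times> {0..L}) (\<lambda>p. hx (fst p) (snd p))"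
    by (rule classical_solution_energy[OF pos(1-3) sol]) (rule that)
  have prof: "level_profile L g \<mu> m hs (h t) (hx t) (v t)" if "0 \<le> t" for t
  proof (rule classical_solution_profile(1)[OF pos(1-4) hs sol that hx[OF that]])
    have "continuous_on {0..L} (\<lambda>x. hx (fst (t, x)) (snd (t, x)))"
      by (rule continuous_on_compose2[OF hxc]) (use that in \<open>auto intro!: continuous_intros\<close>)
    then show "continuous_on {0..L} (hx t)" by simp
  qed
  show \<Psi>0: "\<Psi>_fun L g \<mu> m q \<sigma> k \<gamma> (\<xi> 0, w 0, h 0, v 0) (\<zeta> 0) \<le> r"
    unfolding init
    by (rule initial_lyapunov_bound[OF pos(1-4) hs K eps_pos eps_small xi0 q(1) par q(2) \<epsilon>r \<gamma> k prof X_init]) simp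
  note D = decay[unfolded exp_decay_property_def, rule_format, OF sol \<Psi>0]
  define N0 where "N0 = X_norm L (\<xi> 0, w 0, level_dev L m (h 0), v 0) + \<bar>\<zeta> 0 - w 0 + \<gamma> * \<xi> 0\<bar>"
  \<comment> \<open>A nonzero initial displacement makes N0 positive, so (P') at t = 0, which reads
    N0 \<le> M N0, forces M \<ge> 1.\<close>
  have "\<bar>\<xi>0\<bar> \<le> N0" using X_norm_position_le[of "\<xi> 0"] by (simp add: N0_def init del: X_norm.simps add: add_increasing2)
  then have N0: "0 < N0" using xi0 by linarith
  have "N0 \<le> M * N0" using D[of 0] by (simp add: N0_def del: X_norm.simps)
  then have M1: "1 \<le> M" using N0 by simp
  note concl = transfer_conclusion[OF M eps_pos T]
  have T0: "0 \<le> T" by (rule concl(2)[OF M1])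
  show "M * exp (- \<phi> * T) * (\<bar>\<xi>0\<bar> + 2 * \<epsilon>) = \<epsilon>" by (rule concl(1))
  \<comment> \<open>With the prescribed observer start the initial error is -w(0), which costs a
    second \<epsilon> besides the one bounding the rest of the state.\<close>
  have "\<bar>w 0\<bar> \<le> \<epsilon>" using X_norm_velocity_le X_init by (rule order_trans)
  then have N0_le: "N0 \<le> \<bar>\<xi>0\<bar> + 2 * \<epsilon>"
    using X_norm_position_triangle[of L \<xi>0 "w 0" "level_dev L m (h 0)" "v 0"] X_init
    unfolding N0_def init by (simp del: X_norm.simps)
  have "X_norm L (\<xi> T, w T, level_dev L m (h T), v T) \<le> M * exp (- \<phi> * T) * N0"
    using D[OF T0] unfolding N0_def by linarith
  also have "\<dots> \<le> M * exp (- \<phi> * T) * (\<bar>\<xi>0\<bar> + 2 * \<epsilon>)"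
    using N0_le M by (intro mult_left_mono) auto
  finally show "X_norm L (\<xi> T, w T, level_dev L m (h T), v T) \<le> M * exp (- \<phi> * T) * (\<bar>\<xi>0\<bar> + 2 * \<epsilon>)" .
  show "\<forall>t\<in>{0..T}. max (h t 0) (h t L) < Hmax"
  proof
    fix t assume "t \<in> {0..T}"
    then have t: "0 \<le> t" by simp
    interpret level_profile L g \<mu> m hs "h t" "hx t" "v t" by (rule prof[OF t])
    have "V_fun L g \<mu> m q k (\<xi> t, w t, h t, v t) < R" using D[OF t] by (simp add: X_set_def R)
    moreover have "0 \<le> q * k\<^sup>2 / 2 * (\<xi> t)\<^sup>2" "0 \<le> q / 2 * (w t + k * \<xi> t)\<^sup>2" using q(1) by auto
    ultimately have "E < R_const L g \<mu> m Hmax" unfolding V_fun_eq R by linarith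
    then show "max (h t 0) (h t L) < Hmax"
      using level_below_wall[OF hs_less] pos(1) by simp
  qed
qed

end
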